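(* The parameterized factorization problem, the parameterized knapsack problem and the parameterized subset sum problem for symmetric groups are equivalent with respect to fpt-reductions: $\mathsf{pF}[\mathsf{S}_*]\equiv^{\mathsf{fpt}}\mathsf{pKS}[\mathsf{S}_*]\equiv^{\mathsf{fpt}}\mathsf{pSSS}[\mathsf{S}_*]$.
   Context: $\mathbb{N}$ includes $0$. A parameterized problem is a subset $L\subseteq\Sigma^*\times\mathbb{N}$ for a finite alphabet $\Sigma$; in $(u,k)$ the number $k$ is the parameter. An fpt-reduction from $L_1\subseteq\Sigma_1^*\times\mathbb{N}$ to $L_2\subseteq\Sigma_2^*\times\mathbb{N}$ is a computable function $r:\Sigma_1^*\times\mathbb{N}\to\Sigma_2^*\times\mathbb{N}$ such that: $r(u,k)=(g(u,k),h(k))$ for some functions $g,h$; $r(u,k)$ can be computed in time $\mathrm{poly}(|u|)\cdot f(k)$ for some computable $f:\mathbb{N}\to\mathbb{N}$; and $(u,k)\in L_1$ iff $r(u,k)\in L_2$. Write $L_1\leq^{\mathsf{fpt}}L_2$ if such a reduction exists, and $L_1\equiv^{\mathsf{fpt}}L_2$ if $L_1\leq^{\mathsf{fpt}}L_2\leq^{\mathsf{fpt}}L_1$. $S_n$ is the group of all permutations of $[1,n]$, with products evaluated from left to right: $(fg)(a)=g(f(a))$. For a subset $A$ of a monoid, $A^k$ is the set of all products of exactly $k$ elements of $A$ (repetitions allowed). All three problems have as input: $n\geq1$ in unary, permutations $a,a_1,\dots,a_m\in S_n$ (each $f\in S_n$ given by the list $f(1),\dots,f(n)$), and $k\in\mathbb{N}$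 (the parameter). The questions are: - $\mathsf{pF}[\mathsf{S}_*]$: is $a\in\{a_1,\dots,a_m\}^k$? - $\mathsf{pKS}[\mathsf{S}_*]$: are there $x_1,\dots,x_m\in\mathbb{N}$ with $\sum_{i=1}^m x_i=k$ and $a=a_1^{x_1}\cdots a_m^{x_m}$? - $\mathsf{pSSS}[\mathsf{S}_*]$: are there $x_1,\dots,x_m\in\{0,1\}$ with $\sum_{i=1}^m x_i=k$ and $a=a_1^{x_1}\cdots a_m^{x_m}$? *)

theory Defs
  imports
    "HOL-Algebra.Sym_Groups"
    "HOL-Computational_Algebra.Polynomial"
    "HOL-Library.Countable"
begin

section \<open>Deterministic multitape Turing machines\<close>

text \<open>
  States and tape symbols are initial segments of the natural numbers. The symbol 0 is the blank,
  state 0 is initial, and the only halting state is \<open>num_states\<close>. Tapes are infinite in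
  both directions.
\<close>

datatype move = MoveLeft | Stay | MoveRight

record tm =
  num_tapes :: nat
  num_states :: nat
  num_symbols :: nat
  delta :: "nat \<Rightarrow> nat list \<Rightarrow> nat \<times> (nat \<times> move) list"

definition wf_tm :: "tm \<Rightarrow> bool" where
  "wf_tm M \<longleftrightarrow> 0 < num_symbols M \<and>
    (\<forall>q < num_states M. \<forall>ss. length ss = num_tapes M \<and> set ss \<subseteq> {..<num_symbols M} \<longrightarrow>
      (case delta M q ss of (q', as) \<Rightarrow>
        q' \<le> num_states M \<and> length as = num_tapes M \<and> fst ` set as \<subseteq> {..<num_symbols M}))"

text \<open>A tape is its content together with the position of the head.\<close>

type_synonym tape = "(int \<Rightarrow> nat) \<times> int"
type_synonym config = "nat \<times> tape list"

fun read_tape :: "tape \<Rightarrow> nat" where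
  "read_tape (c, h) = c h"

fun move_head :: "move \<Rightarrow> int \<Rightarrow> int" where
  "move_head MoveLeft h = h - 1"
| "move_head Stay h = h"
| "move_head MoveRight h = h + 1"

fun act_tape :: "nat \<times> move \<Rightarrow> tape \<Rightarrow> tape" where
  "act_tape (s, d) (c, h) = (c(h := s), move_head d h)"

definition step :: "tm \<Rightarrow> config \<Rightarrow> config" where
  "step M cfg = (case cfg of (q, ts) \<Rightarrow>
    if q < num_states M then
      (case delta M q (map read_tape ts) of (q', as) \<Rightarrow> (q', map2 act_tape as ts))
    else cfg)"

definition word_content :: "nat list \<Rightarrow> int \<Rightarrow> nat" where
  "word_content w i = (if 0 \<le> i \<and> i < int (length w) then w ! nat i else 0)"

definition init_config :: "tm \<Rightarrow> nat list list \<Rightarrow> config" where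
  "init_config M ws =
    (0, map (\<lambda>w. (word_content w, 0)) (ws @ replicate (num_tapes M - length ws) []))"

text \<open>The output on a tape is read from cell 0 up to the first blank.\<close>

definition tape_holds :: "tape \<Rightarrow> nat list \<Rightarrow> bool" where
  "tape_holds t w \<longleftrightarrow> (\<forall>i < length w. fst t (int i) = w ! i) \<and> 0 \<notin> set w \<and> fst t (int (length w)) = 0"

text \<open>
  Started on the words \<open>ws\<close> (the \<open>i\<close>-th word on the \<open>i\<close>-th tape), the machine halts
  within \<open>t\<close> steps with the words \<open>vs\<close> on its first tapes. Since \<open>wf_tm\<close> restricts
  \<open>delta\<close> on tape symbols only, the input has to be written in the alphabet of the machine.
\<close>

definition tm_computes :: "tm \<Rightarrow> nat list list \<Rightarrow> nat list list \<Rightarrow> nat \<Rightarrow> bool" where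
  "tm_computes M ws vs t \<longleftrightarrow>
    length ws \<le> num_tapes M \<and> length vs \<le> num_tapes M \<and>
    (\<forall>w \<in> set ws. set w \<subseteq> {..<num_symbols M}) \<and>
    (case (step M ^^ t) (init_config M ws) of (q, ts) \<Rightarrow>
      q = num_states M \<and> (\<forall>i < length vs. tape_holds (ts ! i) (vs ! i)))"

text \<open>
  Words over an arbitrary finite alphabet are written with an injective numbering of the letters
  that avoids the blank; natural numbers are written in unary.
\<close>

definition tape_word :: "'a::finite list \<Rightarrow> nat list" where
  "tape_word u = map (\<lambda>x. Suc (to_nat x)) u"

definition tape_num :: "nat \<Rightarrow> nat list" where
  "tape_num k = replicate k 1"

definition computable_fun :: "(nat \<Rightarrow> nat) \<Rightarrow> bool" where
  "computable_fun f \<longleftrightarrow>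
    (\<exists>M. wf_tm M \<and> (\<forall>k. \<exists>t. tm_computes M [tape_num k] [tape_num (f k)] t))"


section \<open>Parameterized problems and fpt-reductions\<close>

type_synonym 'a param_problem = "('a list \<times> nat) set"

text \<open>
  The word and the parameter are placed on separate tapes. The unary notation for the parameter is
  immaterial, since it affects the running time by a computable function of the parameter only.
\<close>

definition fpt_computable ::
  "('a::finite list \<times> nat \<Rightarrow> 'b::finite list \<times> nat) \<Rightarrow> bool" where
  "fpt_computable r \<longleftrightarrow>
    (\<exists>M (p :: nat poly) f. wf_tm M \<and> computable_fun f \<and>
      (\<forall>u k. tm_computes M [tape_word u, tape_num k]
        [tape_word (fst (r (u, k))), tape_num (snd (r (u, k)))]
        (poly p (length u) * f k)))"

definition fpt_reduction ::
  "('a::finite list \<times> nat \<Rightarrow> 'b::finite list \<times> nat) \<Rightarrow>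
    'a param_problem \<Rightarrow> 'b param_problem \<Rightarrow> bool" where
  "fpt_reduction r L1 L2 \<longleftrightarrow>
    (\<exists>g h. \<forall>u k. r (u, k) = (g (u, k), h k)) \<and>
    fpt_computable r \<and>
    (\<forall>u k. (u, k) \<in> L1 \<longleftrightarrow> r (u, k) \<in> L2)"

definition fpt_le :: "'a::finite param_problem \<Rightarrow> 'b::finite param_problem \<Rightarrow> bool"
    (infix "\<le>fpt" 50) where
  "L1 \<le>fpt L2 \<longleftrightarrow> (\<exists>r. fpt_reduction r L1 L2)"

definition fpt_equiv :: "'a::finite param_problem \<Rightarrow> 'b::finite param_problem \<Rightarrow> bool"
    (infix "\<equiv>fpt" 50) where
  "L1 \<equiv>fpt L2 \<longleftrightarrow> L1 \<le>fpt L2 \<and> L2 \<le>fpt L1"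


section \<open>The problems for symmetric groups\<close>

text \<open>The product of \<open>sym_group\<close> is composition, which applies the right factor first.\<close>

definition sym_lr :: "nat \<Rightarrow> (nat \<Rightarrow> nat) monoid" where
  "sym_lr n = (sym_group n)\<lparr>mult := \<lambda>f g. g \<circ> f\<rparr>"

definition list_product :: "('g, 'm) monoid_scheme \<Rightarrow> 'g list \<Rightarrow> 'g" where
  "list_product G xs = foldr (\<otimes>\<^bsub>G\<^esub>) xs \<one>\<^bsub>G\<^esub>"

definition set_power :: "('g, 'm) monoid_scheme \<Rightarrow> 'g set \<Rightarrow> nat \<Rightarrow> 'g set" where
  "set_power G A k = {list_product G xs | xs. length xs = k \<and> set xs \<subseteq> A}"

definition power_product :: "('g, 'm) monoid_scheme \<Rightarrow> 'g list \<Rightarrow> (nat \<Rightarrow> nat) \<Rightarrow> 'g" where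
  "power_product G as x = list_product G (map (\<lambda>i. as ! i [^]\<^bsub>G\<^esub> x i) [0..<length as])"

datatype letter = Stroke | Comma | Hash

instance letter :: finite
proof
  have "(UNIV :: letter set) = {Stroke, Comma, Hash}"
    using letter.exhaust by auto
  then show "finite (UNIV :: letter set)"
    by (metis finite.emptyI finite_insert)
qed

text \<open>
  As \<open>n\<close> is given in unary, writing the values of the permutations in unary as well changes the
  length of an instance only polynomially.
\<close>

definition enc_perm :: "nat \<Rightarrow> (nat \<Rightarrow> nat) \<Rightarrow> letter list" where
  "enc_perm n f = concat (map (\<lambda>i. replicate (f i) Stroke @ [Comma]) [1..<Suc n]) @ [Hash]"

definition enc_instance :: "nat \<Rightarrow> (nat \<Rightarrow> nat) \<Rightarrow> (nat \<Rightarrow> nat) list \<Rightarrow> letter list" where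
  "enc_instance n a as =
    replicate n Stroke @ [Hash] @ enc_perm n a @ concat (map (enc_perm n) as)"

definition pF_sym :: "letter param_problem" where
  "pF_sym = {(enc_instance n a as, k) | n a as k.
    1 \<le> n \<and> a \<in> carrier (sym_lr n) \<and> set as \<subseteq> carrier (sym_lr n) \<and>
    a \<in> set_power (sym_lr n) (set as) k}"

definition pKS_sym :: "letter param_problem" where
  "pKS_sym = {(enc_instance n a as, k) | n a as k.
    1 \<le> n \<and> a \<in> carrier (sym_lr n) \<and> set as \<subseteq> carrier (sym_lr n) \<and>
    (\<exists>x :: nat \<Rightarrow> nat. (\<Sum>i<length as. x i) = k \<and> a = power_product (sym_lr n) as x)}"

definition pSSS_sym :: "letter param_problem" where
  "pSSS_sym = {(enc_instance n a as, k) | n a as k.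
    1 \<le> n \<and> a \<in> carrier (sym_lr n) \<and> set as \<subseteq> carrier (sym_lr n) \<and>
    (\<exists>x :: nat \<Rightarrow> nat. (\<forall>i<length as. x i \<in> {0, 1}) \<and> (\<Sum>i<length as. x i) = k \<and>
      a = power_product (sym_lr n) as x)}"

end

theory Submission
  imports Defs
begin

text \<open>
  All three problems ask for an index list of length \<open>k\<close> whose product is \<open>a\<close>: an arbitrary list for
  \<open>pF\<close>, a sorted one for \<open>pKS\<close>, a strictly sorted one for \<open>pSSS\<close>. Listing the generators \<open>k\<close> times
  makes every index list realisable by a strictly sorted one, which reduces \<open>pF\<close> to the other two.
  Conversely, an order is enforced in \<open>pF\<close> by letting the generators act on additional points: a
  generator \<open>(j, i, i')\<close> contributes \<open>a\<^sub>i\<close> as the \<open>j\<close>-th factor and announces the index \<open>i'\<close>, at least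
  \<open>i\<close> (or \<open>i + 1\<close>), of the next factor. Prescribing the action on the additional points ensures
  that every label \<open>j\<close> occurs once, in increasing order, and that the announced indices are the ones
  used. All reductions keep the parameter.

  For the running times, the output words are written in a small language of word expressions with
  bounded loops. It is closed under composition, and a compositional compiler to Turing machines that
  use their tapes as stacks shows that each of its expressions is evaluated in polynomial time.
\<close>

section \<open>Structured Turing machine programs\<close>

text \<open>A product of group elements is compared with the target for equality only. The
  inequality between neighbouring indices is therefore put into the choice of the generators, each
  of which carries two indices, and the group merely tests that the second index of a factor is the
  first index of its successor. The token works by counting: a factor moves it by at most one cell,
  so \<open>k\<close> factors cover the distance \<open>k\<close> only if no step is wasted. For
  \<open>m\<close> given generators this takes at most \<open>k * m * (m + 1)\<close> new ones on
  \<open>n + k + 1 + k * (m + 1)\<close> points, which is polynomial in the length of the instance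
  and \<open>k\<close>. Knapsack and subset sum are compared through factorization, never directly.
  Words that encode no instance have to be reduced too: they are recognised by decoding and
  re-encoding, and are sent to the empty word, which lies in none of the problems. A time bound
  \<open>(|u| + k + 2) ^ c\<close> is split into a factor in \<open>|u|\<close> and a factor in
  \<open>k\<close>.\<close>

datatype cmd =
    Act "nat list \<Rightarrow> (nat \<times> move) list"
  | Seq cmd cmd
  | Cond "nat list \<Rightarrow> bool" cmd cmd
  | Loop "nat list \<Rightarrow> bool" cmd

text \<open>Termination is built in: only finite runs have a derivation. A test costs one step
  because \<open>control\<close> spends a state on it.\<close>

inductive exec :: "cmd \<Rightarrow> tape list \<Rightarrow> nat \<Rightarrow> tape list \<Rightarrow> bool" where
  Act: "exec (Act f) ts 1 (map2 act_tape (f (map read_tape ts)) ts)"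
| Seq: "exec a ts m ts' \<Longrightarrow> exec b ts' n ts'' \<Longrightarrow> exec (Seq a b) ts (m + n) ts''"
| CondT: "P (map read_tape ts) \<Longrightarrow> exec a ts m ts' \<Longrightarrow> exec (Cond P a b) ts (Suc m) ts'"
| CondF: "\<not> P (map read_tape ts) \<Longrightarrow> exec b ts m ts' \<Longrightarrow> exec (Cond P a b) ts (Suc m) ts'"
| LoopF: "\<not> P (map read_tape ts) \<Longrightarrow> exec (Loop P a) ts 1 ts"
| LoopT: "P (map read_tape ts) \<Longrightarrow> exec a ts m ts' \<Longrightarrow> exec (Loop P a) ts' n ts''
    \<Longrightarrow> exec (Loop P a) ts (Suc (m + n)) ts''"

definition idle :: "nat list \<Rightarrow> (nat \<times> move) list" where
  "idle ss = map (\<lambda>s. (s, Stay)) ss"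

lemma length_idle [simp]: "length (idle ss) = length ss"
  by (simp add: idle_def)

fun states :: "cmd \<Rightarrow> nat" where
  "states (Act f) = 1"
| "states (Seq a b) = states a + states b"
| "states (Cond P a b) = Suc (states a + states b)"
| "states (Loop P a) = Suc (states a)"

text \<open>The code of a command occupies the states from \<open>s\<close> on and leaves for state \<open>x\<close>.\<close>

fun control :: "cmd \<Rightarrow> nat \<Rightarrow> nat \<Rightarrow> nat \<Rightarrow> nat list \<Rightarrow> nat \<times> (nat \<times> move) list" where
  "control (Act f) s x q ss = (x, f ss)"
| "control (Seq a b) s x q ss =
    (if q < s + states a then control a s (s + states a) q ss else control b (s + states a) x q ss)"
| "control (Cond P a b) s x q ss =
    (if q = s then (if P ss then Suc s else Suc (s + states a), idle ss)
     else if q < Suc (s + states a) then control a (Suc s) x q ss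
     else control b (Suc (s + states a)) x q ss)"
| "control (Loop P a) s x q ss =
    (if q = s then (if P ss then Suc s else x, idle ss) else control a (Suc s) s q ss)"

definition machine :: "nat \<Rightarrow> nat \<Rightarrow> cmd \<Rightarrow> tm" where
  "machine T S c =
    \<lparr>num_tapes = T, num_states = states c, num_symbols = S, delta = control c 0 (states c)\<rparr>"

fun wf_cmd :: "nat \<Rightarrow> nat \<Rightarrow> cmd \<Rightarrow> bool" where
  "wf_cmd T S (Act f) \<longleftrightarrow> (\<forall>ss. length ss = T \<and> set ss \<subseteq> {..<S} \<longrightarrow>
     length (f ss) = T \<and> fst ` set (f ss) \<subseteq> {..<S})"
| "wf_cmd T S (Seq a b) \<longleftrightarrow> wf_cmd T S a \<and> wf_cmd T S b"
| "wf_cmd T S (Cond P a b) \<longleftrightarrow> wf_cmd T S a \<and> wf_cmd T S b"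
| "wf_cmd T S (Loop P a) \<longleftrightarrow> wf_cmd T S a"

lemma states_pos: "0 < states c"
  by (induction c) auto

lemma control_wf:
  assumes "wf_cmd T S c" "length ss = T" "set ss \<subseteq> {..<S}"
    "x \<le> N" "s + states c \<le> N"
  shows "fst (control c s x q ss) \<le> N \<and> length (snd (control c s x q ss)) = T \<and>
    fst ` set (snd (control c s x q ss)) \<subseteq> {..<S}"
  using assms
proof (induction c arbitrary: s x)
  case (Cond P a b)
  then show ?case using states_pos[of a] states_pos[of b] by (auto simp: idle_def)
next
  case (Loop P a)
  then show ?case using states_pos[of a] by (auto simp: idle_def)
qed auto

lemma wf_machine: "wf_cmd T S c \<Longrightarrow> 0 < S \<Longrightarrow> wf_tm (machine T S c)"
  unfolding wf_tm_def
  using control_wf[of T S c _ "states c" "states c" 0]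
  by (simp add: machine_def split_beta)

lemma map2_idle: "map2 act_tape (idle (map read_tape ts)) ts = ts"
  by (induction ts) (auto simp: idle_def)

lemma step_control:
  assumes "q < num_states M" "delta M q (map read_tape ts) = (q', as)"
  shows "(step M ^^ Suc n) (q, ts) = (step M ^^ n) (q', map2 act_tape as ts)"
proof -
  have "step M (q, ts) = (q', map2 act_tape as ts)"
    using assms by (simp add: step_def)
  then show ?thesis by (simp only: funpow_Suc_right comp_apply)
qed

lemma steps_append:
  "(step M ^^ m) c = c' \<Longrightarrow> (step M ^^ n) c' = c'' \<Longrightarrow> (step M ^^ (m + n)) c = c''"
  by (simp add: add.commute[of m] funpow_add)

text \<open>\<open>delta\<close> is compared with \<open>control\<close> on the states of this block
  only, so the hypothesis passes to sub-commands. Their exit \<open>x\<close> may be any state: the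
  next block, or the head of the surrounding loop.\<close>

lemma exec_steps:
  assumes "exec c ts t ts'"
    and "\<And>q ss. s \<le> q \<Longrightarrow> q < s + states c \<Longrightarrow> delta M q ss = control c s x q ss"
    and "s + states c \<le> num_states M"
  shows "(step M ^^ t) (s, ts) = (x, ts')"
  using assms
proof (induction arbitrary: s x rule: exec.induct)
  case (Act f ts)
  then show ?case using step_control[of s M ts x "f (map read_tape ts)" 0] by simp
next
  case (Seq a ts m ts' b n ts'')
  have "(step M ^^ m) (s, ts) = (s + states a, ts')"
    using Seq.prems by (intro Seq.IH(1)) auto
  moreover have "(step M ^^ n) (s + states a, ts') = (x, ts'')"
    using Seq.prems by (intro Seq.IH(2)) auto
  ultimately show ?case by (rule steps_append)
next
  case (CondT P ts a m ts' b)
  have "(step M ^^ m) (Suc s, ts) = (x, ts')"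
    using CondT.prems by (intro CondT.IH) auto
  then show ?case using CondT.prems CondT.hyps
    by (subst step_control[where q' = "Suc s" and as = "idle (map read_tape ts)"]) (auto simp: map2_idle)
next
  case (CondF P ts b m ts' a)
  have "(step M ^^ m) (Suc (s + states a), ts) = (x, ts')"
    using CondF.prems by (intro CondF.IH) auto
  then show ?case using CondF.prems CondF.hyps
    by (subst step_control[where q' = "Suc (s + states a)" and as = "idle (map read_tape ts)"])
      (auto simp: map2_idle)
next
  case (LoopF P ts a)
  then show ?case
    using step_control[of s M ts x "idle (map read_tape ts)" 0] by (simp add: map2_idle)
next
  case (LoopT P ts a m ts' n ts'')
  have "(step M ^^ m) (Suc s, ts) = (s, ts')"
    using LoopT.prems by (intro LoopT.IH(1)) auto
  moreover have "(step M ^^ n) (s, ts') = (x, ts'')"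
    using LoopT.prems by (intro LoopT.IH(2)) auto
  ultimately have "(step M ^^ (m + n)) (Suc s, ts) = (x, ts'')"
    by (rule steps_append)
  then show ?case using LoopT.prems LoopT.hyps
    by (subst step_control[where q' = "Suc s" and as = "idle (map read_tape ts)"]) (auto simp: map2_idle)
qed

text \<open>Bounds replace exact times, so that branches and loops of varying duration can be
  described by a single cost.\<close>

definition runs :: "cmd \<Rightarrow> tape list \<Rightarrow> nat \<Rightarrow> tape list \<Rightarrow> bool" where
  "runs c ts t ts' \<longleftrightarrow> (\<exists>t'\<le>t. exec c ts t' ts')"

lemma runs_Seq: "runs a ts m ts' \<Longrightarrow> runs b ts' n ts'' \<Longrightarrow> runs (Seq a b) ts (m + n) ts''"
  unfolding runs_def using exec.Seq by (meson add_mono)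

lemma runs_CondT:
  "P (map read_tape ts) \<Longrightarrow> runs a ts m ts' \<Longrightarrow> runs (Cond P a b) ts (Suc m) ts'"
  unfolding runs_def using exec.CondT by (meson Suc_le_mono)

lemma runs_CondF:
  "\<not> P (map read_tape ts) \<Longrightarrow> runs b ts m ts' \<Longrightarrow> runs (Cond P a b) ts (Suc m) ts'"
  unfolding runs_def using exec.CondF by (meson Suc_le_mono)

lemma runs_LoopF: "\<not> P (map read_tape ts) \<Longrightarrow> runs (Loop P a) ts 1 ts"
  unfolding runs_def using exec.LoopF by blast

lemma runs_LoopT:
  "P (map read_tape ts) \<Longrightarrow> runs a ts m ts' \<Longrightarrow> runs (Loop P a) ts' n ts''
    \<Longrightarrow> runs (Loop P a) ts (Suc (m + n)) ts''"
  unfolding runs_def using exec.LoopT by (meson Suc_le_mono add_mono)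

lemma runs_mono: "runs c ts m ts' \<Longrightarrow> m \<le> n \<Longrightarrow> runs c ts n ts'"
  unfolding runs_def using order_trans by blast

lemma runs_Act: "map2 act_tape (f (map read_tape ts)) ts = ts' \<Longrightarrow> runs (Act f) ts 1 ts'"
  unfolding runs_def using exec.Act by blast

lemma step_halted: "(step M ^^ n) (num_states M, ts) = (num_states M, ts)"
  by (induction n) (auto simp: step_def)

lemma runs_machine:
  assumes "runs c ts t ts'"
  shows "(step (machine T S c) ^^ t) (0, ts) = (states c, ts')"
proof -
  let ?M = "machine T S c"
  obtain t' where t': "t' \<le> t" "exec c ts t' ts'"
    using assms by (auto simp: runs_def)
  have "(step ?M ^^ t') (0, ts) = (states c, ts')"
    by (rule exec_steps[OF t'(2)]) (auto simp: machine_def)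
  \<comment> \<open>\<open>tm_computes\<close> fixes the exact number of steps; a halted
    configuration is stationary, so the remaining steps change nothing.\<close>
  moreover have "(step ?M ^^ (t - t')) (states c, ts') = (states c, ts')"
    using step_halted[of "t - t'" ?M ts'] by (simp add: machine_def)
  ultimately have "(step ?M ^^ (t' + (t - t'))) (0, ts) = (states c, ts')"
    by (rule steps_append)
  then show ?thesis using t'(1) by simp
qed

section \<open>A language of word expressions\<close>

text \<open>The whole trace \<open>s\<close> is given in closed form instead of an invariant, so
  that the final state and the summed time come out together.\<close>

lemma runs_Loop_upto:
  assumes "\<And>i. i < n \<Longrightarrow> P (map read_tape (s i))"
    and "\<And>i. i < n \<Longrightarrow> runs c (s i) (t i) (s (Suc i))"
    and "\<not> P (map read_tape (s n))"
  shows "runs (Loop P c) (s 0) ((\<Sum>i<n. Suc (t i)) + 1) (s n)"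
  using assms
proof (induction n arbitrary: s t)
  case 0
  then show ?case using runs_LoopF by simp
next
  case (Suc n)
  have "runs (Loop P c) (s (Suc 0)) ((\<Sum>i<n. Suc (t (Suc i))) + 1) (s (Suc n))"
    using Suc.prems by (intro Suc.IH[where s = "\<lambda>i. s (Suc i)"]) auto
  then have "runs (Loop P c) (s 0) (Suc (t 0 + ((\<Sum>i<n. Suc (t (Suc i))) + 1))) (s (Suc n))"
    using Suc.prems by (intro runs_LoopT) auto
  then show ?case by (simp add: sum.lessThan_Suc_shift del: sum.lessThan_Suc)
qed

text \<open>A tape serves as a stack whose top is the last letter of the word, with the head on it.\<close>

definition stack_tape :: "nat list \<Rightarrow> tape" where
  "stack_tape w = (word_content w, int (length w) - 1)"

definition rep :: "nat \<Rightarrow> (nat \<Rightarrow> nat list) \<Rightarrow> tape list" where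
  "rep T st = map (\<lambda>i. stack_tape (st i)) [0..<T]"

text \<open>The default 0 is the blank that the head of an empty stack reads on cell -1. As long as
  words avoid 0, reading the top tests for emptiness.\<close>

definition top_of :: "nat list \<Rightarrow> nat" where
  "top_of w = (if w = [] then 0 else last w)"

lemma top_of_eq_0: "0 \<notin> set w \<Longrightarrow> top_of w = 0 \<longleftrightarrow> w = []"
  by (metis last_in_set top_of_def)

lemma top_of_snoc [simp]: "top_of (w @ [v]) = v"
  by (simp add: top_of_def)

lemma length_rep [simp]: "length (rep T st) = T"
  by (simp add: rep_def)

lemma read_stack_tape: "read_tape (stack_tape w) = top_of w"
  by (auto simp: stack_tape_def word_content_def top_of_def last_conv_nth nat_diff_distrib')

lemma read_rep [simp]: "j < T \<Longrightarrow> read_tape (rep T st ! j) = top_of (st j)"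
  by (simp add: rep_def read_stack_tape)

lemma rep_update: "(rep T st)[j := stack_tape w] = rep T (st(j := w))"
  by (rule nth_equalityI) (auto simp: rep_def nth_list_update)

lemma nth_rep: "j < T \<Longrightarrow> rep T st ! j = stack_tape (st j)"
  by (simp add: rep_def)

definition act_on :: "nat \<Rightarrow> (nat list \<Rightarrow> nat) \<Rightarrow> move \<Rightarrow> cmd" where
  "act_on j g d = Act (\<lambda>ss. (idle ss)[j := (g ss, d)])"

lemma runs_act_on:
  assumes "j < length ts"
  shows "runs (act_on j g d) ts 1 (ts[j := act_tape (g (map read_tape ts), d) (ts ! j)])"
  unfolding act_on_def
proof (rule runs_Act)
  have "map2 act_tape ((idle (map read_tape ts))[j := (s, d)]) (ts[j := ts ! j]) =
      (map2 act_tape (idle (map read_tape ts)) ts)[j := act_tape (s, d) (ts ! j)]" for s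
    by (simp only: zip_update map_update case_prod_conv)
  then show "map2 act_tape ((idle (map read_tape ts))[j := (g (map read_tape ts), d)]) ts =
      ts[j := act_tape (g (map read_tape ts), d) (ts ! j)]"
    by (simp add: map2_idle)
qed

definition noop :: cmd where
  "noop = Act idle"

definition pop :: "nat \<Rightarrow> cmd" where
  "pop j = act_on j (\<lambda>_. 0) MoveLeft"

text \<open>The move to the fresh cell is an action of its own and must write back the letter that
  it leaves. \<open>g\<close> is evaluated afterwards, when tape \<open>d\<close> shows a blank, so
  its value may depend on the other tops only.\<close>

definition push :: "nat \<Rightarrow> (nat list \<Rightarrow> nat) \<Rightarrow> cmd" where
  "push d g = Seq (act_on d (\<lambda>ss. ss ! d) MoveRight) (act_on d g Stay)"

lemma runs_noop: "runs noop ts 1 ts"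
  unfolding noop_def by (rule runs_Act) (rule map2_idle)

lemma runs_pop:
  assumes "j < T" "st j \<noteq> []"
  shows "runs (pop j) (rep T st) 1 (rep T (st(j := butlast (st j))))"
proof -
  have "act_tape (0, MoveLeft) (stack_tape (st j)) = stack_tape (butlast (st j))"
    using assms(2)
    by (auto simp: stack_tape_def word_content_def fun_eq_iff nth_butlast of_nat_diff Suc_le_eq)
  then show ?thesis
    using runs_act_on[of j "rep T st" "\<lambda>_. 0" MoveLeft] assms(1)
    by (simp add: pop_def rep_update nth_rep)
qed

lemma runs_push:
  assumes d: "d < T"
    and g: "\<And>ss. (\<And>i. i < T \<Longrightarrow> i \<noteq> d \<Longrightarrow> ss ! i = top_of (st i)) \<Longrightarrow> g ss = v"
  shows "runs (push d g) (rep T st) 2 (rep T (st(d := st d @ [v])))"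
proof -
  let ?t = "(word_content (st d), int (length (st d)))" and ?ts = "rep T st"
  have "(word_content (st d))(int (length (st d)) - 1 := top_of (st d)) = word_content (st d)"
    by (auto simp: fun_eq_iff word_content_def top_of_def last_conv_nth nat_diff_distrib')
  then have "act_tape (map read_tape ?ts ! d, MoveRight) (?ts ! d) = ?t"
    using d by (simp add: nth_rep stack_tape_def read_stack_tape)
  then have 1: "runs (act_on d (\<lambda>ss. ss ! d) MoveRight) ?ts 1 (?ts[d := ?t])"
    using runs_act_on[of d ?ts "\<lambda>ss. ss ! d" MoveRight] d by simp
  have "g (map read_tape (?ts[d := ?t])) = v"
    by (rule g) (simp add: nth_rep read_stack_tape)
  moreover have "(word_content (st d))(int (length (st d)) := v) = word_content (st d @ [v])"
    by (auto simp: word_content_def fun_eq_iff nth_append)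
  ultimately have "act_tape (g (map read_tape (?ts[d := ?t])), Stay) (?ts[d := ?t] ! d) =
      stack_tape (st d @ [v])"
    using d by (simp add: stack_tape_def)
  then have "runs (act_on d g Stay) (?ts[d := ?t]) 1 (rep T (st(d := st d @ [v])))"
    using runs_act_on[of d "?ts[d := ?t]" g Stay] d by (simp add: rep_update)
  from runs_Seq[OF 1 this] show ?thesis by (simp add: push_def numeral_2_eq_2)
qed

lemma runs_push_const:
  "d < T \<Longrightarrow> runs (push d (\<lambda>_. v)) (rep T st) 2 (rep T (st(d := st d @ [v])))"
  by (rule runs_push) auto

lemma runs_push_top:
  "d < T \<Longrightarrow> j < T \<Longrightarrow> j \<noteq> d \<Longrightarrow>
    runs (push d (\<lambda>ss. ss ! j)) (rep T st) 2 (rep T (st(d := st d @ [top_of (st j)])))"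
  by (rule runs_push) auto

section \<open>Clearing, reversing and copying stacks\<close>

definition clear :: "nat \<Rightarrow> cmd" where
  "clear j = Loop (\<lambda>ss. ss ! j \<noteq> 0) (pop j)"

lemma top_of_take:
  "0 < n \<Longrightarrow> n \<le> length w \<Longrightarrow> top_of (take n w) = w ! (n - 1)"
  by (auto simp: top_of_def last_conv_nth)

lemma take_rev_Suc: "i < length w \<Longrightarrow> take (Suc i) (rev w) = take i (rev w) @ [w ! (length w - Suc i)]"
  by (simp add: take_Suc_conv_app_nth rev_nth)

lemma runs_clear:
  assumes "j < T" "0 \<notin> set (st j)"
  shows "runs (clear j) (rep T st) (2 * length (st j) + 1) (rep T (st(j := [])))"
proof -
  let ?w = "st j"
  let ?s = "\<lambda>i. rep T (st(j := take (length ?w - i) ?w))"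
  have "runs (clear j) (?s 0) ((\<Sum>i<length ?w. Suc 1) + 1) (?s (length ?w))"
    unfolding clear_def
  proof (rule runs_Loop_upto)
    fix i assume i: "i < length ?w"
    then have ne: "take (length ?w - i) ?w \<noteq> []" by auto
    moreover have "0 \<notin> set (take (length ?w - i) ?w)"
      using assms(2) by (auto dest: in_set_takeD)
    ultimately show "map read_tape (?s i) ! j \<noteq> 0"
      using top_of_eq_0[of "take (length ?w - i) ?w"] assms(1) by simp
    show "runs (pop j) (?s i) 1 (?s (Suc i))"
      using runs_pop[of j T "st(j := take (length ?w - i) ?w)"] assms(1) ne i
      by (simp add: butlast_take)
  qed (use assms in \<open>simp add: top_of_def\<close>)
  then show ?thesis by (simp add: mult_2)
qed

text \<open>The pop comes last, so that every target receives the same letter. Pouring reverses the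
  word.\<close>

definition pour :: "nat list \<Rightarrow> nat \<Rightarrow> cmd" where
  "pour ds j = Loop (\<lambda>ss. ss ! j \<noteq> 0) (foldr (\<lambda>d c. Seq (push d (\<lambda>ss. ss ! j)) c) ds (pop j))"

definition append_on :: "nat list \<Rightarrow> nat list \<Rightarrow> (nat \<Rightarrow> nat list) \<Rightarrow> nat \<Rightarrow> nat list" where
  "append_on ds w st i = (if i \<in> set ds then st i @ w else st i)"

lemma runs_pour_step:
  assumes "j < T" "set ds \<subseteq> {..<T}" "distinct ds" "j \<notin> set ds" "st j = w @ [v]"
  shows "runs (foldr (\<lambda>d c. Seq (push d (\<lambda>ss. ss ! j)) c) ds (pop j)) (rep T st)
    (2 * length ds + 1) (rep T ((append_on ds [v] st)(j := w)))"
  using assms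
proof (induction ds arbitrary: st)
  case Nil
  have eq: "append_on [] [v] st = st" by (auto simp: append_on_def)
  have "runs (pop j) (rep T st) 1 (rep T (st(j := w)))"
    using Nil runs_pop[of j T st] by simp
  then have "runs (foldr (\<lambda>d c. Seq (push d (\<lambda>ss. ss ! j)) c) [] (pop j)) (rep T st) 1
      (rep T ((append_on [] [v] st)(j := w)))"
    unfolding eq by simp
  then show ?case by (rule runs_mono) simp
next
  case (Cons d ds)
  let ?st = "st(d := st d @ [v])"
  let ?c = "foldr (\<lambda>d c. Seq (push d (\<lambda>ss. ss ! j)) c) ds (pop j)"
  have 1: "runs (push d (\<lambda>ss. ss ! j)) (rep T st) 2 (rep T ?st)"
    using runs_push_top[of d T j st] Cons.prems by simp
  have 2: "runs ?c (rep T ?st) (2 * length ds + 1) (rep T ((append_on ds [v] ?st)(j := w)))"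
    using Cons.prems by (intro Cons.IH) auto
  have eq: "append_on ds [v] ?st = append_on (d # ds) [v] st"
    using Cons.prems by (auto simp: append_on_def fun_eq_iff)
  have "runs (foldr (\<lambda>d c. Seq (push d (\<lambda>ss. ss ! j)) c) (d # ds) (pop j)) (rep T st)
      (2 + (2 * length ds + 1)) (rep T ((append_on (d # ds) [v] st)(j := w)))"
    using runs_Seq[OF 1 2] unfolding eq by simp
  then show ?case by (rule runs_mono) simp
qed

lemma runs_pour:
  assumes j: "j < T" "0 \<notin> set (st j)" and ds: "set ds \<subseteq> {..<T}" "distinct ds" "j \<notin> set ds"
  shows "runs (pour ds j) (rep T st) ((2 * length ds + 2) * length (st j) + 1)
    (rep T ((append_on ds (rev (st j)) st)(j := [])))"
proof -
  let ?w = "st j"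
  let ?st = "\<lambda>i. (append_on ds (take i (rev ?w)) st)(j := take (length ?w - i) ?w)"
  let ?s = "\<lambda>i. rep T (?st i)"
  have "runs (pour ds j) (?s 0) ((\<Sum>i<length ?w. Suc (2 * length ds + 1)) + 1) (?s (length ?w))"
    unfolding pour_def
  proof (rule runs_Loop_upto)
    fix i assume i: "i < length ?w"
    then have ne: "take (length ?w - i) ?w \<noteq> []" by auto
    moreover have "0 \<notin> set (take (length ?w - i) ?w)"
      using j(2) by (auto dest: in_set_takeD)
    ultimately show "map read_tape (?s i) ! j \<noteq> 0"
      using top_of_eq_0[of "take (length ?w - i) ?w"] j(1) by simp
    let ?v = "?w ! (length ?w - Suc i)"
    have "?st i j = take (length ?w - Suc i) ?w @ [?v]"
      using i take_Suc_conv_app_nth[of "length ?w - Suc i" ?w] by (simp add: Suc_diff_Suc)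
    then have "runs (foldr (\<lambda>d c. Seq (push d (\<lambda>ss. ss ! j)) c) ds (pop j)) (?s i) (2 * length ds + 1)
      (rep T ((append_on ds [?v] (?st i))(j := take (length ?w - Suc i) ?w)))"
      using j(1) ds by (intro runs_pour_step)
    moreover have eq: "(append_on ds [?v] (?st i))(j := take (length ?w - Suc i) ?w) = ?st (Suc i)"
      using i ds(3) by (auto simp: append_on_def fun_eq_iff take_rev_Suc)
    ultimately show "runs (foldr (\<lambda>d c. Seq (push d (\<lambda>ss. ss ! j)) c) ds (pop j)) (?s i)
      (2 * length ds + 1) (?s (Suc i))" by (simp only:)
  qed (use j in \<open>simp add: top_of_def\<close>)
  moreover have "?st 0 = st" by (auto simp: append_on_def fun_eq_iff)
  moreover have "?st (length ?w) = (append_on ds (rev ?w) st)(j := [])" by simp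
  ultimately have "runs (pour ds j) (rep T st) ((\<Sum>i<length ?w. Suc (2 * length ds + 1)) + 1)
      (rep T ((append_on ds (rev ?w) st)(j := [])))"
    by (simp only:)
  then show ?thesis by (rule runs_mono) (simp add: algebra_simps)
qed

text \<open>Pouring to the scratch tape and back reverses twice: the source is restored, the copy
  has the right order, and the scratch tape is empty again.\<close>

definition copy :: "nat \<Rightarrow> nat \<Rightarrow> nat \<Rightarrow> cmd" where
  "copy j d L = Seq (pour [L] j) (pour [j, d] L)"

lemma runs_copy:
  assumes "j < L" "d < L" "L < T" "j \<noteq> d" "st L = []" "0 \<notin> set (st j)"
  shows "runs (copy j d L) (rep T st) (10 * length (st j) + 2) (rep T (st(d := st d @ st j)))"
proof -
  let ?st = "st(j := [], L := rev (st j))"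
  have "(append_on [L] (rev (st j)) st)(j := []) = ?st"
    using assms by (auto simp: append_on_def fun_eq_iff)
  then have 1: "runs (pour [L] j) (rep T st) (4 * length (st j) + 1) (rep T ?st)"
    using runs_pour[of j T st "[L]"] assms by simp
  have "(append_on [j, d] (rev (?st L)) ?st)(L := []) = st(d := st d @ st j)"
    using assms by (auto simp: append_on_def fun_eq_iff)
  then have 2: "runs (pour [j, d] L) (rep T ?st) (6 * length (st j) + 1)
    (rep T (st(d := st d @ st j)))"
    using runs_pour[of L T ?st "[j, d]"] assms by simp
  show ?thesis
    unfolding copy_def by (rule runs_mono[OF runs_Seq[OF 1 2]]) simp
qed

text \<open>A loop runs once per letter of a word computed beforehand and has no accumulator: a
  round cannot see what earlier rounds have written. This is what keeps every expression
  polynomial.\<close>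

datatype exp =
    Emp
  | Sym nat
  | Var nat
  | App exp exp
  | For nat exp exp
  | Bind nat exp exp
  | Ite exp exp exp
  | Less exp exp
  | At exp exp nat

text \<open>Numbers are words compared by their lengths, and a condition holds if its word is nonempty.\<close>

fun ev :: "exp \<Rightarrow> (nat \<Rightarrow> nat list) \<Rightarrow> nat list" where
  "ev Emp \<sigma> = []"
| "ev (Sym c) \<sigma> = [c]"
| "ev (Var x) \<sigma> = \<sigma> x"
| "ev (App a b) \<sigma> = ev a \<sigma> @ ev b \<sigma>"
| "ev (For x a b) \<sigma> =
    concat (map (\<lambda>i. ev b (\<sigma>(x := replicate i 1))) [0..<length (ev a \<sigma>)])"
| "ev (Bind x a b) \<sigma> = ev b (\<sigma>(x := ev a \<sigma>))"
| "ev (Ite c a b) \<sigma> = (if ev c \<sigma> \<noteq> [] then ev a \<sigma> else ev b \<sigma>)"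
| "ev (Less a b) \<sigma> = (if length (ev a \<sigma>) < length (ev b \<sigma>) then [1] else [])"
| "ev (At a i c) \<sigma> =
    (if length (ev i \<sigma>) < length (ev a \<sigma>) \<and> ev a \<sigma> ! length (ev i \<sigma>) = c then [1] else [])"

fun syms :: "exp \<Rightarrow> nat set" where
  "syms (Sym c) = {c}"
| "syms (App a b) = syms a \<union> syms b"
| "syms (For x a b) = syms a \<union> syms b"
| "syms (Bind x a b) = syms a \<union> syms b"
| "syms (Ite c a b) = syms c \<union> syms a \<union> syms b"
| "syms (Less a b) = syms a \<union> syms b"
| "syms (At a i c) = insert c (syms a \<union> syms i)"
| "syms _ = {}"

text \<open>Sub-expressions are evaluated one after another and reuse the same scratch tapes, hence
  the maxima. The summands count the tapes occupied by intermediate words: bound and counter of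
  \<open>For\<close>, both arguments of \<open>Less\<close>, and the index, the word and its
  reversal for \<open>At\<close>.\<close>

fun space :: "exp \<Rightarrow> nat" where
  "space (Var x) = 1"
| "space (App a b) = max (space a) (space b)"
| "space (For x a b) = 2 + max (space a) (space b)"
| "space (Bind x a b) = 1 + max (space a) (space b)"
| "space (Ite c a b) = 1 + max (space c) (max (space a) (space b))"
| "space (Less a b) = 2 + max (space a) (space b)"
| "space (At a i c) = 3 + max (space a) (space i)"
| "space _ = 0"

text \<open>Appends the value to tape \<open>d\<close>, where variable \<open>x\<close> is stored on tape
  \<open>\<rho> x\<close> and the tapes from \<open>L\<close> on are scratch space.\<close>

fun compile :: "exp \<Rightarrow> (nat \<Rightarrow> nat) \<Rightarrow> nat \<Rightarrow> nat \<Rightarrow> cmd" where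
  "compile Emp \<rho> d L = noop"
| "compile (Sym c) \<rho> d L = push d (\<lambda>_. c)"
| "compile (Var x) \<rho> d L = copy (\<rho> x) d L"
| "compile (App a b) \<rho> d L = Seq (compile a \<rho> d L) (compile b \<rho> d L)"
| "compile (For x a b) \<rho> d L = Seq (compile a \<rho> L (Suc L)) (Seq
    (Loop (\<lambda>ss. ss ! L \<noteq> 0)
      (Seq (compile b (\<rho>(x := Suc L)) d (L + 2)) (Seq (push (Suc L) (\<lambda>_. 1)) (pop L))))
    (clear (Suc L)))"
| "compile (Bind x a b) \<rho> d L =
    Seq (compile a \<rho> L (Suc L)) (Seq (compile b (\<rho>(x := L)) d (Suc L)) (clear L))"
| "compile (Ite c a b) \<rho> d L = Seq (compile c \<rho> L (Suc L))
    (Cond (\<lambda>ss. ss ! L \<noteq> 0) (Seq (clear L) (compile a \<rho> d L)) (compile b \<rho> d L))"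
| "compile (Less a b) \<rho> d L = Seq (compile a \<rho> L (Suc L)) (Seq (compile b \<rho> (Suc L) (L + 2)) (Seq
    (Loop (\<lambda>ss. ss ! L \<noteq> 0 \<and> ss ! Suc L \<noteq> 0) (Seq (pop L) (pop (Suc L)))) (Seq
    (Cond (\<lambda>ss. ss ! Suc L \<noteq> 0) (push d (\<lambda>_. 1)) noop)
    (Seq (clear L) (clear (Suc L))))))"
| "compile (At a i c) \<rho> d L = Seq (compile i \<rho> L (Suc L)) (Seq (compile a \<rho> (Suc L) (L + 2)) (Seq
    (pour [L + 2] (Suc L)) (Seq
    (Loop (\<lambda>ss. ss ! L \<noteq> 0 \<and> ss ! (L + 2) \<noteq> 0) (Seq (pop L) (pop (L + 2)))) (Seq
    (Cond (\<lambda>ss. ss ! L = 0 \<and> ss ! (L + 2) = c) (push d (\<lambda>_. 1)) noop)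
    (Seq (clear L) (clear (L + 2)))))))"

text \<open>An upper bound only: \<open>Ite\<close> pays for both branches. The lengths account for
  copying, clearing, reversing and comparing intermediate words; the 4 per round of
  \<open>For\<close> is the test, the two steps of \<open>push\<close> and the
  \<open>pop\<close>.\<close>

fun cost :: "exp \<Rightarrow> (nat \<Rightarrow> nat list) \<Rightarrow> nat" where
  "cost Emp \<sigma> = 1"
| "cost (Sym c) \<sigma> = 2"
| "cost (Var x) \<sigma> = 10 * length (\<sigma> x) + 2"
| "cost (App a b) \<sigma> = cost a \<sigma> + cost b \<sigma>"
| "cost (For x a b) \<sigma> = cost a \<sigma> +
    (\<Sum>i<length (ev a \<sigma>). cost b (\<sigma>(x := replicate i 1)) + 4) + 2 * length (ev a \<sigma>) + 2"
| "cost (Bind x a b) \<sigma> =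
    cost a \<sigma> + cost b (\<sigma>(x := ev a \<sigma>)) + 2 * length (ev a \<sigma>) + 1"
| "cost (Ite c a b) \<sigma> =
    cost c \<sigma> + cost a \<sigma> + cost b \<sigma> + 2 * length (ev c \<sigma>) + 2"
| "cost (Less a b) \<sigma> =
    cost a \<sigma> + cost b \<sigma> + 5 * length (ev a \<sigma>) + 2 * length (ev b \<sigma>) + 6"
| "cost (At a i c) \<sigma> =
    cost a \<sigma> + cost i \<sigma> + 6 * length (ev a \<sigma>) + 5 * length (ev i \<sigma>) + 7"

lemma ev_nonblank:
  assumes "0 \<notin> syms e" "\<And>x. 0 \<notin> set (\<sigma> x)"
  shows "0 \<notin> set (ev e \<sigma>)"
  using assms
proof (induction e arbitrary: \<sigma>)
  case (For x a b)
  have "0 \<notin> set (ev b (\<sigma>(x := replicate i 1)))" for i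
    using For.prems by (intro For.IH) auto
  then show ?case by simp
qed auto

section \<open>Compiled programs are well formed\<close>

lemma wf_act_on [simp]:
  assumes "\<And>ss. length ss = T \<Longrightarrow> set ss \<subseteq> {..<S} \<Longrightarrow> g ss < S"
  shows "wf_cmd T S (act_on j g m)"
  using assms set_update_subset_insert[of _ j]
  by (fastforce simp: act_on_def idle_def)

lemma nth_symbol: "length ss = T \<Longrightarrow> set ss \<subseteq> {..<S} \<Longrightarrow> j < T \<Longrightarrow> ss ! j < S"
  using nth_mem by fastforce

lemma wf_push [simp]:
  assumes "d < T" "\<And>ss. length ss = T \<Longrightarrow> set ss \<subseteq> {..<S} \<Longrightarrow> g ss < S"
  shows "wf_cmd T S (push d g)"
  unfolding push_def using assms by (simp add: nth_symbol)

lemma wf_pop [simp]: "0 < S \<Longrightarrow> wf_cmd T S (pop j)"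
  by (simp add: pop_def)

lemma wf_noop [simp]: "wf_cmd T S noop"
  by (auto simp: noop_def idle_def)

lemma wf_clear [simp]: "0 < S \<Longrightarrow> wf_cmd T S (clear j)"
  by (simp add: clear_def)

lemma wf_pour [simp]:
  assumes "0 < S" "j < T" "set ds \<subseteq> {..<T}"
  shows "wf_cmd T S (pour ds j)"
proof -
  have "wf_cmd T S (foldr (\<lambda>d c. Seq (push d (\<lambda>ss. ss ! j)) c) ds (pop j))"
    using assms by (induction ds) (auto simp: nth_symbol)
  then show ?thesis by (simp add: pour_def)
qed

lemma wf_compile:
  assumes "d < L" "\<And>x. \<rho> x < L" "L + space e \<le> T" "syms e \<subseteq> {..<S}" "1 < S"
  shows "wf_cmd T S (compile e \<rho> d L)"
  using assms
proof (induction e arbitrary: \<rho> d L)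
  case (Var x)
  have "\<rho> x < T" "d < T" "L < T"
    using Var.prems(1,3) Var.prems(2)[of x] by auto
  then show ?case using Var.prems by (simp add: copy_def)
next
  case (For x a b)
  have L: "\<And>y. \<rho> y < Suc L" "\<And>y. (\<rho>(x := Suc L)) y < L + 2"
    using For.prems(2) by (auto intro: less_SucI)
  have "wf_cmd T S (compile a \<rho> L (Suc L))" "wf_cmd T S (compile b (\<rho>(x := Suc L)) d (L + 2))"
    by (rule For.IH; use For.prems(1,3-) L in simp)+
  then show ?case using For.prems(1,3-) by simp
next
  case (Bind x a b)
  have L: "\<And>y. \<rho> y < Suc L" "\<And>y. (\<rho>(x := L)) y < Suc L"
    using Bind.prems(2) by (auto intro: less_SucI)
  have "wf_cmd T S (compile a \<rho> L (Suc L))" "wf_cmd T S (compile b (\<rho>(x := L)) d (Suc L))"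
    by (rule Bind.IH; use Bind.prems(1,3-) L in simp)+
  then show ?case using Bind.prems(1,3-) by simp
next
  case (Ite c a b)
  have L: "\<And>y. \<rho> y < Suc L"
    using Ite.prems(2) by (auto intro: less_SucI)
  have "wf_cmd T S (compile c \<rho> L (Suc L))"
    by (rule Ite.IH; use Ite.prems(1,3-) L in simp)
  moreover have "wf_cmd T S (compile a \<rho> d L)" "wf_cmd T S (compile b \<rho> d L)"
    by (rule Ite.IH; use Ite.prems in simp)+
  ultimately show ?case using Ite.prems(1,3-) by simp
next
  case (Less a b)
  have L: "\<And>y. \<rho> y < Suc L" "\<And>y. \<rho> y < L + 2"
    using Less.prems(2) by (auto intro: less_SucI)
  have "wf_cmd T S (compile a \<rho> L (Suc L))" "wf_cmd T S (compile b \<rho> (Suc L) (L + 2))"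
    by (rule Less.IH; use Less.prems(1,3-) L in simp)+
  then show ?case using Less.prems(1,3-) by simp
next
  case (At a i c)
  have L: "\<And>y. \<rho> y < Suc L" "\<And>y. \<rho> y < L + 2"
    using At.prems(2) by (auto intro: less_SucI)
  have "wf_cmd T S (compile i \<rho> L (Suc L))" "wf_cmd T S (compile a \<rho> (Suc L) (L + 2))"
    by (rule At.IH; use At.prems(1,3-) L in simp)+
  then show ?case using At.prems(1,3-) by simp
qed auto

section \<open>Correctness of the compiler\<close>

definition frame :: "(nat \<Rightarrow> nat) \<Rightarrow> nat \<Rightarrow> (nat \<Rightarrow> nat list) \<Rightarrow> (nat \<Rightarrow> nat list) \<Rightarrow> bool" where
  "frame \<rho> L st \<sigma> \<longleftrightarrow> (\<forall>x. \<rho> x < L \<and> st (\<rho> x) = \<sigma> x) \<and> (\<forall>j\<ge>L. st j = []) \<and> (\<forall>j. 0 \<notin> set (st j))"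

lemma frame_env_nonblank: "frame \<rho> L st \<sigma> \<Longrightarrow> 0 \<notin> set (\<sigma> x)"
  unfolding frame_def by metis

lemma frame_empty: "frame \<rho> L st \<sigma> \<Longrightarrow> L \<le> j \<Longrightarrow> st j = []"
  by (simp add: frame_def)

lemma frame_scratch: "frame \<rho> L st \<sigma> \<Longrightarrow> 0 \<notin> set w \<Longrightarrow> frame \<rho> (Suc L) (st(L := w)) \<sigma>"
  unfolding frame_def by (auto simp: less_SucI)

lemma frame_bind:
  "frame \<rho> L st \<sigma> \<Longrightarrow> 0 \<notin> set w \<Longrightarrow> frame (\<rho>(x := L)) (Suc L) (st(L := w)) (\<sigma>(x := w))"
  unfolding frame_def by (auto simp: less_SucI)

lemma frame_dest:
  "frame \<rho> L st \<sigma> \<Longrightarrow> d < L \<Longrightarrow> \<forall>x. \<rho> x \<noteq> d \<Longrightarrow> 0 \<notin> set w \<Longrightarrow> frame \<rho> L (st(d := w)) \<sigma>"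
  unfolding frame_def by auto

text \<open>Popping two stacks in step takes the shorter length off both. What remains decides
  \<open>Less\<close> and exposes the requested letter for \<open>At\<close>.\<close>

lemma runs_pop2_loop:
  assumes "j < T" "l < T" "j \<noteq> l" "0 \<notin> set (st j)" "0 \<notin> set (st l)"
  defines "n \<equiv> min (length (st j)) (length (st l))"
  shows "runs (Loop (\<lambda>ss. ss ! j \<noteq> 0 \<and> ss ! l \<noteq> 0) (Seq (pop j) (pop l))) (rep T st) (3 * n + 1)
    (rep T (st(j := take (length (st j) - n) (st j), l := take (length (st l) - n) (st l))))"
proof -
  let ?v = "st j" and ?w = "st l"
  let ?st = "\<lambda>i. st(j := take (length ?v - i) ?v, l := take (length ?w - i) ?w)"
  let ?s = "\<lambda>i. rep T (?st i)"
  have nb: "0 \<notin> set (take i ?v)" "0 \<notin> set (take i ?w)" for i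
    using assms(4,5) by (auto dest: in_set_takeD)
  have "runs (Loop (\<lambda>ss. ss ! j \<noteq> 0 \<and> ss ! l \<noteq> 0) (Seq (pop j) (pop l))) (?s 0)
      ((\<Sum>i<n. Suc 2) + 1) (?s n)"
  proof (rule runs_Loop_upto)
    fix i assume i: "i < n"
    then have ne: "take (length ?v - i) ?v \<noteq> []" "take (length ?w - i) ?w \<noteq> []"
      by (auto simp: n_def)
    then show "map read_tape (?s i) ! j \<noteq> 0 \<and> map read_tape (?s i) ! l \<noteq> 0"
      using top_of_eq_0[OF nb(1)] top_of_eq_0[OF nb(2)] assms(1-3) by simp
    let ?st' = "(?st i)(j := take (length ?v - Suc i) ?v)"
    have "runs (pop j) (?s i) 1 (rep T ((?st i)(j := butlast (?st i j))))"
      using ne assms(1,3) by (intro runs_pop) auto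
    moreover have "(?st i)(j := butlast (?st i j)) = ?st'"
      using i assms(3) by (simp add: n_def butlast_take)
    ultimately have 1: "runs (pop j) (?s i) 1 (rep T ?st')" by (simp only:)
    have "runs (pop l) (rep T ?st') 1 (rep T (?st'(l := butlast (?st' l))))"
      using ne assms(2,3) by (intro runs_pop) auto
    moreover have "?st'(l := butlast (?st' l)) = ?st (Suc i)"
      using i assms(3) by (simp add: n_def butlast_take fun_upd_twist)
    ultimately have 2: "runs (pop l) (rep T ?st') 1 (?s (Suc i))" by (simp only:)
    show "runs (Seq (pop j) (pop l)) (?s i) 2 (?s (Suc i))"
      using runs_Seq[OF 1 2] by (simp only: one_add_one)
  next
    have "?st n j = [] \<or> ?st n l = []"
      using assms(3) by (auto simp: n_def min_def)
    then show "\<not> (map read_tape (?s n) ! j \<noteq> 0 \<and> map read_tape (?s n) ! l \<noteq> 0)"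
      using assms(1,2) by (auto simp: top_of_def)
  qed
  moreover have "?st 0 = st" by (simp add: fun_eq_iff)
  ultimately show ?thesis by (simp add: mult.commute)
qed

lemma runs_to: "runs c ts m ts' \<Longrightarrow> ts' = ts'' \<Longrightarrow> m \<le> n \<Longrightarrow> runs c ts n ts''"
  using runs_mono by blast

text \<open>The destination \<open>d\<close> holds no variable, so writing to it changes no value.
  It may already carry a word, since results are appended; this turns \<open>App\<close> and the
  rounds of \<open>For\<close> into plain sequencing.\<close>

definition compiles :: "nat \<Rightarrow> exp \<Rightarrow> bool" where
  "compiles T e \<longleftrightarrow> (\<forall>\<rho> L st \<sigma> d. frame \<rho> L st \<sigma> \<longrightarrow> d < L \<longrightarrow> (\<forall>x. \<rho> x \<noteq> d) \<longrightarrow>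
    L + space e \<le> T \<longrightarrow> 0 \<notin> syms e \<longrightarrow>
    runs (compile e \<rho> d L) (rep T st) (cost e \<sigma>) (rep T (st(d := st d @ ev e \<sigma>))))"

lemma compilesI:
  assumes "\<And>\<rho> L st \<sigma> d. frame \<rho> L st \<sigma> \<Longrightarrow> d < L \<Longrightarrow> \<forall>x. \<rho> x \<noteq> d \<Longrightarrow>
    L + space e \<le> T \<Longrightarrow> 0 \<notin> syms e \<Longrightarrow>
    runs (compile e \<rho> d L) (rep T st) (cost e \<sigma>) (rep T (st(d := st d @ ev e \<sigma>)))"
  shows "compiles T e"
  using assms unfolding compiles_def by blast

lemma compilesD:
  "compiles T e \<Longrightarrow> frame \<rho> L st \<sigma> \<Longrightarrow> d < L \<Longrightarrow> \<forall>x. \<rho> x \<noteq> d \<Longrightarrow> L + space e \<le> T \<Longrightarrow>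
    0 \<notin> syms e \<Longrightarrow>
    runs (compile e \<rho> d L) (rep T st) (cost e \<sigma>) (rep T (st(d := st d @ ev e \<sigma>)))"
  unfolding compiles_def by blast

lemma compiles_Emp: "compiles T Emp"
proof (rule compilesI)
  fix \<rho> L st \<sigma> d
  assume prems: "frame \<rho> L st \<sigma>" "d < L" "\<forall>x. \<rho> x \<noteq> d" "L + space Emp \<le> T" "0 \<notin> syms Emp"
  let ?case = "runs (compile Emp \<rho> d L) (rep T st) (cost Emp \<sigma>) (rep T (st(d := st d @ ev Emp \<sigma>)))"
  show ?case using runs_noop by simp
qed

lemma compiles_Sym: "compiles T (Sym c)"
proof (rule compilesI)
  fix \<rho> L st \<sigma> d
  assume prems: "frame \<rho> L st \<sigma>" "d < L" "\<forall>x. \<rho> x \<noteq> d" "L + space (Sym c) \<le> T" "0 \<notin> syms (Sym c)"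
  let ?case = "runs (compile (Sym c) \<rho> d L) (rep T st) (cost (Sym c) \<sigma>) (rep T (st(d := st d @ ev (Sym c) \<sigma>)))"
  show ?case using runs_push_const[of d T c st] prems by simp
qed

lemma compiles_Var: "compiles T (Var x)"
proof (rule compilesI)
  fix \<rho> L st \<sigma> d
  assume prems: "frame \<rho> L st \<sigma>" "d < L" "\<forall>x. \<rho> x \<noteq> d" "L + space (Var x) \<le> T" "0 \<notin> syms (Var x)"
  let ?case = "runs (compile (Var x) \<rho> d L) (rep T st) (cost (Var x) \<sigma>) (rep T (st(d := st d @ ev (Var x) \<sigma>)))"
  have "\<rho> x < L" "st (\<rho> x) = \<sigma> x" "st L = []"
    using prems(1) by (simp_all add: frame_def)
  moreover have "0 \<notin> set (\<sigma> x)"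
    using prems(1) by (rule frame_env_nonblank)
  ultimately show ?case
    using runs_copy[of "\<rho> x" L d T st] prems by simp
qed

lemma compiles_App:
  assumes "compiles T a" "compiles T b"
  shows "compiles T (App a b)"
proof (rule compilesI)
  fix \<rho> L st \<sigma> d
  assume prems: "frame \<rho> L st \<sigma>" "d < L" "\<forall>x. \<rho> x \<noteq> d" "L + space (App a b) \<le> T" "0 \<notin> syms (App a b)"
  let ?case = "runs (compile (App a b) \<rho> d L) (rep T st) (cost (App a b) \<sigma>) (rep T (st(d := st d @ ev (App a b) \<sigma>)))"
  have "0 \<notin> set (ev a \<sigma>)"
    by (rule ev_nonblank) (use prems frame_env_nonblank in auto)
  then have "frame \<rho> L (st(d := st d @ ev a \<sigma>)) \<sigma>"
    using prems by (intro frame_dest) (auto simp: frame_def)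
  then have 2: "runs (compile b \<rho> d L) (rep T (st(d := st d @ ev a \<sigma>))) (cost b \<sigma>)
      (rep T ((st(d := st d @ ev a \<sigma>))(d := (st(d := st d @ ev a \<sigma>)) d @ ev b \<sigma>)))"
    using prems by (intro compilesD[OF assms(2)]) auto
  have "runs (compile a \<rho> d L) (rep T st) (cost a \<sigma>) (rep T (st(d := st d @ ev a \<sigma>)))"
    using prems by (intro compilesD[OF assms(1)]) auto
  from runs_Seq[OF this 2] show ?case by simp
qed

lemma compiles_For:
  assumes "compiles T a" "compiles T b"
  shows "compiles T (For x a b)"
proof (rule compilesI)
  fix \<rho> L st \<sigma> d
  assume prems: "frame \<rho> L st \<sigma>" "d < L" "\<forall>x. \<rho> x \<noteq> d" "L + space (For x a b) \<le> T" "0 \<notin> syms (For x a b)"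
  let ?case = "runs (compile (For x a b) \<rho> d L) (rep T st) (cost (For x a b) \<sigma>) (rep T (st(d := st d @ ev (For x a b) \<sigma>)))"
  note fr = prems(1)
  let ?w = "ev a \<sigma>" and ?f = "\<lambda>i. ev b (\<sigma>(x := replicate i 1))"
  let ?n = "length ?w"
  let ?st = "\<lambda>i. st(L := take (?n - i) ?w, Suc L := replicate i 1,
    d := st d @ concat (map ?f [0..<i]))"
  have nb\<sigma>: "0 \<notin> set (\<sigma> y)" for y using fr by (rule frame_env_nonblank)
  have nbw: "0 \<notin> set ?w"
    using prems nb\<sigma> by (intro ev_nonblank) auto
  have nbf: "0 \<notin> set (?f i)" for i
    using prems nb\<sigma> by (intro ev_nonblank) auto
  have 1: "runs (compile a \<rho> L (Suc L)) (rep T st) (cost a \<sigma>) (rep T (?st 0))"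
  proof -
    \<comment> \<open>Tape \<open>L\<close> is empty, so it may be counted as lying below the
      scratch area and serve as the destination for \<open>a\<close>.\<close>
    have "frame \<rho> (Suc L) st \<sigma>"
      using frame_scratch[OF fr, of "[]"] frame_empty[OF fr, of L] by (simp add: fun_upd_idem)
    then have "runs (compile a \<rho> L (Suc L)) (rep T st) (cost a \<sigma>) (rep T (st(L := st L @ ?w)))"
      using prems fr by (intro compilesD[OF assms(1)]) (auto simp: frame_def)
    moreover have "st(L := st L @ ?w) = ?st 0"
      using frame_empty[OF fr] prems(2) by (auto simp: fun_eq_iff)
    ultimately show ?thesis by (simp only:)
  qed
  let ?body = "Seq (compile b (\<rho>(x := Suc L)) d (L + 2)) (Seq (push (Suc L) (\<lambda>_. 1)) (pop L))"
  have 2: "runs (Loop (\<lambda>ss. ss ! L \<noteq> 0) ?body) (rep T (?st 0))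
      ((\<Sum>i<?n. Suc (cost b (\<sigma>(x := replicate i 1)) + 3)) + 1) (rep T (?st ?n))"
  proof (rule runs_Loop_upto)
    fix i assume i: "i < ?n"
    then have ne: "take (?n - i) ?w \<noteq> []" by auto
    have nbt: "0 \<notin> set (take (?n - i) ?w)" using nbw by (auto dest: in_set_takeD)
    then show "map read_tape (rep T (?st i)) ! L \<noteq> 0"
      using ne top_of_eq_0[OF nbt] prems by simp
    let ?s1 = "(?st i)(d := ?st i d @ ?f i)"
    have "frame (\<rho>(x := Suc L)) (Suc (Suc L)) (st(L := take (?n - i) ?w, Suc L := replicate i 1))
        (\<sigma>(x := replicate i 1))"
      using fr nbt by (intro frame_bind frame_scratch) auto
    then have "frame (\<rho>(x := Suc L)) (L + 2) (?st i) (\<sigma>(x := replicate i 1))"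
      unfolding add_2_eq_Suc'
      by (rule frame_dest) (use prems(2,3) fr nbf in \<open>auto simp: frame_def\<close>)
    then have b1: "runs (compile b (\<rho>(x := Suc L)) d (L + 2)) (rep T (?st i))
        (cost b (\<sigma>(x := replicate i 1))) (rep T ?s1)"
      using prems(2-) by (intro compilesD[OF assms(2)]) auto
    let ?s2 = "?s1(Suc L := ?s1 (Suc L) @ [1])"
    have b2: "runs (push (Suc L) (\<lambda>_. 1)) (rep T ?s1) 2 (rep T ?s2)"
      using prems(4) by (intro runs_push_const) auto
    have b3: "runs (pop L) (rep T ?s2) 1 (rep T (?s2(L := butlast (?s2 L))))"
      using prems(2,4) ne by (intro runs_pop) auto
    have "?s2(L := butlast (?s2 L)) = ?st (Suc i)"
      using i prems(2) by (auto simp: fun_eq_iff butlast_take replicate_append_same)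
    then show "runs ?body (rep T (?st i)) (cost b (\<sigma>(x := replicate i 1)) + 3) (rep T (?st (Suc i)))"
      using runs_Seq[OF b1 runs_Seq[OF b2 b3]] by (elim runs_to) auto
  qed (use prems in \<open>simp add: top_of_def\<close>)
  have 3: "runs (clear (Suc L)) (rep T (?st ?n)) (2 * ?n + 1) (rep T ((?st ?n)(Suc L := [])))"
  proof -
    have "runs (clear (Suc L)) (rep T (?st ?n)) (2 * length (?st ?n (Suc L)) + 1)
        (rep T ((?st ?n)(Suc L := [])))"
      using prems by (intro runs_clear) auto
    then show ?thesis using prems(2) by (elim runs_to) auto
  qed
  have "(?st ?n)(Suc L := []) = st(d := st d @ ev (For x a b) \<sigma>)"
    using frame_empty[OF fr] prems(2) by (auto simp: fun_eq_iff)
  then show ?case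
    using runs_Seq[OF 1 runs_Seq[OF 2 3]] unfolding compile.simps
    by (elim runs_to) (auto simp: numeral_eq_Suc)
qed

lemma compiles_Bind:
  assumes "compiles T a" "compiles T b"
  shows "compiles T (Bind x a b)"
proof (rule compilesI)
  fix \<rho> L st \<sigma> d
  assume prems: "frame \<rho> L st \<sigma>" "d < L" "\<forall>x. \<rho> x \<noteq> d" "L + space (Bind x a b) \<le> T" "0 \<notin> syms (Bind x a b)"
  let ?case = "runs (compile (Bind x a b) \<rho> d L) (rep T st) (cost (Bind x a b) \<sigma>) (rep T (st(d := st d @ ev (Bind x a b) \<sigma>)))"
  note fr = prems(1)
  let ?w = "ev a \<sigma>" let ?v = "ev b (\<sigma>(x := ?w))"
  let ?s1 = "st(L := ?w)" and ?s2 = "st(L := ?w, d := st d @ ?v)"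
  have nb\<sigma>: "0 \<notin> set (\<sigma> y)" for y using fr by (rule frame_env_nonblank)
  have nbw: "0 \<notin> set ?w"
    using prems nb\<sigma> by (intro ev_nonblank) auto
  have "frame \<rho> (Suc L) st \<sigma>"
    using frame_scratch[OF fr, of "[]"] frame_empty[OF fr, of L] by (simp add: fun_upd_idem)
  then have "runs (compile a \<rho> L (Suc L)) (rep T st) (cost a \<sigma>) (rep T (st(L := st L @ ?w)))"
    using prems fr by (intro compilesD[OF assms(1)]) (auto simp: frame_def)
  then have 1: "runs (compile a \<rho> L (Suc L)) (rep T st) (cost a \<sigma>) (rep T ?s1)"
    using frame_empty[OF fr] by simp
  have "runs (compile b (\<rho>(x := L)) d (Suc L)) (rep T ?s1) (cost b (\<sigma>(x := ?w)))
      (rep T (?s1(d := ?s1 d @ ?v)))"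
    using prems nbw by (intro compilesD[OF assms(2)] frame_bind) auto
  then have 2: "runs (compile b (\<rho>(x := L)) d (Suc L)) (rep T ?s1) (cost b (\<sigma>(x := ?w))) (rep T ?s2)"
    using prems(2) by simp
  have "runs (clear L) (rep T ?s2) (2 * length (?s2 L) + 1) (rep T (?s2(L := [])))"
    using prems nbw by (intro runs_clear) auto
  moreover have "?s2(L := []) = st(d := st d @ ?v)"
    using frame_empty[OF fr] prems(2) by (auto simp: fun_eq_iff)
  ultimately have 3: "runs (clear L) (rep T ?s2) (2 * length ?w + 1) (rep T (st(d := st d @ ?v)))"
    using prems(2) by (elim runs_to) auto
  show ?case
    using runs_Seq[OF 1 runs_Seq[OF 2 3]] unfolding compile.simps by (elim runs_to) auto
qed

lemma compiles_Ite:
  assumes "compiles T c" "compiles T a" "compiles T b"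
  shows "compiles T (Ite c a b)"
proof (rule compilesI)
  fix \<rho> L st \<sigma> d
  assume prems: "frame \<rho> L st \<sigma>" "d < L" "\<forall>x. \<rho> x \<noteq> d" "L + space (Ite c a b) \<le> T" "0 \<notin> syms (Ite c a b)"
  let ?case = "runs (compile (Ite c a b) \<rho> d L) (rep T st) (cost (Ite c a b) \<sigma>) (rep T (st(d := st d @ ev (Ite c a b) \<sigma>)))"
  note fr = prems(1)
  let ?w = "ev c \<sigma>" let ?s1 = "st(L := ?w)"
  have nb\<sigma>: "0 \<notin> set (\<sigma> y)" for y using fr by (rule frame_env_nonblank)
  have nbw: "0 \<notin> set ?w"
    using prems nb\<sigma> by (intro ev_nonblank) auto
  have L: "L < T" using prems by simp
  have "frame \<rho> (Suc L) st \<sigma>"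
    using frame_scratch[OF fr, of "[]"] frame_empty[OF fr, of L] by (simp add: fun_upd_idem)
  then have "runs (compile c \<rho> L (Suc L)) (rep T st) (cost c \<sigma>) (rep T (st(L := st L @ ?w)))"
    using prems fr by (intro compilesD[OF assms(1)]) (auto simp: frame_def)
  then have 1: "runs (compile c \<rho> L (Suc L)) (rep T st) (cost c \<sigma>) (rep T ?s1)"
    using frame_empty[OF fr] by simp
  show ?case
  proof (cases "?w = []")
    case True
    then have "?s1 = st" using frame_empty[OF fr, of L] by (auto simp: fun_eq_iff)
    moreover have "runs (compile b \<rho> d L) (rep T st) (cost b \<sigma>) (rep T (st(d := st d @ ev b \<sigma>)))"
      using prems by (intro compilesD[OF assms(3)]) auto
    ultimately have "runs (Cond (\<lambda>ss. ss ! L \<noteq> 0) (Seq (clear L) (compile a \<rho> d L)) (compile b \<rho> d L))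
        (rep T ?s1) (Suc (cost b \<sigma>)) (rep T (st(d := st d @ ev b \<sigma>)))"
      using L frame_empty[OF fr, of L] by (intro runs_CondF) (auto simp: top_of_def)
    from runs_Seq[OF 1 this] True show ?thesis
      unfolding compile.simps by (elim runs_to) auto
  next
    case False
    have "runs (clear L) (rep T ?s1) (2 * length (?s1 L) + 1) (rep T (?s1(L := [])))"
      using L nbw by (intro runs_clear) auto
    moreover have "?s1(L := []) = st"
      using frame_empty[OF fr, of L] by (auto simp: fun_eq_iff)
    ultimately have 2: "runs (clear L) (rep T ?s1) (2 * length ?w + 1) (rep T st)"
      by (elim runs_to) auto
    have 3: "runs (compile a \<rho> d L) (rep T st) (cost a \<sigma>) (rep T (st(d := st d @ ev a \<sigma>)))"
      using prems by (intro compilesD[OF assms(2)]) auto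
    have "runs (Cond (\<lambda>ss. ss ! L \<noteq> 0) (Seq (clear L) (compile a \<rho> d L)) (compile b \<rho> d L))
        (rep T ?s1) (Suc (2 * length ?w + 1 + cost a \<sigma>)) (rep T (st(d := st d @ ev a \<sigma>)))"
      using L top_of_eq_0[OF nbw] False runs_Seq[OF 2 3] by (intro runs_CondT) auto
    from runs_Seq[OF 1 this] False show ?thesis
      unfolding compile.simps by (elim runs_to) auto
  qed
qed

lemma compiles_Less:
  assumes "compiles T a" "compiles T b"
  shows "compiles T (Less a b)"
proof (rule compilesI)
  fix \<rho> L st \<sigma> d
  assume prems: "frame \<rho> L st \<sigma>" "d < L" "\<forall>x. \<rho> x \<noteq> d" "L + space (Less a b) \<le> T" "0 \<notin> syms (Less a b)"
  let ?case = "runs (compile (Less a b) \<rho> d L) (rep T st) (cost (Less a b) \<sigma>) (rep T (st(d := st d @ ev (Less a b) \<sigma>)))"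
  note fr = prems(1)
  let ?v = "ev a \<sigma>" and ?w = "ev b \<sigma>"
  let ?n = "min (length ?v) (length ?w)" and ?r = "ev (Less a b) \<sigma>"
  let ?s1 = "st(L := ?v)" let ?s2 = "?s1(Suc L := ?w)"
  let ?s3 = "st(L := take (length ?v - ?n) ?v, Suc L := take (length ?w - ?n) ?w)"
  let ?s4 = "?s3(d := st d @ ?r)"
  have nb\<sigma>: "0 \<notin> set (\<sigma> y)" for y using fr by (rule frame_env_nonblank)
  have nb: "0 \<notin> set ?v" "0 \<notin> set ?w"
    by (rule ev_nonblank; use prems nb\<sigma> in simp)+
  have nbt: "0 \<notin> set (take i ?v)" "0 \<notin> set (take i ?w)" for i
    using nb by (auto dest: in_set_takeD)
  have T: "Suc L < T" using prems by simp
  have "frame \<rho> (Suc L) st \<sigma>"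
    using frame_scratch[OF fr, of "[]"] frame_empty[OF fr, of L] by (simp add: fun_upd_idem)
  then have "runs (compile a \<rho> L (Suc L)) (rep T st) (cost a \<sigma>) (rep T (st(L := st L @ ?v)))"
    using prems fr by (intro compilesD[OF assms(1)]) (auto simp: frame_def)
  then have 1: "runs (compile a \<rho> L (Suc L)) (rep T st) (cost a \<sigma>) (rep T ?s1)"
    using frame_empty[OF fr] by simp
  have fr1: "frame \<rho> (Suc L) ?s1 \<sigma>" using frame_scratch[OF fr nb(1)] .
  have "frame \<rho> (L + 2) ?s1 \<sigma>"
    using frame_scratch[OF fr1, of "[]"] frame_empty[OF fr1, of "Suc L"] by (simp add: fun_upd_idem)
  moreover have "\<rho> x \<noteq> Suc L" for x
  proof -
    have "\<rho> x < L" using fr by (simp add: frame_def)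
    then show ?thesis by simp
  qed
  ultimately have "runs (compile b \<rho> (Suc L) (L + 2)) (rep T ?s1) (cost b \<sigma>)
      (rep T (?s1(Suc L := ?s1 (Suc L) @ ?w)))"
    using prems by (intro compilesD[OF assms(2)]) auto
  then have 2: "runs (compile b \<rho> (Suc L) (L + 2)) (rep T ?s1) (cost b \<sigma>) (rep T ?s2)"
    using frame_empty[OF fr] by simp
  let ?loop = "Loop (\<lambda>ss. ss ! L \<noteq> 0 \<and> ss ! Suc L \<noteq> 0) (Seq (pop L) (pop (Suc L)))"
  have "runs ?loop (rep T ?s2) (3 * min (length (?s2 L)) (length (?s2 (Suc L))) + 1)
      (rep T (?s2(L := take (length (?s2 L) - min (length (?s2 L)) (length (?s2 (Suc L)))) (?s2 L),
        Suc L := take (length (?s2 (Suc L)) - min (length (?s2 L)) (length (?s2 (Suc L)))) (?s2 (Suc L)))))"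
    using T nb by (intro runs_pop2_loop) auto
  then have 3: "runs ?loop (rep T ?s2) (3 * length ?v + 1) (rep T ?s3)"
    by (rule runs_to) (auto intro!: arg_cong[of _ _ "rep T"])
  have 4: "runs (Cond (\<lambda>ss. ss ! Suc L \<noteq> 0) (push d (\<lambda>_. 1)) noop) (rep T ?s3) 3 (rep T ?s4)"
  proof (cases "length ?v < length ?w")
    case True
    then have "take (length ?w - ?n) ?w \<noteq> []" by auto
    then have "runs (Cond (\<lambda>ss. ss ! Suc L \<noteq> 0) (push d (\<lambda>_. 1)) noop) (rep T ?s3) (Suc 2)
        (rep T (?s3(d := ?s3 d @ [1])))"
      using T prems(2) top_of_eq_0[OF nbt(2), of "length ?w - ?n"]
      by (intro runs_CondT runs_push_const) simp_all
    moreover have "?s3(d := ?s3 d @ [1]) = ?s4"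
      using True prems(2) by (auto simp: fun_eq_iff)
    ultimately show ?thesis by (elim runs_to) auto
  next
    case False
    then have "runs (Cond (\<lambda>ss. ss ! Suc L \<noteq> 0) (push d (\<lambda>_. 1)) noop) (rep T ?s3) (Suc 1) (rep T ?s3)"
      using T by (intro runs_CondF runs_noop) (simp add: top_of_def)
    moreover have "?s3 = ?s4"
      using False prems(2) by (auto simp: fun_eq_iff)
    ultimately show ?thesis by (elim runs_to) auto
  qed
  have "runs (clear L) (rep T ?s4) (2 * length (?s4 L) + 1) (rep T (?s4(L := [])))"
    using T prems(2) nbt by (intro runs_clear) auto
  then have 5: "runs (clear L) (rep T ?s4) (2 * length ?v + 1) (rep T (?s4(L := [])))"
    using prems(2) by (elim runs_to) auto
  have "runs (clear (Suc L)) (rep T (?s4(L := []))) (2 * length ((?s4(L := [])) (Suc L)) + 1)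
      (rep T (?s4(L := [], Suc L := [])))"
    using T prems(2) nbt by (intro runs_clear) auto
  moreover have "?s4(L := [], Suc L := []) = st(d := st d @ ?r)"
    using frame_empty[OF fr] prems(2) by (auto simp: fun_eq_iff)
  ultimately have 6: "runs (clear (Suc L)) (rep T (?s4(L := []))) (2 * length ?w + 1)
      (rep T (st(d := st d @ ?r)))"
    using prems(2) by (elim runs_to) auto
  from runs_Seq[OF 1 runs_Seq[OF 2 runs_Seq[OF 3 runs_Seq[OF 4 runs_Seq[OF 5 6]]]]]
  show ?case unfolding compile.simps by (elim runs_to) auto
qed

lemma compiles_At:
  assumes "compiles T a" "compiles T i"
  shows "compiles T (At a i c)"
proof (rule compilesI)
  fix \<rho> L st \<sigma> d
  assume prems: "frame \<rho> L st \<sigma>" "d < L" "\<forall>x. \<rho> x \<noteq> d" "L + space (At a i c) \<le> T" "0 \<notin> syms (At a i c)"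
  let ?case = "runs (compile (At a i c) \<rho> d L) (rep T st) (cost (At a i c) \<sigma>) (rep T (st(d := st d @ ev (At a i c) \<sigma>)))"
  note fr = prems(1)
  let ?v = "ev i \<sigma>" and ?w = "ev a \<sigma>"
  let ?n = "min (length ?v) (length ?w)" and ?r = "ev (At a i c) \<sigma>"
  let ?s1 = "st(L := ?v)" let ?s2 = "?s1(Suc L := ?w)"
  \<comment> \<open>The reversed word has its first letter on top, so popping it in step with the
    index exposes the letter at that index.\<close>
  let ?s2' = "?s1(L + 2 := rev ?w)"
  let ?s3 = "st(L := take (length ?v - ?n) ?v, L + 2 := take (length ?w - ?n) (rev ?w))"
  let ?s4 = "?s3(d := st d @ ?r)"
  have nb\<sigma>: "0 \<notin> set (\<sigma> y)" for y using fr by (rule frame_env_nonblank)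
  have nb: "0 \<notin> set ?v" "0 \<notin> set ?w"
    by (rule ev_nonblank; use prems nb\<sigma> in simp)+
  have nbt: "0 \<notin> set (take j ?v)" "0 \<notin> set (take j (rev ?w))" for j
    using nb by (auto dest: in_set_takeD)
  have T: "L + 2 < T" using prems by simp
  have "frame \<rho> (Suc L) st \<sigma>"
    using frame_scratch[OF fr, of "[]"] frame_empty[OF fr, of L] by (simp add: fun_upd_idem)
  then have "runs (compile i \<rho> L (Suc L)) (rep T st) (cost i \<sigma>) (rep T (st(L := st L @ ?v)))"
    using prems fr by (intro compilesD[OF assms(2)]) (auto simp: frame_def)
  then have 1: "runs (compile i \<rho> L (Suc L)) (rep T st) (cost i \<sigma>) (rep T ?s1)"
    using frame_empty[OF fr] by simp
  have fr1: "frame \<rho> (Suc L) ?s1 \<sigma>" using frame_scratch[OF fr nb(1)] .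
  have "frame \<rho> (L + 2) ?s1 \<sigma>"
    using frame_scratch[OF fr1, of "[]"] frame_empty[OF fr1, of "Suc L"] by (simp add: fun_upd_idem)
  moreover have "\<rho> x \<noteq> Suc L" for x
  proof -
    have "\<rho> x < L" using fr by (simp add: frame_def)
    then show ?thesis by simp
  qed
  ultimately have "runs (compile a \<rho> (Suc L) (L + 2)) (rep T ?s1) (cost a \<sigma>)
      (rep T (?s1(Suc L := ?s1 (Suc L) @ ?w)))"
    using prems by (intro compilesD[OF assms(1)]) auto
  then have 2: "runs (compile a \<rho> (Suc L) (L + 2)) (rep T ?s1) (cost a \<sigma>) (rep T ?s2)"
    using frame_empty[OF fr] by simp
  have "runs (pour [L + 2] (Suc L)) (rep T ?s2)
      ((2 * length [L + 2] + 2) * length (?s2 (Suc L)) + 1)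
      (rep T ((append_on [L + 2] (rev (?s2 (Suc L))) ?s2)(Suc L := [])))"
    using T nb by (intro runs_pour) auto
  moreover have "(append_on [L + 2] (rev (?s2 (Suc L))) ?s2)(Suc L := []) = ?s2'"
    using frame_empty[OF fr] by (auto simp: append_on_def fun_eq_iff)
  ultimately have 5: "runs (pour [L + 2] (Suc L)) (rep T ?s2) (4 * length ?w + 1) (rep T ?s2')"
    by (elim runs_to) auto
  let ?loop = "Loop (\<lambda>ss. ss ! L \<noteq> 0 \<and> ss ! (L + 2) \<noteq> 0) (Seq (pop L) (pop (L + 2)))"
  have "runs ?loop (rep T ?s2') (3 * min (length (?s2' L)) (length (?s2' (L + 2))) + 1)
      (rep T (?s2'(L := take (length (?s2' L) - min (length (?s2' L)) (length (?s2' (L + 2)))) (?s2' L),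
        L + 2 := take (length (?s2' (L + 2)) - min (length (?s2' L)) (length (?s2' (L + 2)))) (?s2' (L + 2)))))"
    using T nb by (intro runs_pop2_loop) auto
  then have 3: "runs ?loop (rep T ?s2') (3 * length ?v + 1) (rep T ?s3)"
    by (rule runs_to) (auto intro!: arg_cong[of _ _ "rep T"])
  \<comment> \<open>If the index equals the length of the word, both stacks end up empty and read 0;
    only \<open>c \<noteq> 0\<close> tells this apart from a hit.\<close>
  have c: "c \<noteq> 0" using prems(5) by auto
  let ?cond = "Cond (\<lambda>ss. ss ! L = 0 \<and> ss ! (L + 2) = c) (push d (\<lambda>_. 1)) noop"
  have top: "top_of (take (length ?v - ?n) ?v) = 0 \<and> top_of (take (length ?w - ?n) (rev ?w)) = c
      \<longleftrightarrow> length ?v < length ?w \<and> ?w ! length ?v = c"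
  proof (cases "length ?v < length ?w")
    case True
    then have "top_of (take (length ?w - ?n) (rev ?w)) = ?w ! length ?v"
      by (subst top_of_take) (auto simp: rev_nth)
    then show ?thesis using True by (simp add: top_of_def)
  next
    case False
    then show ?thesis using c by (simp add: top_of_def)
  qed
  have 4: "runs ?cond (rep T ?s3) 3 (rep T ?s4)"
  proof (cases "length ?v < length ?w \<and> ?w ! length ?v = c")
    case True
    then have "runs ?cond (rep T ?s3) (Suc 2) (rep T (?s3(d := ?s3 d @ [1])))"
      using T prems(2) top by (intro runs_CondT runs_push_const) simp_all
    moreover have "?s3(d := ?s3 d @ [1]) = ?s4"
      using True prems(2) by (auto simp: fun_eq_iff)
    ultimately show ?thesis by (elim runs_to) auto
  next
    case False
    then have "runs ?cond (rep T ?s3) (Suc 1) (rep T ?s3)"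
      using T top by (intro runs_CondF runs_noop) simp
    moreover have "?s3 = ?s4"
      using False prems(2) by (auto simp: fun_eq_iff)
    ultimately show ?thesis by (elim runs_to) auto
  qed
  have "runs (clear L) (rep T ?s4) (2 * length (?s4 L) + 1) (rep T (?s4(L := [])))"
    using T prems(2) nbt by (intro runs_clear) auto
  then have 6: "runs (clear L) (rep T ?s4) (2 * length ?v + 1) (rep T (?s4(L := [])))"
    using prems(2) by (elim runs_to) auto
  have "runs (clear (L + 2)) (rep T (?s4(L := []))) (2 * length ((?s4(L := [])) (L + 2)) + 1)
      (rep T (?s4(L := [], L + 2 := [])))"
    using T prems(2) nbt by (intro runs_clear) auto
  moreover have "?s4(L := [], L + 2 := []) = st(d := st d @ ?r)"
    using frame_empty[OF fr] prems(2) by (auto simp: fun_eq_iff)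
  ultimately have 7: "runs (clear (L + 2)) (rep T (?s4(L := []))) (2 * length ?w + 1)
      (rep T (st(d := st d @ ?r)))"
    using prems(2) by (elim runs_to) auto
  from runs_Seq[OF 1 runs_Seq[OF 2 runs_Seq[OF 5 runs_Seq[OF 3 runs_Seq[OF 4 runs_Seq[OF 6 7]]]]]]
  show ?case unfolding compile.simps by (elim runs_to) auto
qed

lemma compiles: "compiles T e"
  by (induction e) (auto intro: compiles_Emp compiles_Sym compiles_Var compiles_App compiles_For
    compiles_Bind compiles_Ite compiles_Less compiles_At)

lemmas runs_compile = compilesD[OF compiles]

section \<open>Polynomial running time\<close>

text \<open>With \<open>B \<ge> 2\<close> the bounds \<open>B ^ c\<close> are closed under sums,
  products and substitution, and a constant factor \<open>K\<close> moves into the exponent because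
  \<open>K \<le> 2 ^ K\<close>. Size is bounded along with time because the size of one word bounds
  the number of rounds of a loop.\<close>

definition poly_bounded :: "exp \<Rightarrow> nat \<Rightarrow> bool" where
  "poly_bounded e c \<longleftrightarrow> (\<forall>B\<ge>2. \<forall>\<sigma>. (\<forall>x. length (\<sigma> x) \<le> B) \<longrightarrow>
    length (ev e \<sigma>) \<le> B ^ c \<and> cost e \<sigma> \<le> B ^ c)"

lemma poly_boundedD:
  "poly_bounded e c \<Longrightarrow> 2 \<le> B \<Longrightarrow> (\<And>x. length (\<sigma> x) \<le> B) \<Longrightarrow>
    length (ev e \<sigma>) \<le> B ^ c \<and> cost e \<sigma> \<le> B ^ c"
  by (simp add: poly_bounded_def)

lemma poly_bounded_mono:
  assumes "poly_bounded e c" "c \<le> c'"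
  shows "poly_bounded e c'"
proof -
  have "(B::nat) ^ c \<le> B ^ c'" if "2 \<le> B" for B
    using that assms(2) by (intro power_increasing) auto
  then show ?thesis using assms(1) unfolding poly_bounded_def by (meson le_trans)
qed

lemma mult_le_power: "2 \<le> (B::nat) \<Longrightarrow> K * B ^ c \<le> B ^ (c + K)"
proof -
  assume B: "2 \<le> B"
  have "K \<le> 2 ^ K" by (simp add: less_imp_le_nat)
  also have "\<dots> \<le> B ^ K" using B by (intro power_mono) auto
  finally show ?thesis by (simp add: power_add mult.commute)
qed

lemma le_mult_powerI: "2 \<le> (B::nat) \<Longrightarrow> x \<le> K * B ^ c \<Longrightarrow> x \<le> B ^ (c + K)"
  using mult_le_power[of B K c] by linarith

text \<open>The bound \<open>B\<close> on the environment is replaced by \<open>B ^ Suc k\<close>,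
  which dominates both \<open>B\<close> and \<open>B ^ k\<close> (even for \<open>k = 0\<close>);
  under such a substitution exponents multiply.\<close>

lemma poly_bounded_bind:
  assumes "poly_bounded b c" "2 \<le> B" "\<And>y. length (\<sigma> y) \<le> B" "length w \<le> B ^ k"
  shows "length (ev b (\<sigma>(x := w))) \<le> B ^ (Suc k * c) \<and> cost b (\<sigma>(x := w)) \<le> B ^ (Suc k * c)"
proof -
  have "B ^ 1 \<le> B ^ Suc k" "B ^ k \<le> B ^ Suc k" using assms(2) by (intro power_increasing; simp)+
  then have "length ((\<sigma>(x := w)) y) \<le> B ^ Suc k" for y
    using assms(3)[of y] assms(4) by (simp del: power_Suc)
  moreover have "2 \<le> B ^ Suc k" using \<open>B ^ 1 \<le> B ^ Suc k\<close> assms(2) by (simp del: power_Suc)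
  ultimately show ?thesis
    using poly_boundedD[OF assms(1), of "B ^ Suc k" "\<sigma>(x := w)"] by (simp only: power_mult)
qed

lemma poly_bounded_ex: "\<exists>c. poly_bounded e c"
proof (induction e)
  case Emp
  have "poly_bounded Emp 0" by (simp add: poly_bounded_def)
  then show ?case ..
next
  case (Sym a)
  have "poly_bounded (Sym a) 1" by (simp add: poly_bounded_def)
  then show ?case ..
next
  case (Var x)
  have "poly_bounded (Var x) (1 + 12)"
    unfolding poly_bounded_def
  proof (intro allI impI conjI; rule le_mult_powerI)
    fix B :: nat and \<sigma> :: "nat \<Rightarrow> nat list"
    assume B: "2 \<le> B" "\<forall>x. length (\<sigma> x) \<le> B"
    have "length (\<sigma> x) \<le> B" using B by simp
    then show "length (ev (Var x) \<sigma>) \<le> 12 * B ^ 1" "cost (Var x) \<sigma> \<le> 12 * B ^ 1"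
      using B(1) by simp_all
  qed
  then show ?case ..
next
  case (App a b)
  then obtain ca cb where "poly_bounded a ca" "poly_bounded b cb" by blast
  then have p: "poly_bounded a (ca + cb)" "poly_bounded b (ca + cb)"
    by (auto elim: poly_bounded_mono)
  have "poly_bounded (App a b) (ca + cb + 2)"
    unfolding poly_bounded_def
  proof (intro allI impI conjI; rule le_mult_powerI)
    fix B :: nat and \<sigma> :: "nat \<Rightarrow> nat list"
    assume B: "2 \<le> B" "\<forall>x. length (\<sigma> x) \<le> B"
    show "length (ev (App a b) \<sigma>) \<le> 2 * B ^ (ca + cb)" "cost (App a b) \<sigma> \<le> 2 * B ^ (ca + cb)"
      using poly_boundedD[OF p(1), of B \<sigma>] poly_boundedD[OF p(2), of B \<sigma>] B by simp_all
  qed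
  then show ?case ..
next
  case (For x a b)
  then obtain ca cb where p: "poly_bounded a ca" "poly_bounded b cb" by blast
  let ?E = "Suc ca * cb"
  \<comment> \<open>10 = 1 + (1 + 4) + 2 + 2 adds up the coefficients in the cost of a loop, each of
    whose terms is at most \<open>B ^ ca * B ^ ?E\<close>.\<close>
  have "poly_bounded (For x a b) (ca + ?E + 10)"
    unfolding poly_bounded_def
  proof (intro allI impI conjI; rule le_mult_powerI)
    fix B :: nat and \<sigma> :: "nat \<Rightarrow> nat list"
    assume B: "2 \<le> B" "\<forall>x. length (\<sigma> x) \<le> B"
    have a: "length (ev a \<sigma>) \<le> B ^ ca" "cost a \<sigma> \<le> B ^ ca"
      using poly_boundedD[OF p(1), of B \<sigma>] B by simp_all
    have b: "length (ev b (\<sigma>(x := replicate i 1))) \<le> B ^ ?E"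
      "cost b (\<sigma>(x := replicate i 1)) \<le> B ^ ?E" if "i < length (ev a \<sigma>)" for i
      using poly_bounded_bind[OF p(2) B(1), of \<sigma> "replicate i 1" ca] B(2) a(1) that by simp_all
    have M: "B ^ (ca + ?E) = B ^ ca * B ^ ?E" by (rule power_add)
    have pos: "1 \<le> B ^ ca" "1 \<le> B ^ ?E" using B(1) by (simp_all add: Suc_le_eq)
    then have M': "B ^ ca \<le> B ^ ca * B ^ ?E" "1 \<le> B ^ ca * B ^ ?E" by simp_all
    have "(\<Sum>i<length (ev a \<sigma>). length (ev b (\<sigma>(x := replicate i 1)))) \<le>
        of_nat (card {..<length (ev a \<sigma>)}) * B ^ ?E"
      using b by (intro sum_bounded_above) auto
    also have "\<dots> \<le> B ^ ca * B ^ ?E" using a(1) by simp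
    finally show "length (ev (For x a b) \<sigma>) \<le> 10 * B ^ (ca + ?E)"
      using M by (simp add: length_concat comp_def interv_sum_list_conv_sum_set_nat atLeast0LessThan)
    have "(\<Sum>i<length (ev a \<sigma>). cost b (\<sigma>(x := replicate i 1)) + 4) \<le>
        of_nat (card {..<length (ev a \<sigma>)}) * (B ^ ?E + 4)"
      using b by (intro sum_bounded_above) auto
    also have "\<dots> \<le> B ^ ca * (B ^ ?E + 4)" using a(1) by simp
    also have "\<dots> = B ^ ca * B ^ ?E + 4 * B ^ ca" by (simp add: algebra_simps)
    finally show "cost (For x a b) \<sigma> \<le> 10 * B ^ (ca + ?E)"
      using a M' unfolding M cost.simps by linarith
  qed
  then show ?case ..
next
  case (Bind x a b)
  then obtain ca cb where p: "poly_bounded a ca" "poly_bounded b cb" by blast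
  let ?E = "Suc ca * cb"
  have "poly_bounded (Bind x a b) (ca + ?E + 5)"
    unfolding poly_bounded_def
  proof (intro allI impI conjI; rule le_mult_powerI)
    fix B :: nat and \<sigma> :: "nat \<Rightarrow> nat list"
    assume B: "2 \<le> B" "\<forall>x. length (\<sigma> x) \<le> B"
    have a: "length (ev a \<sigma>) \<le> B ^ ca" "cost a \<sigma> \<le> B ^ ca"
      using poly_boundedD[OF p(1), of B \<sigma>] B by simp_all
    have b: "length (ev b (\<sigma>(x := ev a \<sigma>))) \<le> B ^ ?E" "cost b (\<sigma>(x := ev a \<sigma>)) \<le> B ^ ?E"
      using poly_bounded_bind[OF p(2) B(1), of \<sigma> "ev a \<sigma>" ca] B(2) a(1) by simp_all
    have M: "B ^ (ca + ?E) = B ^ ca * B ^ ?E" by (rule power_add)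
    have "1 \<le> B ^ ca" "1 \<le> B ^ ?E" using B(1) by (simp_all add: Suc_le_eq)
    then have M': "B ^ ca \<le> B ^ ca * B ^ ?E" "B ^ ?E \<le> B ^ ca * B ^ ?E" "1 \<le> B ^ ca * B ^ ?E"
      by simp_all
    show "length (ev (Bind x a b) \<sigma>) \<le> 5 * B ^ (ca + ?E)"
      using b M' unfolding M ev.simps by linarith
    show "cost (Bind x a b) \<sigma> \<le> 5 * B ^ (ca + ?E)"
      using a b M' unfolding M cost.simps by linarith
  qed
  then show ?case ..
next
  case (Ite d a b)
  then obtain cd ca cb where "poly_bounded d cd" "poly_bounded a ca" "poly_bounded b cb" by blast
  then have p: "poly_bounded d (cd + ca + cb)" "poly_bounded a (cd + ca + cb)"
    "poly_bounded b (cd + ca + cb)"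
    by (auto elim: poly_bounded_mono)
  have "poly_bounded (Ite d a b) (cd + ca + cb + 7)"
    unfolding poly_bounded_def
  proof (intro allI impI conjI; rule le_mult_powerI)
    fix B :: nat and \<sigma> :: "nat \<Rightarrow> nat list"
    assume B: "2 \<le> B" "\<forall>x. length (\<sigma> x) \<le> B"
    then have pos: "1 \<le> B ^ (cd + ca + cb)" by (simp add: Suc_le_eq)
    note bounds = p[THEN poly_boundedD, of B \<sigma>, OF B(1) B(2)[rule_format]]
    show "length (ev (Ite d a b) \<sigma>) \<le> 7 * B ^ (cd + ca + cb)"
      using bounds pos unfolding ev.simps by (auto split: if_split)
    show "cost (Ite d a b) \<sigma> \<le> 7 * B ^ (cd + ca + cb)"
      using bounds pos unfolding cost.simps by linarith
  qed
  then show ?case ..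
next
  case (Less a b)
  then obtain ca cb where "poly_bounded a ca" "poly_bounded b cb" by blast
  then have p: "poly_bounded a (ca + cb)" "poly_bounded b (ca + cb)"
    by (auto elim: poly_bounded_mono)
  have "poly_bounded (Less a b) (ca + cb + 15)"
    unfolding poly_bounded_def
  proof (intro allI impI conjI; rule le_mult_powerI)
    fix B :: nat and \<sigma> :: "nat \<Rightarrow> nat list"
    assume B: "2 \<le> B" "\<forall>x. length (\<sigma> x) \<le> B"
    then have pos: "1 \<le> B ^ (ca + cb)" by (simp add: Suc_le_eq)
    note bounds = p[THEN poly_boundedD, of B \<sigma>, OF B(1) B(2)[rule_format]]
    show "length (ev (Less a b) \<sigma>) \<le> 15 * B ^ (ca + cb)"
      using bounds pos unfolding ev.simps by (auto split: if_split)
    show "cost (Less a b) \<sigma> \<le> 15 * B ^ (ca + cb)"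
      using bounds pos unfolding cost.simps by linarith
  qed
  then show ?case ..
next
  case (At a i c)
  then obtain ca ci where "poly_bounded a ca" "poly_bounded i ci" by blast
  then have p: "poly_bounded a (ca + ci)" "poly_bounded i (ca + ci)"
    by (auto elim: poly_bounded_mono)
  have "poly_bounded (At a i c) (ca + ci + 20)"
    unfolding poly_bounded_def
  proof (intro allI impI conjI; rule le_mult_powerI)
    fix B :: nat and \<sigma> :: "nat \<Rightarrow> nat list"
    assume B: "2 \<le> B" "\<forall>x. length (\<sigma> x) \<le> B"
    then have pos: "1 \<le> B ^ (ca + ci)" by (simp add: Suc_le_eq)
    note bounds = p[THEN poly_boundedD, of B \<sigma>, OF B(1) B(2)[rule_format]]
    show "length (ev (At a i c) \<sigma>) \<le> 20 * B ^ (ca + ci)"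
      using bounds pos unfolding ev.simps by (auto split: if_split)
    show "cost (At a i c) \<sigma> \<le> 20 * B ^ (ca + ci)"
      using bounds pos unfolding cost.simps by linarith
  qed
  then show ?case ..
qed

text \<open>The machine starts with its heads on cell 0, whereas a stack has its head on the last
  letter. The loop stops on the blank behind the word, one cell too far, hence the final move to the
  left.\<close>

definition to_end :: "nat \<Rightarrow> cmd" where
  "to_end j = Seq (Loop (\<lambda>ss. ss ! j \<noteq> 0) (act_on j (\<lambda>ss. ss ! j) MoveRight))
    (act_on j (\<lambda>ss. ss ! j) MoveLeft)"

lemma runs_to_end:
  assumes j: "j < length ts" and t: "ts ! j = (word_content w, 0)" and nb: "0 \<notin> set w"
  shows "runs (to_end j) ts (2 * length w + 2) (ts[j := stack_tape w])"
proof -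
  let ?s = "\<lambda>i. ts[j := (word_content w, int i)]"
  have rd: "map read_tape (?s i) ! j = word_content w (int i)" for i
    using j by simp
  have act: "runs (act_on j (\<lambda>ss. ss ! j) m) (?s i) 1 (ts[j := (word_content w, move_head m (int i))])"
    for m i
    using runs_act_on[of j "?s i" "\<lambda>ss. ss ! j" m] j by simp
  have "runs (Loop (\<lambda>ss. ss ! j \<noteq> 0) (act_on j (\<lambda>ss. ss ! j) MoveRight)) (?s 0)
      ((\<Sum>i<length w. Suc 1) + 1) (?s (length w))"
  proof (rule runs_Loop_upto)
    fix i assume i: "i < length w"
    then show "map read_tape (?s i) ! j \<noteq> 0"
      unfolding rd using nb nth_mem[OF i] by (metis (mono_tags) word_content_def nat_int of_nat_0_le_iff of_nat_less_iff)
    show "runs (act_on j (\<lambda>ss. ss ! j) MoveRight) (?s i) 1 (?s (Suc i))"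
      using act[of MoveRight i] by (simp add: add.commute)
  qed (unfold rd, simp add: word_content_def)
  moreover have "?s 0 = ts" using t by (simp flip: t)
  ultimately have "runs (Loop (\<lambda>ss. ss ! j \<noteq> 0) (act_on j (\<lambda>ss. ss ! j) MoveRight)) ts
      ((\<Sum>i<length w. Suc 1) + 1) (?s (length w))" by (simp only:)
  from runs_Seq[OF this act[of MoveLeft "length w"]] show ?thesis
    unfolding to_end_def by (elim runs_to) (auto simp: stack_tape_def)
qed

fun all_to_end :: "nat \<Rightarrow> cmd" where
  "all_to_end 0 = noop"
| "all_to_end (Suc j) = Seq (all_to_end j) (to_end j)"

lemma runs_all_to_end:
  assumes "n \<le> T" "\<And>j. 0 \<notin> set (st j)" "\<And>j. length (st j) \<le> N"
  shows "runs (all_to_end n) (map (\<lambda>j. (word_content (st j), 0)) [0..<T]) (n * (2 * N + 2) + 1)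
    (map (\<lambda>j. if j < n then stack_tape (st j) else (word_content (st j), 0)) [0..<T])"
  using assms(1)
proof (induction n)
  case 0
  show ?case using runs_noop by simp
next
  case (Suc n)
  let ?s = "\<lambda>n. map (\<lambda>j. if j < n then stack_tape (st j) else (word_content (st j), 0)) [0..<T]"
  have "runs (to_end n) (?s n) (2 * length (st n) + 2) ((?s n)[n := stack_tape (st n)])"
    using Suc.prems assms(2) by (intro runs_to_end) auto
  moreover have "(?s n)[n := stack_tape (st n)] = ?s (Suc n)"
    using Suc.prems by (intro nth_equalityI) (auto simp: nth_list_update less_Suc_eq)
  ultimately have 2: "runs (to_end n) (?s n) (2 * length (st n) + 2) (?s (Suc n))"
    by (simp only:)
  have 1: "runs (all_to_end n) (map (\<lambda>j. (word_content (st j), 0)) [0..<T]) (n * (2 * N + 2) + 1) (?s n)"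
    using Suc by simp
  show ?case
    using runs_Seq[OF 1 2] assms(3)[of n] unfolding all_to_end.simps by (elim runs_to) auto
qed

lemma wf_all_to_end: "n \<le> T \<Longrightarrow> wf_cmd T S (all_to_end n)"
  by (induction n) (auto simp: to_end_def nth_symbol)

lemma tape_holds_stack_tape: "0 \<notin> set w \<Longrightarrow> tape_holds (stack_tape w) w"
  by (simp add: tape_holds_def stack_tape_def word_content_def)

text \<open>The value replaces the first input while the other inputs survive: in a reduction the
  parameter thus stays on the second tape and becomes the new parameter.\<close>

theorem exp_machine:
  assumes e: "0 \<notin> syms e" and n: "0 < n"
  shows "\<exists>M c. wf_tm M \<and>
    (\<forall>ws. length ws = n \<and> (\<forall>w\<in>set ws. 0 \<notin> set w \<and> set w \<subseteq> {..<S}) \<longrightarrow>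
      tm_computes M ws (ev e (\<lambda>x. ws ! min x (n - 1)) # tl ws) ((sum_list (map length ws) + 2) ^ c))"
proof -
  \<comment> \<open>Besides the inputs there is the result tape \<open>n\<close>. The final copy
    uses tape \<open>Suc n\<close> as scratch space, even if \<open>space e = 0\<close>.\<close>
  define T where "T = n + 2 + space e"
  \<comment> \<open>There are infinitely many variables; all those beyond the inputs share the tape
    of the last input, since \<open>frame\<close> does not ask for distinct tapes.\<close>
  define \<rho> where "\<rho> = (\<lambda>x. min x (n - 1))"
  \<comment> \<open>Blank tapes are prepared as well, since an empty stack has its head on cell -1.
    The value is built on a separate tape because \<open>e\<close> may read tape 0 until the
    end.\<close>
  define code where "code = Seq (all_to_end T) (Seq (compile e \<rho> n (Suc n))
    (Seq (clear 0) (copy n 0 (Suc n))))"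
  have "finite (syms e)" by (induction e) auto
  then obtain m where m: "syms e \<subseteq> {..<m}"
    using finite_nat_iff_bounded by auto
  \<comment> \<open>Room for the input letters, the symbols of \<open>e\<close> and the symbol 1
    that counters use.\<close>
  define S' where "S' = S + m + 2"
  obtain c where c: "poly_bounded e c" using poly_bounded_ex by blast
  have "wf_cmd T S' (compile e \<rho> n (Suc n))"
    using m n by (intro wf_compile) (auto simp: T_def S'_def \<rho>_def)
  then have "wf_cmd T S' code"
    by (auto simp: code_def copy_def wf_all_to_end) (auto simp: T_def S'_def)
  then have wf: "wf_tm (machine T S' code)"
    by (rule wf_machine) (simp add: S'_def)
  \<comment> \<open>\<open>2 * T\<close> pays for moving \<open>T\<close> heads, and 20 for
    evaluation, clearing and copying, in units of \<open>B ^ Suc c\<close>.\<close>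
  let ?K = "2 * T + 20"
  have "tm_computes (machine T S' code) ws (ev e (\<lambda>x. ws ! min x (n - 1)) # tl ws)
      ((sum_list (map length ws) + 2) ^ (Suc c + ?K))"
    if ws: "length ws = n" "\<And>w. w \<in> set ws \<Longrightarrow> 0 \<notin> set w \<and> set w \<subseteq> {..<S}" for ws
  proof -
    define \<sigma> where "\<sigma> = (\<lambda>x. ws ! min x (n - 1))"
    define st where "st = (\<lambda>j. if j < n then ws ! j else [])"
    define B where "B = sum_list (map length ws) + 2"
    define v where "v = ev e \<sigma>"
    have len: "length w \<le> sum_list (map length ws)" if "w \<in> set ws" for w
      using that by (intro member_le_sum_list) auto
    have nb: "0 \<notin> set (st j)" for j using ws n by (auto simp: st_def)
    have lenst: "length (st j) \<le> B - 2" for j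
      using len[of "ws ! j"] ws by (auto simp: st_def B_def)
    have nb\<sigma>: "0 \<notin> set (\<sigma> x)" for x using ws n by (simp add: \<sigma>_def)
    have lens: "length (\<sigma> x) \<le> B" for x
      using len[of "\<sigma> x"] ws n by (simp add: \<sigma>_def B_def)
    have nbv: "0 \<notin> set v" unfolding v_def using e nb\<sigma> by (rule ev_nonblank)
    have fr: "frame \<rho> (Suc n) st \<sigma>"
      using n nb by (auto simp: frame_def \<rho>_def \<sigma>_def st_def)
    have init: "init_config (machine T S' code) ws =
        (0, map (\<lambda>j. (word_content (st j), 0)) [0..<T])"
    proof -
      have "n \<le> T" by (simp add: T_def)
      then have "ws @ replicate (T - length ws) [] = map st [0..<T]"
        by (intro nth_equalityI) (auto simp: st_def ws nth_append)
      then show ?thesis by (simp add: init_config_def machine_def)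
    qed
    have "map (\<lambda>j. if j < T then stack_tape (st j) else (word_content (st j), 0)) [0..<T] = rep T st"
      by (simp add: rep_def)
    then have 1: "runs (all_to_end T) (map (\<lambda>j. (word_content (st j), 0)) [0..<T])
        (T * (2 * (B - 2) + 2) + 1) (rep T st)"
      using runs_all_to_end[of T T st "B - 2"] nb lenst by simp
    let ?s1 = "st(n := v)" let ?s2 = "?s1(0 := [])"
    have "runs (compile e \<rho> n (Suc n)) (rep T st) (cost e \<sigma>) (rep T (st(n := st n @ v)))"
      unfolding v_def using fr n e by (intro runs_compile) (auto simp: \<rho>_def T_def)
    then have 2: "runs (compile e \<rho> n (Suc n)) (rep T st) (cost e \<sigma>) (rep T ?s1)"
      by (simp add: st_def)
    have "runs (clear 0) (rep T ?s1) (2 * length (?s1 0) + 1) (rep T ?s2)"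
      using nb nbv by (intro runs_clear) (auto simp: T_def)
    then have 3: "runs (clear 0) (rep T ?s1) (2 * B + 1) (rep T ?s2)"
      using n lenst[of 0] by (elim runs_to) auto
    have "runs (copy n 0 (Suc n)) (rep T ?s2) (10 * length (?s2 n) + 2) (rep T (?s2(0 := ?s2 0 @ ?s2 n)))"
      using n nbv by (intro runs_copy) (auto simp: T_def st_def)
    then have 4: "runs (copy n 0 (Suc n)) (rep T ?s2) (10 * length v + 2) (rep T (st(n := v, 0 := v)))"
      using n by simp
    have ve: "length v \<le> B ^ c" "cost e \<sigma> \<le> B ^ c"
      using poly_boundedD[OF c, of B \<sigma>] lens by (auto simp: v_def B_def)
    have B2: "2 \<le> B" by (simp add: B_def)
    then have "B ^ c \<le> B ^ Suc c" "B ^ 1 \<le> B ^ Suc c" by (intro power_increasing; simp)+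
    then have "1 + (cost e \<sigma> + (2 * B + 1 + (10 * length v + 2))) \<le> 20 * B ^ Suc c"
      using ve B2 unfolding power_one_right by linarith
    moreover have "T * (2 * (B - 2) + 2) \<le> T * (2 * B ^ Suc c)"
    proof (rule mult_le_mono2)
      show "2 * (B - 2) + 2 \<le> 2 * B ^ Suc c"
        using B2 \<open>B ^ 1 \<le> B ^ Suc c\<close> unfolding power_one_right by linarith
    qed
    ultimately have "T * (2 * (B - 2) + 2) + (1 + (cost e \<sigma> + (2 * B + 1 + (10 * length v + 2))))
        \<le> T * (2 * B ^ Suc c) + 20 * B ^ Suc c"
      by (intro add_mono)
    then have "T * (2 * (B - 2) + 2) + 1 + (cost e \<sigma> + (2 * B + 1 + (10 * length v + 2)))
        \<le> T * (2 * B ^ Suc c) + 20 * B ^ Suc c"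
      by (simp only: add.assoc)
    also have "\<dots> = ?K * B ^ Suc c" by algebra
    finally have "T * (2 * (B - 2) + 2) + 1 + (cost e \<sigma> + (2 * B + 1 + (10 * length v + 2)))
        \<le> B ^ (Suc c + ?K)"
      by (rule le_mult_powerI[OF B2])
    with runs_Seq[OF 1 runs_Seq[OF 2 runs_Seq[OF 3 4]]]
    have "runs code (map (\<lambda>j. (word_content (st j), 0)) [0..<T]) (B ^ (Suc c + ?K))
        (rep T (st(n := v, 0 := v)))"
      unfolding code_def by (rule runs_mono)
    from runs_machine[OF this, of T S']
    have fin: "(step (machine T S' code) ^^ (B ^ (Suc c + ?K))) (init_config (machine T S' code) ws) =
        (num_states (machine T S' code), rep T (st(n := v, 0 := v)))"
      unfolding init by (simp add: machine_def)
    have "tape_holds (rep T (st(n := v, 0 := v)) ! i) ((v # tl ws) ! i)" if "i < n" for i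
    proof (cases i)
      case 0
      then show ?thesis using nbv by (simp add: nth_rep T_def tape_holds_stack_tape)
    next
      case (Suc j)
      then have "(v # tl ws) ! i = st i" using that ws by (simp add: st_def nth_tl)
      then show ?thesis using that Suc nb[of i] by (simp add: nth_rep T_def tape_holds_stack_tape)
    qed
    moreover have "set w \<subseteq> {..<S'}" if "w \<in> set ws" for w
      using ws(2)[OF that] by (auto simp: S'_def)
    ultimately show ?thesis
      unfolding tm_computes_def B_def[symmetric] \<sigma>_def[symmetric] v_def[symmetric] fin
      using ws n by (auto simp: machine_def T_def)
  qed
  with wf show ?thesis
    by (intro exI[of _ "machine T S' code"] exI[of _ "Suc c + ?K"] conjI allI impI) blast+
qed

section \<open>Definable word functions are fpt-computable\<close>

text \<open>Every variable except 0 holds the parameter, which is the sharing of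
  \<open>exp_machine\<close> for two inputs.\<close>

definition input_env :: "'a::finite list \<Rightarrow> nat \<Rightarrow> nat \<Rightarrow> nat list" where
  "input_env u k = (\<lambda>x. if x = 0 then tape_word u else tape_num k)"

text \<open>Nested loops of \<open>k + 2\<close> rounds each; by the same compiler they show that
  the parameter-dependent factor of the time bound is computable.\<close>

fun power_exp :: "nat \<Rightarrow> exp" where
  "power_exp 0 = Sym 1"
| "power_exp (Suc c) = For 1 (App (Var 0) (App (Sym 1) (Sym 1))) (power_exp c)"

lemma ev_power_exp: "length (\<sigma> 0) = k \<Longrightarrow> ev (power_exp c) \<sigma> = tape_num ((k + 2) ^ c)"
proof (induction c arbitrary: \<sigma>)
  case 0
  then show ?case by (simp add: tape_num_def)
next
  case (Suc c)
  have "ev (power_exp c) (\<sigma>(1 := replicate i 1)) = tape_num ((k + 2) ^ c)" for i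
    using Suc.prems by (intro Suc.IH) simp
  moreover have "concat (map (\<lambda>i. tape_num m) [0..<l]) = tape_num (l * m)" for l m
    by (induction l) (auto simp: tape_num_def replicate_add[symmetric] add.commute)
  moreover have "ev (power_exp (Suc c)) \<sigma> =
      concat (map (\<lambda>i. ev (power_exp c) (\<sigma>(1 := replicate i 1))) [0..<k + 2])"
    using Suc.prems by (simp del: upt_Suc)
  ultimately show ?case by (simp only: power_Suc)
qed

lemma computable_power: "computable_fun (\<lambda>k. (k + 2) ^ c)"
proof -
  have "0 \<notin> syms (power_exp c)" by (induction c) auto
  from exp_machine[OF this zero_less_one, of 2] obtain M d where M: "wf_tm M"
      "\<forall>ws. length ws = 1 \<and> (\<forall>w\<in>set ws. 0 \<notin> set w \<and> set w \<subseteq> {..<2}) \<longrightarrow>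
        tm_computes M ws (ev (power_exp c) (\<lambda>x. ws ! min x (1 - 1)) # tl ws)
          ((sum_list (map length ws) + 2) ^ d)"
    by blast
  have "tm_computes M [tape_num k] [tape_num ((k + 2) ^ c)]
      ((sum_list (map length [tape_num k]) + 2) ^ d)" for k
    using M(2)[rule_format, of "[tape_num k]"] ev_power_exp[of "\<lambda>x. tape_num k" k c]
    by (simp add: tape_num_def set_replicate_conv_if)
  then show ?thesis
    unfolding computable_fun_def using M(1) by blast
qed

lemma exp_fpt_computable:
  fixes F :: "'a::finite list \<Rightarrow> nat \<Rightarrow> 'b::finite list"
  assumes e: "0 \<notin> syms e" "\<And>u k. ev e (input_env u k) = tape_word (F u k)"
  shows "fpt_computable (\<lambda>(u, k). (F u k, k))"
proof -
  obtain S where S: "\<And>x :: 'a. Suc (to_nat x) < S" "1 < S"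
  proof -
    have "finite (range (\<lambda>x :: 'a. Suc (to_nat x)))" by simp
    then obtain m where "range (\<lambda>x :: 'a. Suc (to_nat x)) \<subseteq> {..<m}"
      using finite_nat_iff_bounded by auto
    then have "Suc (to_nat x) < m" for x :: 'a by auto
    then have "Suc (to_nat x) < m + 2" for x :: 'a by (meson trans_less_add1)
    then show ?thesis by (intro that[of "m + 2"]) auto
  qed
  from exp_machine[OF e(1) pos2, of S] obtain M c where M: "wf_tm M"
      "\<forall>ws. length ws = 2 \<and> (\<forall>w\<in>set ws. 0 \<notin> set w \<and> set w \<subseteq> {..<S}) \<longrightarrow>
        tm_computes M ws (ev e (\<lambda>x. ws ! min x (2 - 1)) # tl ws)
          ((sum_list (map length ws) + 2) ^ c)"
    by blast
  have run: "tm_computes M [tape_word u, tape_num k] [tape_word (F u k), tape_num k]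
      ((length u + k + 2) ^ c)" for u k
  proof -
    have "(\<lambda>x. [tape_word u, tape_num k] ! min x (2 - 1)) = input_env u k"
      by (auto simp: input_env_def fun_eq_iff min_def nth_Cons split: nat.splits)
    moreover have "0 \<notin> set w \<and> set w \<subseteq> {..<S}" if "w \<in> set [tape_word u, tape_num k]" for w
      using that S by (auto simp: tape_word_def tape_num_def)
    ultimately show ?thesis
      using M(2)[rule_format, of "[tape_word u, tape_num k]"] e(2)[of u k]
      by (simp add: tape_word_def tape_num_def)
  qed
  have "tm_computes M [tape_word u, tape_num k] [tape_word (F u k), tape_num k]
      (poly ([:2, 1:] ^ c) (length u) * (k + 2) ^ c)" for u k
  proof -
    \<comment> \<open>The inequality \<open>a + b + 2 \<le> (a + 2) * (b + 2)\<close> separates the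
      word from the parameter, as the fpt form of the bound demands.\<close>
    have "(length u + k + 2) ^ c \<le> ((length u + 2) * (k + 2)) ^ c"
      by (intro power_mono) (auto simp: algebra_simps)
    also have "\<dots> = poly ([:2, 1:] ^ c) (length u) * (k + 2) ^ c"
    proof -
      have "poly [:2, 1:] (length u) = length u + 2" by simp
      then show ?thesis by (simp only: poly_power power_mult_distrib)
    qed
    finally have le: "(length u + k + 2) ^ c \<le> poly ([:2, 1:] ^ c) (length u) * (k + 2) ^ c" .
    \<comment> \<open>A halted machine keeps its configuration, so the number of steps may be
      increased at will.\<close>
    have "tm_computes M ws vs t'" if "tm_computes M ws vs t" "t \<le> t'" for ws vs t t'
    proof -
      obtain q ts where q: "(step M ^^ t) (init_config M ws) = (q, ts)" by fastforce
      then have "q = num_states M" using that(1) by (simp add: tm_computes_def)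
      then have "(step M ^^ (t + (t' - t))) (init_config M ws) = (q, ts)"
        using steps_append[OF q, of "t' - t"] step_halted[of "t' - t" M ts] by simp
      then show ?thesis using that q by (simp add: tm_computes_def)
    qed
    from this[OF run le] show ?thesis .
  qed
  then show ?thesis
    unfolding fpt_computable_def using M(1) computable_power[of c]
    by (intro exI[of _ M] exI[of _ "[:2, 1:] ^ c"] exI[of _ "\<lambda>k. (k + 2) ^ c"]) simp
qed

definition definable :: "('a::finite list \<Rightarrow> nat \<Rightarrow> 'b::finite list) \<Rightarrow> bool" where
  "definable F \<longleftrightarrow> (\<exists>e. 0 \<notin> syms e \<and> (\<forall>u k. ev e (input_env u k) = tape_word (F u k)))"

text \<open>Composing expressions by \<open>Bind\<close> takes the place of transitivity of
  \<open>\<le>fpt\<close>, so machines never have to be composed.\<close>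

lemma definable_comp:
  assumes "definable F" "definable G"
  shows "definable (\<lambda>u k. G (F u k) k)"
proof -
  obtain a b where "0 \<notin> syms a" "\<forall>u k. ev a (input_env u k) = tape_word (F u k)"
    "0 \<notin> syms b" "\<forall>u k. ev b (input_env u k) = tape_word (G u k)"
    using assms unfolding definable_def by blast
  moreover have "(input_env u k)(0 := tape_word v) = input_env v k" for u :: "'a list" and v :: "'b list" and k
    by (auto simp: input_env_def)
  ultimately show ?thesis
    unfolding definable_def by (intro exI[of _ "Bind 0 a b"]) simp
qed

lemma definable_fpt_le:
  assumes "definable F" "\<And>u k. (u, k) \<in> L1 \<longleftrightarrow> (F u k, k) \<in> L2"
  shows "L1 \<le>fpt L2"
proof -
  obtain e where e: "0 \<notin> syms e" "\<And>u k. ev e (input_env u k) = tape_word (F u k)"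
    using assms(1) unfolding definable_def by blast
  have "fpt_reduction (\<lambda>(u, k). (F u k, k)) L1 L2"
    unfolding fpt_reduction_def
    using exp_fpt_computable[of e F] e assms(2)
    by (intro conjI exI[of _ "\<lambda>(u, k). F u k"] exI[of _ "\<lambda>k. k"]) auto
  then show ?thesis unfolding fpt_le_def by blast
qed

section \<open>The three problems in terms of index lists\<close>

text \<open>Unlike the group product it needs no degree and works on any type, so it also multiplies
  maps on the enlarged set of points.\<close>

definition lr_product :: "('a \<Rightarrow> 'a) list \<Rightarrow> 'a \<Rightarrow> 'a" where
  "lr_product fs = foldr (\<lambda>f g. g \<circ> f) fs id"

lemma lr_product_simps [simp]:
  "lr_product [] = id"
  "lr_product (f # fs) = lr_product fs \<circ> f"
  by (simp_all add: lr_product_def)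

lemma lr_product_append [simp]: "lr_product (fs @ gs) = lr_product gs \<circ> lr_product fs"
  by (induction fs) (auto simp: comp_assoc)

lemma lr_product_ids: "(\<And>f. f \<in> set fs \<Longrightarrow> f = id) \<Longrightarrow> lr_product fs = id"
  by (induction fs) auto

lemma lr_product_permutes: "(\<And>f. f \<in> set fs \<Longrightarrow> f permutes S) \<Longrightarrow> lr_product fs permutes S"
  by (induction fs) (auto simp: permutes_id intro!: permutes_compose)

lemma carrier_sym_lr: "carrier (sym_lr n) = {p. p permutes {1..n}}"
  by (simp add: sym_lr_def sym_group_def)

lemma list_product_sym_lr: "list_product (sym_lr n) fs = lr_product fs"
  by (simp add: list_product_def lr_product_def sym_lr_def sym_group_def)

lemma pow_sym_lr: "f [^]\<^bsub>sym_lr n\<^esub> (x :: nat) = lr_product (replicate x f)"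
proof (induction x)
  case 0
  then show ?case by (simp add: nat_pow_def sym_lr_def sym_group_def)
next
  case (Suc x)
  have "lr_product (replicate (Suc x) f) = f \<circ> lr_product (replicate x f)"
    unfolding replicate_append_same[symmetric] replicate_Suc by simp
  then show ?case using Suc by (simp add: nat_pow_def sym_lr_def)
qed

lemma power_product_sym_lr:
  "power_product (sym_lr n) fs x =
    lr_product (map ((!) fs) (concat (map (\<lambda>i. replicate (x i) i) [0..<length fs])))"
proof -
  have "lr_product (map (\<lambda>i. lr_product (replicate (x i) (fs ! i))) is) =
      lr_product (map ((!) fs) (concat (map (\<lambda>i. replicate (x i) i) is)))" for "is"
    by (induction "is") (auto simp: map_replicate_const)
  then show ?thesis
    by (simp add: power_product_def list_product_sym_lr pow_sym_lr)
qed

text \<open>The parameter \<open>s\<close> lets knapsack (\<open>s = 0\<close>) and subset sum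
  (\<open>s = 1\<close>) share all reductions and their proofs.\<close>

definition gap :: "nat \<Rightarrow> nat list \<Rightarrow> bool" where
  "gap s is \<longleftrightarrow> (\<forall>t. Suc t < length is \<longrightarrow> is ! t + s \<le> is ! Suc t)"

lemma gap_0: "gap 0 is \<longleftrightarrow> sorted is"
  by (simp add: gap_def sorted_iff_nth_Suc)

lemma gap_1: "gap 1 is \<longleftrightarrow> sorted_wrt (<) is"
  by (auto simp: gap_def sorted_wrt_iff_nth_Suc_transp Suc_le_eq)

definition gap_solvable :: "nat \<Rightarrow> nat \<Rightarrow> ('a \<Rightarrow> 'a) \<Rightarrow> ('a \<Rightarrow> 'a) list \<Rightarrow> bool" where
  "gap_solvable s k a fs \<longleftrightarrow> (\<exists>is. length is = k \<and> set is \<subseteq> {..<length fs} \<and> gap s is \<and>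
    a = lr_product (map ((!) fs) is))"

definition factorizable :: "nat \<Rightarrow> ('a \<Rightarrow> 'a) \<Rightarrow> ('a \<Rightarrow> 'a) list \<Rightarrow> bool" where
  "factorizable k a fs \<longleftrightarrow> (\<exists>gs. length gs = k \<and> set gs \<subseteq> set fs \<and> a = lr_product gs)"

lemma set_power_sym_lr: "a \<in> set_power (sym_lr n) (set fs) k \<longleftrightarrow> factorizable k a fs"
  by (auto simp: set_power_def factorizable_def list_product_sym_lr)

text \<open>A sorted list is determined by its multiset; the multiplicities will be the exponents of
  the knapsack problem.\<close>

lemma sorted_concat_replicate:
  assumes "sorted is" "set is \<subseteq> {..<m}"
  shows "concat (map (\<lambda>i. replicate (count_list is i) i) [0..<m]) = is"
proof (rule properties_for_sort[of _ "is", unfolded sorted_sort_id[OF assms(1)], symmetric])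
  show "sorted (concat (map (\<lambda>i. replicate (x i) i) [0..<m]))" for x :: "nat \<Rightarrow> nat"
    by (induction m) (auto simp: sorted_append)
next
  have "count (mset (concat (map (\<lambda>i. replicate (x i) i) [0..<m]))) j = (if j < m then x j else 0)"
    for x :: "nat \<Rightarrow> nat" and j
    by (induction m) (auto simp flip: replicate_mset_def count_mset simp: less_Suc_eq)
  moreover have "count_list is j = 0" if "\<not> j < m" for j
    using assms(2) that by (auto simp: count_list_0_iff)
  ultimately show "mset (concat (map (\<lambda>i. replicate (count_list is i) i) [0..<m])) = mset is"
    by (intro multiset_eqI) (auto simp: count_mset)
qed

lemma sorted_concat_map_replicate: "sorted (concat (map (\<lambda>i. replicate (x i) i) [0..<m]))"
  for x :: "nat \<Rightarrow> nat"
  by (induction m) (auto simp: sorted_append)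

lemma length_concat_replicate: "length (concat (map (\<lambda>i. replicate (x i) i) [0..<m])) = sum x {..<m}"
  by (induction m) (auto simp: atLeast0LessThan)

lemma knapsack_iff:
  "(\<exists>x :: nat \<Rightarrow> nat. (\<Sum>i<length fs. x i) = k \<and> a = power_product (sym_lr n) fs x) \<longleftrightarrow>
    gap_solvable 0 k a fs"
proof
  assume "\<exists>x :: nat \<Rightarrow> nat. (\<Sum>i<length fs. x i) = k \<and> a = power_product (sym_lr n) fs x"
  then obtain x :: "nat \<Rightarrow> nat" where x: "(\<Sum>i<length fs. x i) = k" "a = power_product (sym_lr n) fs x"
    by blast
  then show "gap_solvable 0 k a fs"
    unfolding gap_solvable_def gap_0 power_product_sym_lr
    by (intro exI[of _ "concat (map (\<lambda>i. replicate (x i) i) [0..<length fs])"])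
      (auto simp: length_concat_replicate sorted_concat_map_replicate)
next
  assume "gap_solvable 0 k a fs"
  then obtain "is" where i: "length is = k" "set is \<subseteq> {..<length fs}" "sorted is"
      "a = lr_product (map ((!) fs) is)"
    unfolding gap_solvable_def gap_0 by blast
  note c = sorted_concat_replicate[OF i(3,2)]
  have "sum (count_list is) {..<length fs} = k"
    using length_concat_replicate[of "count_list is" "length fs"] c i(1) by simp
  moreover have "a = power_product (sym_lr n) fs (count_list is)"
    unfolding power_product_sym_lr c by (rule i(4))
  ultimately show "\<exists>x :: nat \<Rightarrow> nat. (\<Sum>i<length fs. x i) = k \<and> a = power_product (sym_lr n) fs x"
    by blast
qed

text \<open>Exponents 0 and 1 are the multiplicities of a list without repetitions, and a sorted
  list without repetitions is strictly sorted.\<close>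

lemma subset_sum_iff:
  "(\<exists>x :: nat \<Rightarrow> nat. (\<forall>i<length fs. x i \<in> {0, 1}) \<and> (\<Sum>i<length fs. x i) = k \<and>
      a = power_product (sym_lr n) fs x) \<longleftrightarrow> gap_solvable 1 k a fs"
proof
  assume "\<exists>x :: nat \<Rightarrow> nat. (\<forall>i<length fs. x i \<in> {0, 1}) \<and> (\<Sum>i<length fs. x i) = k \<and>
      a = power_product (sym_lr n) fs x"
  then obtain x :: "nat \<Rightarrow> nat" where x: "\<And>i. i < length fs \<Longrightarrow> x i \<in> {0, 1}"
      "(\<Sum>i<length fs. x i) = k" "a = power_product (sym_lr n) fs x"
    by blast
  let ?is = "\<lambda>m. concat (map (\<lambda>i. replicate (x i) i) [0..<m])"
  have "sorted_wrt (<) (?is m)" if "m \<le> length fs" for m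
    using that
  proof (induction m)
    case (Suc m)
    then have "x m = 0 \<or> x m = 1" using x(1)[of m] by auto
    then show ?case using Suc by (auto simp: sorted_wrt_append)
  qed simp
  then show "gap_solvable 1 k a fs"
    unfolding gap_solvable_def gap_1 x(3) power_product_sym_lr
    using x(2) by (intro exI[of _ "?is (length fs)"] conjI) (auto simp: length_concat_replicate)
next
  assume "gap_solvable 1 k a fs"
  then obtain "is" where i: "length is = k" "set is \<subseteq> {..<length fs}" "sorted_wrt (<) is"
      "a = lr_product (map ((!) fs) is)"
    unfolding gap_solvable_def gap_1 by blast
  have s: "sorted is" "distinct is"
    using i(3) strict_sorted_iff by auto
  note c = sorted_concat_replicate[OF s(1) i(2)]
  have "sum (count_list is) {..<length fs} = k"
    using length_concat_replicate[of "count_list is" "length fs"] c i(1) by simp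
  moreover have "a = power_product (sym_lr n) fs (count_list is)"
    unfolding power_product_sym_lr c by (rule i(4))
  moreover have "count_list is j \<in> {0, 1}" for j
    using s(2) by (simp add: distinct_count_atmost_1 flip: count_mset)
  ultimately show "\<exists>x :: nat \<Rightarrow> nat. (\<forall>i<length fs. x i \<in> {0, 1}) \<and> (\<Sum>i<length fs. x i) = k \<and>
      a = power_product (sym_lr n) fs x"
    by (intro exI[of _ "count_list is"]) simp
qed

section \<open>Repeating the list of generators\<close>

lemma nth_concat_replicate:
  "t < k \<Longrightarrow> i < length fs \<Longrightarrow> concat (replicate k fs) ! (t * length fs + i) = fs ! i"
proof (induction k arbitrary: t)
  case (Suc k)
  show ?case
  proof (cases t)
    case 0
    then show ?thesis using Suc.prems by (simp add: nth_append)
  next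
    case (Suc t')
    then show ?thesis using Suc.IH[of t'] Suc.prems by (simp add: nth_append)
  qed
qed simp

text \<open>The \<open>t\<close>-th factor is taken from the \<open>t\<close>-th copy of the list,
  so positions increase whatever the factors are. Conversely, every copy offers the old generators
  only.\<close>

lemma gap_solvable_copies:
  assumes "s \<le> 1"
  shows "gap_solvable s k a (concat (replicate k fs)) \<longleftrightarrow> factorizable k a fs"
proof
  assume "gap_solvable s k a (concat (replicate k fs))"
  then obtain "is" where i: "length is = k" "set is \<subseteq> {..<length (concat (replicate k fs))}"
      "a = lr_product (map ((!) (concat (replicate k fs))) is)"
    unfolding gap_solvable_def by blast
  have "set (map ((!) (concat (replicate k fs))) is) \<subseteq> set (concat (replicate k fs))"
    using i(2) by (auto simp del: set_concat length_concat intro!: nth_mem)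
  also have "\<dots> \<subseteq> set fs" by auto
  finally show "factorizable k a fs"
    unfolding factorizable_def using i by (metis length_map)
next
  assume "factorizable k a fs"
  then obtain gs where g: "length gs = k" "set gs \<subseteq> set fs" "a = lr_product gs"
    unfolding factorizable_def by blast
  let ?m = "length fs"
  have "\<exists>i. i < ?m \<and> fs ! i = gs ! t" if "t < k" for t
    using g that by (metis in_set_conv_nth nth_mem subsetD)
  then obtain f where f: "\<And>t. t < k \<Longrightarrow> f t < ?m \<and> fs ! f t = gs ! t" by metis
  let ?is = "map (\<lambda>t. t * ?m + f t) [0..<k]"
  have lt: "t * ?m + f t < k * ?m" if "t < k" for t
  proof -
    have "t * ?m + f t < Suc t * ?m" using f[OF that] by simp
    also have "\<dots> \<le> k * ?m" using that by (intro mult_le_mono1) simp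
    finally show ?thesis .
  qed
  have "length (concat (replicate k fs)) = k * ?m"
    by (simp add: length_concat sum_list_replicate)
  then have "set ?is \<subseteq> {..<length (concat (replicate k fs))}"
    using lt by auto
  moreover have "gap s ?is"
    unfolding gap_def
  proof (intro allI impI)
    fix t assume t: "Suc t < length ?is"
    \<comment> \<open>A position in copy \<open>t\<close> is below \<open>Suc t * ?m\<close>, where
      the next copy starts; this leaves room for a gap of 1, but no more.\<close>
    then have "f t + s \<le> ?m" using f[of t] assms by simp
    then show "?is ! t + s \<le> ?is ! Suc t" using t by simp
  qed
  moreover have "map ((!) (concat (replicate k fs))) ?is = gs"
    using g f nth_concat_replicate[of _ k _ fs] by (intro nth_equalityI) auto
  ultimately show "gap_solvable s k a (concat (replicate k fs))"
    unfolding gap_solvable_def using g(3) by (intro exI[of _ ?is]) simp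
qed

section \<open>Enforcing an order in the factorization problem\<close>

datatype point = Orig nat | Pos nat | Reg nat nat

text \<open>
  The token on \<open>Pos 0\<close> has to travel to \<open>Pos k\<close>, which forces the \<open>t\<close>-th factor to carry the label
  \<open>t\<close>. Register \<open>r\<close> is touched only by the factors with the labels \<open>r\<close> and \<open>r + 1\<close>, and it is
  restored iff the index announced by the former is the one used by the latter. The sentinel index
  \<open>m\<close>, whose transposition is trivial, is announced by the last factor.
\<close>

definition reg_action :: "nat \<Rightarrow> nat \<Rightarrow> nat \<times> nat \<times> nat \<Rightarrow> nat \<Rightarrow> nat" where
  "reg_action m r = (\<lambda>(j, i, i'). if r = j then transpose m i'
     else if Suc r = j then transpose m i else id)"

fun gadget :: "(nat \<Rightarrow> nat) list \<Rightarrow> nat \<times> nat \<times> nat \<Rightarrow> point \<Rightarrow> point" where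
  "gadget fs q (Orig t) = Orig ((fs ! fst (snd q)) t)"
| "gadget fs q (Pos c) = Pos (transpose (fst q) (Suc (fst q)) c)"
| "gadget fs q (Reg r x) = Reg r (reg_action (length fs) r q x)"

text \<open>On the track this is the product of the transpositions of \<open>j\<close> and
  \<open>j + 1\<close> for \<open>j\<close> = 0, ..., \<open>k - 1\<close>, in this order: a cycle
  on the cells up to \<open>k\<close>. The registers have to be restored.\<close>

fun target :: "(nat \<Rightarrow> nat) \<Rightarrow> nat \<Rightarrow> point \<Rightarrow> point" where
  "target a k (Orig t) = Orig (a t)"
| "target a k (Pos c) = Pos (if c = 0 then k else if c \<le> k then c - 1 else c)"
| "target a k (Reg r x) = Reg r x"

text \<open>The only place where the order of indices enters. The sentinel \<open>m\<close> may
  follow any \<open>i < m\<close>, since \<open>s\<close> will be at most 1.\<close>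

definition labels :: "nat \<Rightarrow> nat \<Rightarrow> nat \<Rightarrow> (nat \<times> nat \<times> nat) set" where
  "labels s k m = {(j, i, i'). j < k \<and> i < m \<and> i' \<le> m \<and> i + s \<le> i'}"

text \<open>The order of this list fixes both the numbering of the points and the layout of the
  tables that the reduction writes.\<close>

definition points :: "nat \<Rightarrow> nat \<Rightarrow> nat \<Rightarrow> point list" where
  "points n k m = map Orig [1..<Suc n] @ map Pos [0..<Suc k] @
     concat (map (\<lambda>r. map (Reg r) [0..<Suc m]) [0..<k])"

lemma product_gadget:
  "lr_product (map (gadget fs) qs) (Orig t) =
    Orig (lr_product (map (\<lambda>q. fs ! fst (snd q)) qs) t)"
  "lr_product (map (gadget fs) qs) (Pos c) =
    Pos (lr_product (map (\<lambda>j. transpose j (Suc j)) (map fst qs)) c)"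
  "lr_product (map (gadget fs) qs) (Reg r x) =
    Reg r (lr_product (map (reg_action (length fs) r) qs) x)"
  by (induction qs arbitrary: t c x) auto

lemma transpose_Suc_le: "transpose j (Suc j) c \<le> Suc c"
  by (simp add: transpose_def)

lemma token_le: "lr_product (map (\<lambda>j. transpose j (Suc j)) js) c \<le> c + length js"
proof (induction js arbitrary: c)
  case (Cons j js)
  have "lr_product (map (\<lambda>j. transpose j (Suc j)) (j # js)) c \<le> transpose j (Suc j) c + length js"
    using Cons[of "transpose j (Suc j) c"] by simp
  also have "\<dots> \<le> Suc c + length js" using transpose_Suc_le by (rule add_right_mono)
  finally show ?case by simp
qed simp

text \<open>By \<open>token_le\<close> a factor advances the token by at most one cell, so covering
  \<open>l\<close> cells with \<open>l\<close> factors forces each one to advance it, and only the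
  transposition of \<open>c\<close> and \<open>Suc c\<close> moves \<open>c\<close> to
  \<open>Suc c\<close>.\<close>

lemma token_forces_labels:
  "lr_product (map (\<lambda>j. transpose j (Suc j)) js) c = c + l \<Longrightarrow> length js = l \<Longrightarrow> js = [c..<c + l]"
proof (induction js arbitrary: c l)
  case (Cons j js)
  let ?c = "transpose j (Suc j) c"
  obtain l' where l: "l = Suc l'" "length js = l'" using Cons.prems(2) by auto
  have p: "lr_product (map (\<lambda>j. transpose j (Suc j)) js) ?c = Suc c + l'"
    using Cons.prems l by simp
  then have c: "?c = Suc c"
    using token_le[of js ?c] transpose_Suc_le[of j c] l(2) by linarith
  have "js = [Suc c..<Suc c + l']"
    using p l(2) unfolding c by (rule Cons.IH)
  moreover have "j = c"
    using c unfolding transpose_def by presburger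
  ultimately show ?case using l(1) by (simp add: upt_conv_Cons)
qed simp

lemma token_product:
  "lr_product (map (\<lambda>j. transpose j (Suc j)) [0..<k]) c =
    (if c = 0 then k else if c \<le> k then c - 1 else c)"
  by (induction k) (auto simp: transpose_def)

text \<open>With the labels in order only the factors \<open>r\<close> and \<open>Suc r\<close> act
  on register \<open>r\<close>, so the product collapses. The last register sees no second
  transposition.\<close>

lemma register_product:
  assumes "r < k"
  shows "lr_product (map (\<lambda>t. reg_action m r (t, f t, g t)) [0..<k]) =
    (if Suc r < k then transpose m (f (Suc r)) \<circ> transpose m (g r) else transpose m (g r))"
proof -
  define h where "h = (\<lambda>t. reg_action m r (t, f t, g t))"
  have h: "h r = transpose m (g r)" "h (Suc r) = transpose m (f (Suc r))"
    by (simp_all add: h_def reg_action_def)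
  have id: "lr_product (map h [0..<r]) = id" "lr_product (map h [Suc (Suc r)..<k]) = id"
    by (rule lr_product_ids; auto simp: h_def reg_action_def)+
  have "lr_product (map h [0..<k]) =
      (if Suc r < k then transpose m (f (Suc r)) \<circ> transpose m (g r) else transpose m (g r))"
  proof (cases "Suc r < k")
    case True
    have "[0..<k] = [0..<r] @ [r..<k]"
      using True upt_add_eq_append[of 0 r "k - r"] by simp
    also have "[r..<k] = r # Suc r # [Suc (Suc r)..<k]"
      using True by (simp add: upt_conv_Cons)
    finally show ?thesis using True by (simp add: id h)
  next
    case False
    then have "k = Suc r" using assms by simp
    then show ?thesis by (simp add: id h)
  qed
  then show ?thesis by (simp add: h_def)
qed

lemma register_product_untouched:
  "k \<le> r \<Longrightarrow> lr_product (map (\<lambda>t. reg_action m r (t, f t, g t)) [0..<k]) = id"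
  by (intro lr_product_ids) (auto simp: reg_action_def)

lemma gadget_complete:
  assumes "length is = k" "set is \<subseteq> {..<length fs}" "gap s is" "s \<le> 1" "a = lr_product (map ((!) fs) is)"
  shows "\<exists>qs. length qs = k \<and> set qs \<subseteq> labels s k (length fs) \<and>
    lr_product (map (gadget fs) qs) = target a k"
proof -
  let ?m = "length fs"
  \<comment> \<open>Each factor announces the index of its successor; the last one has none and
    announces the sentinel \<open>?m\<close>.\<close>
  let ?g = "\<lambda>t. if Suc t < k then is ! Suc t else ?m"
  let ?qs = "map (\<lambda>t. (t, is ! t, ?g t)) [0..<k]"
  have lt: "is ! t < ?m" if "t < k" for t
    using assms(1,2) that nth_mem by blast
  have "(t, is ! t, ?g t) \<in> labels s k ?m" if "t < k" for t
    using lt[OF that] lt[of "Suc t"] assms(1,3,4) that by (auto simp: labels_def gap_def)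
  then have "set ?qs \<subseteq> labels s k ?m" by auto
  moreover have "lr_product (map (gadget fs) ?qs) p = target a k p" for p
  proof (cases p)
    case (Orig t)
    have "map (\<lambda>q. fs ! fst (snd q)) ?qs = map ((!) fs) is"
      using assms(1) by (intro nth_equalityI) auto
    then show ?thesis using Orig assms(5) by (simp add: product_gadget del: map_map)
  next
    case (Pos c)
    have "map fst ?qs = [0..<k]" by (simp add: comp_def)
    then show ?thesis using Pos by (simp add: product_gadget token_product del: map_map)
  next
    case (Reg r x)
    \<comment> \<open>For \<open>Suc r < k\<close> the two transpositions are equal and cancel; for
      \<open>Suc r = k\<close> the only one exchanges \<open>?m\<close> with itself.\<close>
    have "lr_product (map (reg_action ?m r) ?qs) x = x"
    proof (cases "r < k")
      case True
      then show ?thesis by (simp add: comp_def register_product)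
    next
      case False
      then show ?thesis by (simp add: comp_def register_product_untouched)
    qed
    then show ?thesis using Reg by (simp add: product_gadget del: map_map)
  qed
  ultimately show ?thesis by (intro exI[of _ ?qs]) auto
qed

lemma gadget_sound:
  assumes qs: "length qs = k" "set qs \<subseteq> labels s k (length fs)"
    and eq: "\<And>p. p \<in> set (points n k (length fs)) \<Longrightarrow> lr_product (map (gadget fs) qs) p = target a k p"
    and perm: "a permutes {1..n}" "\<And>f. f \<in> set fs \<Longrightarrow> f permutes {1..n}"
  shows "gap_solvable s k a fs"
proof -
  let ?m = "length fs"
  define f where "f = (\<lambda>t. fst (snd (qs ! t)))"
  define g where "g = (\<lambda>t. snd (snd (qs ! t)))"
  have "lr_product (map (\<lambda>j. transpose j (Suc j)) (map fst qs)) 0 = 0 + k"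
    using eq[of "Pos 0"] qs(1) by (simp add: product_gadget points_def del: map_map upt_Suc)
  then have "map fst qs = [0..<k]"
    using token_forces_labels[of "map fst qs" 0 k] qs(1) by simp
  then have fst: "fst (qs ! t) = t" if "t < k" for t
    using that qs(1) by (metis add_0 nth_map nth_upt)
  have qs_eq: "qs = map (\<lambda>t. (t, f t, g t)) [0..<k]"
    using fst qs(1) by (intro nth_equalityI) (auto simp: f_def g_def prod_eq_iff)
  have lab: "f t < ?m" "f t + s \<le> g t" if "t < k" for t
  proof -
    have "qs ! t \<in> set qs" using that qs(1) by simp
    moreover have "qs ! t = (t, f t, g t)" using fst[OF that] by (simp add: f_def g_def prod_eq_iff)
    ultimately have "(t, f t, g t) \<in> labels s k ?m" using qs(2) by auto
    then show "f t < ?m" "f t + s \<le> g t" by (simp_all add: labels_def)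
  qed
  have "g r = f (Suc r)" if r: "Suc r < k" for r
  proof -
    have "Reg r ?m \<in> set (points n k ?m)" using r by (auto simp: points_def)
    \<comment> \<open>Cell \<open>?m\<close> alone suffices: it is sent to the announced index
      \<open>g r\<close>, and the second transposition brings it back only if it uses the same
      index.\<close>
    from eq[OF this] have "lr_product (map (reg_action ?m r) qs) ?m = ?m"
      by (simp add: product_gadget)
    then have "transpose ?m (f (Suc r)) (transpose ?m (g r) ?m) = ?m"
      using r unfolding qs_eq by (simp add: comp_def register_product)
    then show ?thesis by (auto simp: transpose_def split: if_splits)
  qed
  then have "f t + s \<le> f (Suc t)" if "Suc t < k" for t
    using lab(2)[of t] that by simp
  then have "gap s (map f [0..<k])"
    by (simp add: gap_def)
  moreover have "a = lr_product (map ((!) fs) (map f [0..<k]))"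
  proof
    fix t
    let ?fs = "map ((!) fs) (map f [0..<k])"
    show "a t = lr_product ?fs t"
    proof (cases "t \<in> {1..n}")
      case True
      then have "Orig t \<in> set (points n k ?m)" by (auto simp: points_def)
      moreover have "map (\<lambda>q. fs ! fst (snd q)) qs = ?fs"
        by (subst qs_eq) simp
      ultimately show ?thesis
        using eq[of "Orig t"] by (simp add: product_gadget del: map_map)
    next
      case False
      have "lr_product ?fs permutes {1..n}"
        using lab(1) perm(2) by (intro lr_product_permutes) auto
      then show ?thesis using False perm(1) by (simp add: permutes_not_in)
    qed
  qed
  ultimately show ?thesis
    unfolding gap_solvable_def using lab(1) by (intro exI[of _ "map f [0..<k]"]) auto
qed

section \<open>Transport from points to an interval of numbers\<close>

fun number :: "nat \<Rightarrow> nat \<Rightarrow> nat \<Rightarrow> point \<Rightarrow> nat" where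
  "number n k m (Orig t) = t"
| "number n k m (Pos c) = n + 1 + c"
| "number n k m (Reg r x) = n + k + 2 + r * Suc m + x"

definition num_points :: "nat \<Rightarrow> nat \<Rightarrow> nat \<Rightarrow> nat" where
  "num_points n k m = n + Suc k + k * Suc m"

text \<open>Injectivity of the numbering, its image and the layout of encoded tables are all read
  off from this one equation.\<close>

lemma map_number_points: "map (number n k m) (points n k m) = [1..<Suc (num_points n k m)]"
proof -
  have "map (number n k m) (concat (map (\<lambda>r. map (Reg r) [0..<Suc m]) [0..<l])) =
      [n + k + 2..<n + k + 2 + l * Suc m]" for l
  proof (induction l)
    case (Suc l)
    have "map (number n k m) (map (Reg l) [0..<Suc m]) = map (\<lambda>x. x + (n + k + 2 + l * Suc m)) [0..<Suc m]"
      by (simp add: comp_def add.commute del: upt_Suc)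
    also have "\<dots> = [n + k + 2 + l * Suc m..<Suc m + (n + k + 2 + l * Suc m)]"
      by (simp only: map_add_upt add_0)
    finally have 1: "map (number n k m) (map (Reg l) [0..<Suc m]) =
      [n + k + 2 + l * Suc m..<n + k + 2 + l * Suc m + Suc m]" by (simp only: add.commute)
    have "map (number n k m) (concat (map (\<lambda>r. map (Reg r) [0..<Suc m]) [0..<Suc l])) =
      [n + k + 2..<n + k + 2 + l * Suc m] @ [n + k + 2 + l * Suc m..<n + k + 2 + l * Suc m + Suc m]"
      unfolding Suc[symmetric] 1[symmetric] by simp
    also have "\<dots> = [n + k + 2..<n + k + 2 + l * Suc m + Suc m]"
      by (rule upt_add_eq_append[symmetric]) simp
    also have "n + k + 2 + l * Suc m + Suc m = n + k + 2 + Suc l * Suc m" by simp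
    finally show ?case .
  qed simp
  moreover have "map (number n k m) (map Orig [1..<Suc n]) = [1..<Suc n]"
    by (simp add: comp_def del: upt_Suc)
  moreover have "map (number n k m) (map Pos [0..<Suc k]) = [Suc n..<Suc n + Suc k]"
  proof -
    have "map (number n k m) (map Pos [0..<Suc k]) = map (\<lambda>x. x + Suc n) [0..<Suc k]"
      by (simp add: comp_def add.commute del: upt_Suc)
    also have "\<dots> = [Suc n..<Suc k + Suc n]" by (simp only: map_add_upt add_0)
    finally show ?thesis by (simp only: add.commute)
  qed
  ultimately have "map (number n k m) (points n k m) =
      [1..<Suc n] @ [Suc n..<Suc n + Suc k] @ [n + k + 2..<n + k + 2 + k * Suc m]"
    unfolding points_def by (simp only: map_append)
  moreover have "[1..<Suc n] @ [Suc n..<Suc n + Suc k] = [1..<n + k + 2]"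
    using upt_add_eq_append[of 1 "Suc n" "Suc k"] by simp
  moreover have "[1..<n + k + 2] @ [n + k + 2..<n + k + 2 + k * Suc m] = [1..<n + k + 2 + k * Suc m]"
    by (rule upt_add_eq_append[symmetric]) simp
  ultimately show ?thesis by (simp add: num_points_def flip: append_assoc)
qed

text \<open>Conjugation by the numbering, extended by the identity as \<open>permutes\<close>
  requires.\<close>

definition lift :: "nat \<Rightarrow> nat \<Rightarrow> nat \<Rightarrow> (point \<Rightarrow> point) \<Rightarrow> nat \<Rightarrow> nat" where
  "lift n k m h i = (if i \<in> {1..num_points n k m}
     then number n k m (h (inv_into (set (points n k m)) (number n k m) i)) else i)"

lemma number_inj: "inj_on (number n k m) (set (points n k m))"
proof -
  have "distinct (map (number n k m) (points n k m))" by (simp add: map_number_points)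
  then show ?thesis by (simp add: distinct_map)
qed

lemma number_image: "number n k m ` set (points n k m) = {1..num_points n k m}"
  unfolding set_map[symmetric] map_number_points by auto

lemma lift_number: "p \<in> set (points n k m) \<Longrightarrow> lift n k m h (number n k m p) = number n k m (h p)"
  using number_image[of n k m] number_inj[of n k m] by (auto simp: lift_def)

lemma lift_outside: "i \<notin> {1..num_points n k m} \<Longrightarrow> lift n k m h i = i"
  unfolding lift_def by (rule if_not_P)

lemma lift_eqI:
  assumes "\<And>p. p \<in> set (points n k m) \<Longrightarrow> f (number n k m p) = number n k m (h p)"
    and "\<And>i. i \<notin> {1..num_points n k m} \<Longrightarrow> f i = i"
  shows "f = lift n k m h"
proof
  fix i
  show "f i = lift n k m h i"
  proof (cases "i \<in> {1..num_points n k m}")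
    case True
    then obtain p where "p \<in> set (points n k m)" "i = number n k m p"
      unfolding number_image[symmetric] by blast
    then show ?thesis using assms(1) by (simp add: lift_number)
  qed (simp add: assms(2) lift_outside)
qed

text \<open>Invariance of the point set matters: the image under one factor must again have a number
  from which the next factor can be evaluated.\<close>

lemma lift_product:
  assumes "\<And>h. h \<in> set hs \<Longrightarrow> h ` set (points n k m) \<subseteq> set (points n k m)"
  shows "lr_product (map (lift n k m) hs) = lift n k m (lr_product hs)"
  using assms
proof (induction hs)
  case Nil
  then show ?case by (auto intro: lift_eqI)
next
  case (Cons h hs)
  have "lr_product (map (lift n k m) (h # hs)) = lift n k m (lr_product hs) \<circ> lift n k m h"
    using Cons by simp
  also have "\<dots> = lift n k m (lr_product hs \<circ> h)"
    using Cons.prems[of h] by (intro lift_eqI) (auto simp: lift_number lift_outside image_subset_iff)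
  finally show ?case by (simp add: comp_def)
qed

lemma lift_eq_iff:
  assumes "g ` set (points n k m) \<subseteq> set (points n k m)" "h ` set (points n k m) \<subseteq> set (points n k m)"
  shows "lift n k m g = lift n k m h \<longleftrightarrow> (\<forall>p\<in>set (points n k m). g p = h p)"
proof
  assume eq: "lift n k m g = lift n k m h"
  show "\<forall>p\<in>set (points n k m). g p = h p"
  proof
    fix p assume p: "p \<in> set (points n k m)"
    then have "number n k m (g p) = number n k m (h p)"
      using eq by (metis lift_number)
    then show "g p = h p"
      using inj_onD[OF number_inj] assms p by (meson image_subset_iff)
  qed
next
  assume "\<forall>p\<in>set (points n k m). g p = h p"
  then show "lift n k m g = lift n k m h"
    by (intro lift_eqI) (auto simp: lift_number lift_outside)
qed

lemma lift_permutes: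
  assumes "inj h" "h ` set (points n k m) \<subseteq> set (points n k m)"
  shows "lift n k m h permutes {1..num_points n k m}"
proof (rule bij_imp_permutes)
  let ?P = "set (points n k m)"
  have num: "number n k m (h p) \<in> {1..num_points n k m}" if "p \<in> ?P" for p
    using assms(2) that number_image[of n k m] by blast
  have "lift n k m h ` {1..num_points n k m} \<subseteq> {1..num_points n k m}"
  proof
    fix j assume "j \<in> lift n k m h ` {1..num_points n k m}"
    then obtain p where "p \<in> ?P" "j = lift n k m h (number n k m p)"
      unfolding number_image[symmetric] by blast
    then show "j \<in> {1..num_points n k m}" using num by (simp add: lift_number)
  qed
  moreover have "inj_on (lift n k m h) {1..num_points n k m}"
    unfolding number_image[symmetric]
  proof (rule inj_on_imageI, rule inj_onI)
    fix p q assume pq: "p \<in> ?P" "q \<in> ?P"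
      and "(lift n k m h \<circ> number n k m) p = (lift n k m h \<circ> number n k m) q"
    then have "number n k m (h p) = number n k m (h q)" by (simp add: lift_number)
    then have "h p = h q" using inj_onD[OF number_inj] assms(2) pq by (meson image_subset_iff)
    then show "p = q" using assms(1) by (simp add: inj_eq)
  qed
  ultimately show "bij_betw (lift n k m h) {1..num_points n k m} {1..num_points n k m}"
    by (simp add: bij_betw_def endo_inj_surj)
qed (rule lift_outside)

lemma inj_pointwise:
  assumes "\<And>t. h (Orig t) = Orig (f t)" "\<And>c. h (Pos c) = Pos (g c)" "\<And>r x. h (Reg r x) = Reg r (e r x)"
    and "inj f" "inj g" "\<And>r. inj (e r)"
  shows "inj h"
proof (rule injI)
  fix p q assume "h p = h q"
  then show "p = q"
    using assms by (cases p; cases q) (auto simp: inj_eq)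
qed

lemma in_points [simp]:
  "Orig t \<in> set (points n k m) \<longleftrightarrow> t \<in> {1..n}"
  "Pos c \<in> set (points n k m) \<longleftrightarrow> c \<le> k"
  "Reg r x \<in> set (points n k m) \<longleftrightarrow> r < k \<and> x \<le> m"
  by (auto simp: points_def image_iff less_Suc_eq_le simp del: upt_Suc)

lemma inj_gadget:
  assumes "fs ! fst (snd q) permutes S"
  shows "inj (gadget fs q)"
proof (rule inj_pointwise[where f = "fs ! fst (snd q)" and g = "transpose (fst q) (Suc (fst q))"
      and e = "\<lambda>r. reg_action (length fs) r q"])
  show "inj (fs ! fst (snd q))"
    using assms by (rule permutes_inj)
  show "inj (reg_action (length fs) r q)" for r
    by (simp add: reg_action_def split: prod.split)
qed simp_all

lemma inj_target:
  assumes "a permutes S"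
  shows "inj (target a k)"
proof (rule inj_pointwise[where f = a and g = "\<lambda>c. if c = 0 then k else if c \<le> k then c - 1 else c"
      and e = "\<lambda>r x. x"])
  show "inj a" using assms by (rule permutes_inj)
  show "inj (\<lambda>c. if c = 0 then k else if c \<le> k then c - 1 else c)"
    by (auto simp: inj_def split: if_splits)
qed (simp_all add: inj_def)

lemma transpose_le: "x \<le> k \<Longrightarrow> i \<le> k \<Longrightarrow> j \<le> k \<Longrightarrow> transpose i j x \<le> (k :: nat)"
  by (simp add: transpose_def)

lemma gadget_points:
  assumes "q \<in> labels s k (length fs)" "\<And>f. f \<in> set fs \<Longrightarrow> f permutes {1..n}"
  shows "gadget fs q ` set (points n k (length fs)) \<subseteq> set (points n k (length fs))"
proof -
  obtain j i i' where q: "q = (j, i, i')" "j < k" "i < length fs" "i' \<le> length fs"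
    using assms(1) by (auto simp: labels_def)
  have "fs ! i permutes {1..n}" using assms(2) q(3) by simp
  then have a: "(fs ! i) t \<in> {1..n}" if "t \<in> {1..n}" for t
    using that permutes_in_image by metis
  have "gadget fs q p \<in> set (points n k (length fs))" if "p \<in> set (points n k (length fs))" for p
    by (cases p) (use that a q in \<open>auto simp: reg_action_def intro!: transpose_le\<close>)
  then show ?thesis by blast
qed

lemma target_points:
  assumes "a permutes {1..n}"
  shows "target a k ` set (points n k m) \<subseteq> set (points n k m)"
proof -
  have "a t \<in> {1..n}" if "t \<in> {1..n}" for t
    using that assms permutes_in_image by metis
  then have "target a k p \<in> set (points n k m)" if "p \<in> set (points n k m)" for p
    by (cases p) (use that in auto)
  then show ?thesis by blast
qed

lemma product_points:
  "(\<And>h. h \<in> set hs \<Longrightarrow> h ` P \<subseteq> P) \<Longrightarrow> lr_product hs ` P \<subseteq> P"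
  by (induction hs) (fastforce simp: image_comp[symmetric])+

text \<open>On maps that preserve the points, lifting is multiplicative and determines the map
  there. Hence the analysis on \<open>point\<close> carries over to genuine permutations.\<close>

theorem gadget_correct:
  assumes perm: "a permutes {1..n}" "\<And>f. f \<in> set fs \<Longrightarrow> f permutes {1..n}" and s: "s \<le> 1"
    and ls: "set ls = labels s k (length fs)"
  defines "up \<equiv> lift n k (length fs)"
  shows "factorizable k (up (target a k)) (map (\<lambda>q. up (gadget fs q)) ls) \<longleftrightarrow> gap_solvable s k a fs"
proof -
  let ?P = "set (points n k (length fs))"
  have prod: "up (target a k) = lr_product (map (\<lambda>q. up (gadget fs q)) qs) \<longleftrightarrow>
      (\<forall>p\<in>?P. target a k p = lr_product (map (gadget fs) qs) p)"
    if "set qs \<subseteq> labels s k (length fs)" for qs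
  proof -
    have h: "h ` ?P \<subseteq> ?P" if "h \<in> set (map (gadget fs) qs)" for h
      using gadget_points[of _ s k fs n] perm \<open>set qs \<subseteq> _\<close> that by fastforce
    have "lr_product (map up (map (gadget fs) qs)) = up (lr_product (map (gadget fs) qs))"
      unfolding up_def by (rule lift_product) (rule h)
    moreover have "lr_product (map (gadget fs) qs) ` ?P \<subseteq> ?P"
      by (rule product_points) (rule h)
    ultimately show ?thesis
      using lift_eq_iff[OF target_points[OF perm(1)]] by (simp add: comp_def up_def)
  qed
  show ?thesis
  proof
    assume "factorizable k (up (target a k)) (map (\<lambda>q. up (gadget fs q)) ls)"
    then obtain gs where gs: "length gs = k" "set gs \<subseteq> (\<lambda>q. up (gadget fs q)) ` labels s k (length fs)"
        "up (target a k) = lr_product gs"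
      unfolding factorizable_def using ls by auto
    \<comment> \<open>Different labels may yield the same permutation, so a label is merely chosen
      for each factor.\<close>
    then have "gs \<in> lists ((\<lambda>q. up (gadget fs q)) ` labels s k (length fs))"
      by (simp add: lists_eq_set)
    then obtain qs where "qs \<in> lists (labels s k (length fs))" and gs_eq: "gs = map (\<lambda>q. up (gadget fs q)) qs"
      unfolding lists_image by blast
    then have qs: "set qs \<subseteq> labels s k (length fs)" by (simp add: lists_eq_set)
    show "gap_solvable s k a fs"
    proof (rule gadget_sound[OF _ qs])
      show "length qs = k" using gs(1) gs_eq by simp
      show "lr_product (map (gadget fs) qs) p = target a k p" if "p \<in> ?P" for p
        using prod[OF qs] gs(3) gs_eq that by simp
    qed (use perm in auto)
  next
    assume "gap_solvable s k a fs"
    then obtain qs where qs: "length qs = k" "set qs \<subseteq> labels s k (length fs)"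
        "lr_product (map (gadget fs) qs) = target a k"
      unfolding gap_solvable_def using gadget_complete[of _ k fs s a] s by blast
    then have "up (target a k) = lr_product (map (\<lambda>q. up (gadget fs q)) qs)"
      using prod by simp
    then show "factorizable k (up (target a k)) (map (\<lambda>q. up (gadget fs q)) ls)"
      unfolding factorizable_def using qs ls by (intro exI[of _ "map (\<lambda>q. up (gadget fs q)) qs"]) auto
  qed
qed

section \<open>Decoding instances\<close>

text \<open>Every number stored in an instance is the number of positions with a property of the
  letter and of the prefix before it. This is a form that one \<open>For\<close> over the word can
  evaluate.\<close>

definition count_positions :: "('a list \<Rightarrow> 'a \<Rightarrow> bool) \<Rightarrow> 'a list \<Rightarrow> nat" where
  "count_positions Q u = length (filter (\<lambda>p. Q (take p u) (u ! p)) [0..<length u])"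

lemma count_positions_Nil [simp]: "count_positions Q [] = 0"
  by (simp add: count_positions_def)

lemma count_positions_snoc:
  "count_positions Q (u @ [x]) = count_positions Q u + (if Q u x then 1 else 0)"
proof -
  have "filter (\<lambda>p. Q (take p (u @ [x])) ((u @ [x]) ! p)) [0..<length u] =
      filter (\<lambda>p. Q (take p u) (u ! p)) [0..<length u]"
    by (intro filter_cong) (auto simp: nth_append)
  then show ?thesis by (simp add: count_positions_def)
qed

lemma count_positions_replicate:
  assumes "\<And>i. i < a \<Longrightarrow> Q (u @ replicate i x) x = b"
  shows "count_positions Q (u @ replicate a x) = count_positions Q u + (if b then a else 0)"
  using assms
proof (induction a)
  case (Suc a)
  have "count_positions Q (u @ replicate (Suc a) x) = count_positions Q ((u @ replicate a x) @ [x])"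
    by (simp flip: replicate_append_same)
  also have "\<dots> = count_positions Q u + (if b then a else 0) + (if b then 1 else 0)"
    using Suc by (simp only: count_positions_snoc)
  finally show ?case by simp
qed simp

definition size_of :: "letter list \<Rightarrow> nat" where
  "size_of = count_positions (\<lambda>v x. x = Stroke \<and> Hash \<notin> set v)"

definition blocks_of :: "letter list \<Rightarrow> nat" where
  "blocks_of = count_positions (\<lambda>v x. x = Hash \<and> Hash \<in> set v)"

text \<open>Numbers are addressed globally by the count of commas before them; in blocks of size
  \<open>n\<close>, entry \<open>j\<close> of block \<open>b\<close> has the address
  \<open>b * n + j\<close>.\<close>

definition value_of :: "letter list \<Rightarrow> nat \<Rightarrow> nat" where
  "value_of u c = count_positions (\<lambda>v x. x = Stroke \<and> Hash \<in> set v \<and> count_list v Comma = c) u"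

definition unary :: "nat \<Rightarrow> letter list" where
  "unary v = replicate v Stroke @ [Comma]"

definition block :: "nat \<Rightarrow> (nat \<Rightarrow> nat) \<Rightarrow> letter list" where
  "block n v = concat (map (\<lambda>j. unary (v j)) [0..<n]) @ [Hash]"

definition code :: "nat \<Rightarrow> nat \<Rightarrow> (nat \<Rightarrow> nat) \<Rightarrow> letter list" where
  "code n M v = replicate n Stroke @ [Hash] @ concat (map (\<lambda>b. block n (\<lambda>j. v (b * n + j))) [0..<M])"

text \<open>Invariant for a word read so far, with \<open>M\<close> closed blocks and
  \<open>cnt\<close> closed numbers; addresses not yet reached yield 0.\<close>

definition decodes :: "nat \<Rightarrow> nat \<Rightarrow> (nat \<Rightarrow> nat) \<Rightarrow> letter list \<Rightarrow> nat \<Rightarrow> bool" where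
  "decodes n M v w cnt \<longleftrightarrow> Hash \<in> set w \<and> count_list w Comma = cnt \<and> size_of w = n \<and>
    blocks_of w = M \<and> (\<forall>c. value_of w c = (if c < cnt then v c else 0))"

lemma decodes_header: "decodes n 0 v (replicate n Stroke @ [Hash]) 0"
proof -
  have "size_of (replicate n Stroke) = n"
    using count_positions_replicate[of n "\<lambda>v x. x = Stroke \<and> Hash \<notin> set v" "[]" Stroke True]
    by (simp add: size_of_def)
  moreover have "blocks_of (replicate n Stroke) = 0"
    using count_positions_replicate[of n "\<lambda>v x. x = Hash \<and> Hash \<in> set v" "[]" Stroke False]
    by (simp add: blocks_of_def)
  moreover have "value_of (replicate n Stroke) c = 0" for c
    using count_positions_replicate[of n "\<lambda>v x. x = Stroke \<and> Hash \<in> set v \<and> count_list v Comma = c"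
        "[]" Stroke False]
    by (simp add: value_of_def)
  moreover have "count_list (replicate n Stroke) Comma = 0"
    by (induction n) auto
  ultimately show ?thesis
    by (simp add: decodes_def size_of_def blocks_of_def value_of_def count_positions_snoc
        del: append.simps)
qed

lemma decodes_unary:
  assumes "decodes n M v w cnt"
  shows "decodes n M v (w @ unary (v cnt)) (Suc cnt)"
proof -
  let ?w = "w @ replicate (v cnt) Stroke"
  have hash: "Hash \<in> set w" and cnt: "count_list w Comma = cnt"
    using assms by (simp_all add: decodes_def)
  have c0: "count_list (replicate i Stroke) Comma = 0" for i
    by (induction i) auto
  have "size_of ?w = size_of w"
    using count_positions_replicate[of "v cnt" "\<lambda>v x. x = Stroke \<and> Hash \<notin> set v" w Stroke False] hash
    by (simp add: size_of_def)
  moreover have "blocks_of ?w = blocks_of w"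
    using count_positions_replicate[of "v cnt" "\<lambda>v x. x = Hash \<and> Hash \<in> set v" w Stroke False]
    by (simp add: blocks_of_def)
  moreover have "value_of ?w c = value_of w c + (if c = cnt then v cnt else 0)" for c
    using count_positions_replicate[of "v cnt"
        "\<lambda>v x. x = Stroke \<and> Hash \<in> set v \<and> count_list v Comma = c" w Stroke "c = cnt"] hash cnt c0
    by (auto simp: value_of_def)
  ultimately have "decodes n M v (?w @ [Comma]) (Suc cnt)"
    using assms c0
    by (auto simp: decodes_def size_of_def blocks_of_def value_of_def count_positions_snoc
        simp del: append_assoc append.simps)
  then show ?thesis by (simp add: unary_def)
qed

lemma decodes_Hash:
  "decodes n M v w cnt \<Longrightarrow> decodes n (Suc M) v (w @ [Hash]) cnt"
  by (simp add: decodes_def size_of_def blocks_of_def value_of_def count_positions_snoc)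

lemma decodes_code: "decodes n M v (code n M v) (M * n)"
proof (induction M)
  case 0
  then show ?case using decodes_header by (simp add: code_def)
next
  case (Suc M)
  have "decodes n M v (code n M v @ concat (map (\<lambda>j. unary (v (M * n + j))) [0..<l])) (M * n + l)" for l
  proof (induction l)
    case 0
    then show ?case using Suc by simp
  next
    case (Suc l)
    from decodes_unary[OF this] show ?case by simp
  qed
  from decodes_Hash[OF this[of n]] show ?case
    by (simp add: code_def block_def add.commute)
qed

lemma decode_code:
  "size_of (code n M v) = n" "blocks_of (code n M v) = M"
  "c < M * n \<Longrightarrow> value_of (code n M v) c = v c"
  using decodes_code[of n M v] by (simp_all add: decodes_def)

lemma enc_perm_block: "enc_perm n f = block n (\<lambda>j. f (Suc j))"
proof -
  have "[1..<Suc n] = map Suc [0..<n]" by (simp add: map_Suc_upt)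
  then show ?thesis by (simp add: enc_perm_def block_def unary_def comp_def del: upt_Suc)
qed

lemma block_cong: "(\<And>j. j < n \<Longrightarrow> v j = w j) \<Longrightarrow> block n v = block n w"
  unfolding block_def by (intro arg_cong[of _ _ "\<lambda>x. concat x @ _"] map_cong) auto

lemma code_cong: "(\<And>c. c < M * n \<Longrightarrow> v c = w c) \<Longrightarrow> code n M v = code n M w"
proof -
  assume eq: "\<And>c. c < M * n \<Longrightarrow> v c = w c"
  have "b * n + j < M * n" if "b < M" "j < n" for b j
  proof -
    have "b * n + j < Suc b * n" using that by simp
    also have "\<dots> \<le> M * n" using that by (intro mult_le_mono1) simp
    finally show ?thesis .
  qed
  then have "map (\<lambda>b. block n (\<lambda>j. v (b * n + j))) [0..<M] = map (\<lambda>b. block n (\<lambda>j. w (b * n + j))) [0..<M]"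
    using eq by (intro map_cong block_cong) auto
  then show ?thesis unfolding code_def by (simp only:)
qed

definition table :: "nat \<Rightarrow> (nat \<Rightarrow> nat) list \<Rightarrow> nat \<Rightarrow> nat" where
  "table n fs c = (fs ! (c div n)) (Suc (c mod n))"

lemma enc_instance_code:
  assumes "1 \<le> n"
  shows "enc_instance n a as = code n (Suc (length as)) (table n (a # as))"
proof -
  have "concat (map (enc_perm n) fs) = concat (map (\<lambda>b. block n (\<lambda>j. table n fs (b * n + j))) [0..<length fs])" for fs
  proof -
    have "map (enc_perm n) fs = map (\<lambda>b. block n (\<lambda>j. table n fs (b * n + j))) [0..<length fs]"
      by (rule nth_equalityI) (use assms in \<open>auto simp: enc_perm_block table_def intro!: block_cong\<close>)
    then show ?thesis by (rule arg_cong)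
  qed
  from this[of "a # as"] show ?thesis
    by (simp add: enc_instance_def code_def)
qed

definition instance_of :: "nat \<Rightarrow> (nat \<Rightarrow> nat) \<Rightarrow> (nat \<Rightarrow> nat) list \<Rightarrow> bool" where
  "instance_of n a as \<longleftrightarrow> 1 \<le> n \<and> a \<in> carrier (sym_lr n) \<and> set as \<subseteq> carrier (sym_lr n)"

lemma decode_instance:
  assumes "1 \<le> n"
  shows "size_of (enc_instance n a as) = n" "blocks_of (enc_instance n a as) = Suc (length as)"
    and "b \<le> length as \<Longrightarrow> j < n \<Longrightarrow>
      value_of (enc_instance n a as) (b * n + j) = ((a # as) ! b) (Suc j)"
proof -
  show "size_of (enc_instance n a as) = n" "blocks_of (enc_instance n a as) = Suc (length as)"
    by (simp_all add: enc_instance_code[OF assms] decode_code)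
  assume "b \<le> length as" "j < n"
  have "b * n + j < Suc b * n" using \<open>j < n\<close> by simp
  also have "\<dots> \<le> Suc (length as) * n" using \<open>b \<le> length as\<close> by (intro mult_le_mono1) simp
  finally show "value_of (enc_instance n a as) (b * n + j) = ((a # as) ! b) (Suc j)"
    using \<open>j < n\<close> by (simp add: enc_instance_code[OF assms] decode_code table_def)
qed

text \<open>The problems are sets of words, so membership of an encoded instance says something
  about this very instance only because the encoding is injective.\<close>

lemma enc_instance_inj:
  assumes i: "instance_of n a as" "instance_of n' a' as'"
    and eq: "enc_instance n a as = enc_instance n' a' as'"
  shows "n = n' \<and> a = a' \<and> as = as'"
proof -
  have n: "1 \<le> n" "1 \<le> n'" using i by (simp_all add: instance_of_def)
  have nn: "n = n'" using decode_instance(1) n eq by metis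
  have len: "length as = length as'" using decode_instance(2) n eq by (metis Suc_inject)
  have "(a # as) ! b = (a' # as') ! b" if b: "b \<le> length as" for b
  proof
    fix t
    have "(a # as) ! b \<in> set (a # as)" "(a' # as') ! b \<in> set (a' # as')"
      using b len by (auto intro!: nth_mem simp del: set_simps)
    then have p: "(a # as) ! b permutes {1..n}" "(a' # as') ! b permutes {1..n}"
      using i nn by (auto simp: instance_of_def carrier_sym_lr)
    show "((a # as) ! b) t = ((a' # as') ! b) t"
    proof (cases "t \<in> {1..n}")
      case True
      then obtain j where "t = Suc j" "j < n" by (cases t) auto
      then show ?thesis
        using decode_instance(3)[OF n(1), of b as j a] decode_instance(3)[OF n(2), of b as' j a']
          b len nn eq by simp
    next
      case False
      then show ?thesis by (simp only: permutes_not_in[OF p(1)] permutes_not_in[OF p(2)] not_False_eq_True)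
    qed
  qed
  then have "a # as = a' # as'"
    using len by (intro nth_equalityI) (simp_all add: less_Suc_eq_le del: nth_Cons)
  then show ?thesis using nn by simp
qed

text \<open>Parsing is replaced by re-encoding: the decoding functions are total, and a word is well
  formed iff it is rebuilt from its decoded data. The last clause says that each block lists
  distinct values from 1 to \<open>n\<close>.\<close>

definition valid :: "letter list \<Rightarrow> bool" where
  "valid u \<longleftrightarrow> (let n = size_of u; M = blocks_of u; v = value_of u in
    0 < n \<and> 0 < M \<and> u = code n M v \<and>
    (\<forall>b<M. \<forall>j<n. 0 < v (b * n + j) \<and> v (b * n + j) \<le> n \<and>
      (\<forall>i<j. v (b * n + i) \<noteq> v (b * n + j))))"

lemma valid_enc_instance:
  assumes "instance_of n a as"
  shows "valid (enc_instance n a as)"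
proof -
  let ?u = "enc_instance n a as" and ?M = "Suc (length as)"
  have n: "1 \<le> n" using assms by (simp add: instance_of_def)
  note dec = decode_instance[OF n]
  have "?u = code n ?M (table n (a # as))" by (rule enc_instance_code[OF n])
  also have "\<dots> = code n ?M (value_of ?u)"
    by (rule code_cong) (simp add: enc_instance_code[OF n] decode_code)
  finally have "?u = code n ?M (value_of ?u)" .
  moreover have "0 < value_of ?u (b * n + j) \<and> value_of ?u (b * n + j) \<le> n \<and>
      (\<forall>i<j. value_of ?u (b * n + i) \<noteq> value_of ?u (b * n + j))" if "b < ?M" "j < n" for b j
  proof -
    have "(a # as) ! b \<in> set (a # as)" using that by (intro nth_mem) simp
    then have p: "(a # as) ! b permutes {1..n}"
      using assms by (auto simp: instance_of_def carrier_sym_lr)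
    then have "((a # as) ! b) (Suc j) \<in> {1..n}"
      using permutes_in_image[OF p, of "Suc j"] that by simp
    moreover have "((a # as) ! b) (Suc i) \<noteq> ((a # as) ! b) (Suc j)" if "i < j" for i
      using permutes_inj[OF p] that by (simp add: inj_eq)
    ultimately show ?thesis using that by (simp add: dec)
  qed
  ultimately show ?thesis
    unfolding valid_def Let_def dec(1,2) using n by simp
qed

lemma validE:
  assumes "valid u"
  obtains n a as where "instance_of n a as" "u = enc_instance n a as"
proof -
  define n M v where "n = size_of u" and "M = blocks_of u" and "v = value_of u"
  have n: "0 < n" and M: "0 < M" and u: "u = code n M v"
    and v: "\<And>b j. b < M \<Longrightarrow> j < n \<Longrightarrow> 0 < v (b * n + j) \<and> v (b * n + j) \<le> n \<and>
      (\<forall>i<j. v (b * n + i) \<noteq> v (b * n + j))"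
    using assms unfolding valid_def Let_def n_def M_def v_def by auto
  \<comment> \<open>Columns are counted from 0 but points from 1, hence \<open>t - 1\<close>.
    Outside the interval the identity is forced by \<open>permutes\<close>. A self-injection of a
    finite set is a bijection.\<close>
  define f where "f = (\<lambda>b t. if t \<in> {1..n} then v (b * n + (t - 1)) else t)"
  have perm: "f b permutes {1..n}" if b: "b < M" for b
  proof (rule bij_imp_permutes)
    have "f b ` {1..n} \<subseteq> {1..n}"
    proof
      fix y assume "y \<in> f b ` {1..n}"
      then obtain t where "t \<in> {1..n}" "y = f b t" by blast
      then show "y \<in> {1..n}" using v[OF b, of "t - 1"] by (auto simp: f_def Suc_le_eq)
    qed
    moreover have "inj_on (f b) {1..n}"
    proof (rule linorder_inj_onI')
      fix i j assume "i \<in> {1..n}" "j \<in> {1..n}" "i < j"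
      then obtain i' j' where "i = Suc i'" "j = Suc j'" "i' < j'" "j' < n"
        by (cases i; cases j) auto
      then show "f b i \<noteq> f b j" using v[OF b, of j'] by (simp add: f_def)
    qed
    ultimately show "bij_betw (f b) {1..n} {1..n}"
      by (simp add: bij_betw_def endo_inj_surj)
    show "f b t = t" if "t \<notin> {1..n}" for t
      unfolding f_def using that by (rule if_not_P)
  qed
  define as where "as = map f [1..<M]"
  have "instance_of n (f 0) as"
    using n M perm by (auto simp: instance_of_def carrier_sym_lr as_def)
  moreover have "u = enc_instance n (f 0) as"
  proof -
    have "f 0 # as = map f [0..<M]"
      using M by (simp add: as_def upt_conv_Cons)
    then have "table n (f 0 # as) c = v c" if "c < M * n" for c
      using that n by (simp add: table_def f_def less_mult_imp_div_less Suc_le_eq)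
    moreover have "Suc (length as) = M" using M by (simp add: as_def)
    ultimately show ?thesis
      using n unfolding u by (subst enc_instance_code) (auto intro!: code_cong)
  qed
  ultimately show ?thesis by (rule that)
qed

section \<open>The reductions\<close>

text \<open>Malformed words are mapped to the empty word, so by this fact their images are
  no-instances.\<close>

lemma empty_not_valid: "\<not> valid []"
  by (simp add: valid_def size_of_def)

lemma enc_instance_mem_iff:
  assumes "instance_of n a as"
    and "L = {(enc_instance n a as, k) | n a as k. instance_of n a as \<and> P n a as k}"
  shows "(enc_instance n a as, k) \<in> L \<longleftrightarrow> P n a as k"
  using assms enc_instance_inj[OF assms(1)] by blast

lemma pF_sym_iff:
  assumes "instance_of n a as"
  shows "(enc_instance n a as, k) \<in> pF_sym \<longleftrightarrow> factorizable k a as"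
proof -
  have "pF_sym = {(enc_instance n a as, k) | n a as k. instance_of n a as \<and> factorizable k a as}"
    unfolding pF_sym_def instance_of_def set_power_sym_lr by (simp only: conj_assoc)
  then show ?thesis by (rule enc_instance_mem_iff[OF assms])
qed

lemma pKS_sym_iff:
  assumes "instance_of n a as"
  shows "(enc_instance n a as, k) \<in> pKS_sym \<longleftrightarrow> gap_solvable 0 k a as"
proof -
  have "pKS_sym = {(enc_instance n a as, k) | n a as k. instance_of n a as \<and> gap_solvable 0 k a as}"
    unfolding pKS_sym_def instance_of_def knapsack_iff by (simp only: conj_assoc)
  then show ?thesis by (rule enc_instance_mem_iff[OF assms])
qed

lemma pSSS_sym_iff:
  assumes "instance_of n a as"
  shows "(enc_instance n a as, k) \<in> pSSS_sym \<longleftrightarrow> gap_solvable 1 k a as"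
proof -
  have "pSSS_sym = {(enc_instance n a as, k) | n a as k. instance_of n a as \<and> gap_solvable 1 k a as}"
    unfolding pSSS_sym_def instance_of_def subset_sum_iff by (simp only: conj_assoc)
  then show ?thesis by (rule enc_instance_mem_iff[OF assms])
qed

lemma problems_valid:
  "(u, k) \<in> pF_sym \<Longrightarrow> valid u" "(u, k) \<in> pKS_sym \<Longrightarrow> valid u" "(u, k) \<in> pSSS_sym \<Longrightarrow> valid u"
  by (auto simp: pF_sym_def pKS_sym_def pSSS_sym_def instance_of_def intro!: valid_enc_instance)

text \<open>Phrased with the decoding functions, so that an expression can produce it piece by
  piece; its meaning on instances is the next lemma but one.\<close>

definition copies :: "letter list \<Rightarrow> nat \<Rightarrow> letter list" where
  "copies u k = (if valid u then
      replicate (size_of u) Stroke @ [Hash] @ block (size_of u) (value_of u) @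
      concat (map (\<lambda>_. concat (map (\<lambda>b. block (size_of u) (\<lambda>j. value_of u (Suc b * size_of u + j)))
        [0..<blocks_of u - 1])) [0..<k])
    else [])"

lemma enc_perm_value:
  assumes "instance_of n a as"
  shows "block n (value_of (enc_instance n a as)) = enc_perm n a"
    and "b < length as \<Longrightarrow>
      block n (\<lambda>j. value_of (enc_instance n a as) (Suc b * n + j)) = enc_perm n (as ! b)"
proof -
  have n: "1 \<le> n" using assms by (simp add: instance_of_def)
  show "block n (value_of (enc_instance n a as)) = enc_perm n a"
    unfolding enc_perm_block using decode_instance(3)[OF n, of 0 as _ a] by (intro block_cong) simp
  show "block n (\<lambda>j. value_of (enc_instance n a as) (Suc b * n + j)) = enc_perm n (as ! b)"
    if "b < length as"
    unfolding enc_perm_block using decode_instance(3)[OF n, of "Suc b" as _ a] that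
    by (intro block_cong) simp
qed

lemma copies_enc_instance:
  assumes "instance_of n a as"
  shows "copies (enc_instance n a as) k = enc_instance n a (concat (replicate k as))"
proof -
  let ?u = "enc_instance n a as"
  have n: "1 \<le> n" using assms by (simp add: instance_of_def)
  have "map (\<lambda>b. block n (\<lambda>j. value_of ?u (Suc b * n + j))) [0..<length as] = map (enc_perm n) as"
    by (rule nth_equalityI) (simp_all add: enc_perm_value[OF assms] del: mult_Suc)
  moreover have "map (enc_perm n) (concat (replicate k as)) =
      concat (map (\<lambda>_. map (enc_perm n) as) [0..<k])"
    by (induction k) (simp_all add: map_replicate_const replicate_append_same flip: concat_append)
  then have "concat (map (enc_perm n) (concat (replicate k as))) =
      concat (map (\<lambda>_. concat (map (enc_perm n) as)) [0..<k])"
    by (induction k) (simp_all add: map_replicate_const concat_replicate_trivial)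
  ultimately show ?thesis
    unfolding copies_def decode_instance(1,2)[OF n] enc_instance_def[of n a "concat _"]
    using valid_enc_instance[OF assms] enc_perm_value(1)[OF assms] by (simp del: mult_Suc)
qed

text \<open>The table of a lifted permutation, split by kind of point; the offsets are those of
  \<open>number\<close>.\<close>

definition gadget_word ::
  "nat \<Rightarrow> nat \<Rightarrow> nat \<Rightarrow> (nat \<Rightarrow> nat) \<Rightarrow> (nat \<Rightarrow> nat) \<Rightarrow> (nat \<Rightarrow> nat \<Rightarrow> nat) \<Rightarrow> letter list" where
  "gadget_word n k m f g h =
    concat (map (\<lambda>t. unary (f t)) [0..<n]) @
    concat (map (\<lambda>c. unary (n + 1 + g c)) [0..<Suc k]) @
    concat (map (\<lambda>r. concat (map (\<lambda>x. unary (n + k + 2 + r * Suc m + h r x)) [0..<Suc m])) [0..<k]) @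
    [Hash]"

lemma concat_map_concat_map:
  "concat (map f (concat (map g xs))) = concat (map (\<lambda>x. concat (map f (g x))) xs)"
  by (induction xs) auto

lemma enc_perm_lift:
  assumes "\<And>t. t < n \<Longrightarrow> H (Orig (Suc t)) = Orig (f t)" "\<And>c. H (Pos c) = Pos (g c)"
    and "\<And>r x. H (Reg r x) = Reg r (h r x)"
  shows "enc_perm (num_points n k m) (lift n k m H) = gadget_word n k m f g h"
proof -
  have "map (\<lambda>i. unary (lift n k m H i)) [1..<Suc (num_points n k m)] =
      map (\<lambda>p. unary (number n k m (H p))) (points n k m)"
    unfolding map_number_points[symmetric] map_map
    by (rule map_cong) (simp_all add: lift_number)
  moreover have "map Orig [1..<Suc n] = map (\<lambda>t. Orig (Suc t)) [0..<n]"
    by (simp add: map_Suc_upt[symmetric] comp_def del: upt_Suc)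
  ultimately have "enc_perm (num_points n k m) (lift n k m H) =
      concat (map (\<lambda>p. unary (number n k m (H p)))
        (map (\<lambda>t. Orig (Suc t)) [0..<n] @ map Pos [0..<Suc k] @
         concat (map (\<lambda>r. map (Reg r) [0..<Suc m]) [0..<k]))) @ [Hash]"
    unfolding enc_perm_def unary_def points_def by (simp only:)
  moreover have "map (\<lambda>t. unary (number n k m (H (Orig (Suc t))))) [0..<n] = map (\<lambda>t. unary (f t)) [0..<n]"
    using assms(1) by (intro map_cong) auto
  moreover have "concat (map (\<lambda>p. unary (number n k m (H p))) (concat (map (\<lambda>r. map (Reg r) [0..<Suc m]) [0..<l]))) =
      concat (map (\<lambda>r. concat (map (\<lambda>x. unary (n + k + 2 + r * Suc m + h r x)) [0..<Suc m])) [0..<l])" for l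
    unfolding concat_map_concat_map map_map by (simp add: assms(3) comp_def del: upt_Suc mult_Suc_right)
  ultimately show ?thesis
    unfolding gadget_word_def
    by (simp add: assms(2) comp_def del: upt_Suc mult_Suc_right)
qed

definition label_list :: "nat \<Rightarrow> nat \<Rightarrow> nat \<Rightarrow> (nat \<times> nat \<times> nat) list" where
  "label_list s k m = concat (map (\<lambda>j. concat (map (\<lambda>i. concat (map (\<lambda>i'.
    if i + s \<le> i' then [(j, i, i')] else []) [0..<Suc m])) [0..<m])) [0..<k])"

lemma set_label_list: "set (label_list s k m) = labels s k m"
  by (auto simp: label_list_def labels_def less_Suc_eq_le simp del: upt_Suc split: if_splits)

definition ordered :: "nat \<Rightarrow> letter list \<Rightarrow> nat \<Rightarrow> letter list" where
  "ordered s u k = (if valid u then let n = size_of u; m = blocks_of u - 1 in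
      replicate (num_points n k m) Stroke @ [Hash] @
      gadget_word n k m (value_of u) (\<lambda>c. if c = 0 then k else if c \<le> k then c - 1 else c) (\<lambda>r x. x) @
      concat (map (\<lambda>j. concat (map (\<lambda>i. concat (map (\<lambda>i'.
        if i + s \<le> i' then
          gadget_word n k m (\<lambda>t. value_of u (Suc i * n + t)) (transpose j (Suc j))
            (\<lambda>r. reg_action m r (j, i, i'))
        else []) [0..<Suc m])) [0..<m])) [0..<k])
    else [])"

definition ordered_instance where
  "ordered_instance s n a as k = enc_instance (num_points n k (length as))
    (lift n k (length as) (target a k))
    (map (\<lambda>q. lift n k (length as) (gadget as q)) (label_list s k (length as)))"

lemma ordered_enc_instance:
  assumes "instance_of n a as"
  shows "ordered s (enc_instance n a as) k = ordered_instance s n a as k"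
proof -
  let ?u = "enc_instance n a as" and ?m = "length as"
  have n: "1 \<le> n" using assms by (simp add: instance_of_def)
  have t: "enc_perm (num_points n k ?m) (lift n k ?m (target a k)) = gadget_word n k ?m (value_of ?u)
      (\<lambda>c. if c = 0 then k else if c \<le> k then c - 1 else c) (\<lambda>r x. x)"
    using decode_instance(3)[OF n, of 0 as _ a] by (intro enc_perm_lift) simp_all
  have g: "enc_perm (num_points n k ?m) (lift n k ?m (gadget as (j, i, i'))) =
      gadget_word n k ?m (\<lambda>t. value_of ?u (Suc i * n + t)) (transpose j (Suc j))
        (\<lambda>r. reg_action ?m r (j, i, i'))" if "i < ?m" for i j i'
    using decode_instance(3)[OF n, of "Suc i" as _ a] that by (intro enc_perm_lift) simp_all
  have "concat (map (enc_perm (num_points n k ?m))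
      (map (\<lambda>q. lift n k ?m (gadget as q)) (label_list s k ?m))) =
    concat (map (\<lambda>j. concat (map (\<lambda>i. concat (map (\<lambda>i'.
        if i + s \<le> i' then enc_perm (num_points n k ?m) (lift n k ?m (gadget as (j, i, i')))
        else []) [0..<Suc ?m])) [0..<?m])) [0..<k])"
    unfolding label_list_def map_map concat_map_concat_map
    by (intro arg_cong[of _ _ concat] map_cong refl) simp
  also have "\<dots> = concat (map (\<lambda>j. concat (map (\<lambda>i. concat (map (\<lambda>i'.
        if i + s \<le> i' then gadget_word n k ?m (\<lambda>t. value_of ?u (Suc i * n + t)) (transpose j (Suc j))
            (\<lambda>r. reg_action ?m r (j, i, i'))
        else []) [0..<Suc ?m])) [0..<?m])) [0..<k])"
    using g by (intro arg_cong[of _ _ concat] map_cong refl) auto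
  finally show ?thesis
    unfolding ordered_def ordered_instance_def decode_instance(1,2)[OF n]
      enc_instance_def[of "num_points n k ?m"] Let_def
      diff_Suc_1
    using valid_enc_instance[OF assms] t by (simp del: upt_Suc mult_Suc)
qed

text \<open>\<open>L\<close> stands for knapsack or subset sum; this is the sole interface to
  either, so one proof covers both.\<close>

lemma copies_correct:
  assumes "s \<le> 1" and L: "\<And>n a as k. instance_of n a as \<Longrightarrow>
    (enc_instance n a as, k) \<in> L \<longleftrightarrow> gap_solvable s k a as" "\<And>u k. (u, k) \<in> L \<Longrightarrow> valid u"
  shows "(u, k) \<in> pF_sym \<longleftrightarrow> (copies u k, k) \<in> L"
proof (cases "valid u")
  case True
  then obtain n a as where u: "instance_of n a as" "u = enc_instance n a as" by (rule validE)
  then have "instance_of n a (concat (replicate k as))" by (auto simp: instance_of_def)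
  then show ?thesis
    unfolding u(2) copies_enc_instance[OF u(1)] pF_sym_iff[OF u(1)]
    using L(1) gap_solvable_copies[OF assms(1)] by blast
next
  case False
  then show ?thesis
    using problems_valid(1) L(2) empty_not_valid by (auto simp: copies_def)
qed

lemma ordered_correct:
  assumes "s \<le> 1" and L: "\<And>n a as k. instance_of n a as \<Longrightarrow>
    (enc_instance n a as, k) \<in> L \<longleftrightarrow> gap_solvable s k a as" "\<And>u k. (u, k) \<in> L \<Longrightarrow> valid u"
  shows "(u, k) \<in> L \<longleftrightarrow> (ordered s u k, k) \<in> pF_sym"
proof (cases "valid u")
  case True
  then obtain n a as where u: "instance_of n a as" "u = enc_instance n a as" by (rule validE)
  let ?m = "length as"
  have perm: "a permutes {1..n}" "\<And>f. f \<in> set as \<Longrightarrow> f permutes {1..n}"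
    using u(1) by (auto simp: instance_of_def carrier_sym_lr)
  have "lift n k ?m (gadget as q) permutes {1..num_points n k ?m}" if "q \<in> labels s k ?m" for q
  proof (rule lift_permutes)
    have "as ! fst (snd q) \<in> set as" using that by (auto simp: labels_def)
    then show "inj (gadget as q)" using perm(2) by (intro inj_gadget) auto
    show "gadget as q ` set (points n k ?m) \<subseteq> set (points n k ?m)"
      using that perm(2) by (rule gadget_points)
  qed
  moreover have "lift n k ?m (target a k) permutes {1..num_points n k ?m}"
    using inj_target target_points perm(1) by (intro lift_permutes)
  ultimately have "instance_of (num_points n k ?m) (lift n k ?m (target a k))
      (map (\<lambda>q. lift n k ?m (gadget as q)) (label_list s k ?m))"
    by (auto simp: instance_of_def carrier_sym_lr set_label_list num_points_def)
  from pF_sym_iff[OF this] show ?thesis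
    unfolding u(2) ordered_enc_instance[OF u(1)] ordered_instance_def L(1)[OF u(1)]
    using gadget_correct[OF perm assms(1) set_label_list] by simp
next
  case False
  then show ?thesis
    using problems_valid(1) L(2) empty_not_valid by (auto simp: ordered_def)
qed

section \<open>Expressions for the reductions\<close>

text \<open>Together with \<open>holds\<close> this gives each expression a numerical and a logical
  reading, so that conditions and counters can be simplified without looking at words.\<close>

definition nv :: "exp \<Rightarrow> (nat \<Rightarrow> nat list) \<Rightarrow> nat" where
  "nv e \<sigma> = length (ev e \<sigma>)"

definition holds :: "exp \<Rightarrow> (nat \<Rightarrow> nat list) \<Rightarrow> bool" where
  "holds e \<sigma> \<longleftrightarrow> ev e \<sigma> \<noteq> []"

abbreviation letter_sym :: "letter \<Rightarrow> nat" where
  "letter_sym x \<equiv> Suc (to_nat x)"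

lemma tape_word_simps [simp]:
  "tape_word [] = []"
  "tape_word (x # u) = Suc (to_nat x) # tape_word u"
  "tape_word (u @ v) = tape_word u @ tape_word v"
  "tape_word (replicate n x) = replicate n (Suc (to_nat x))"
  "length (tape_word u) = length u"
  by (simp_all add: tape_word_def)

lemma tape_word_concat [simp]: "tape_word (concat us) = concat (map tape_word us)"
  by (induction us) auto

lemma nth_tape_word: "i < length u \<Longrightarrow> tape_word u ! i = Suc (to_nat (u ! i))"
  by (simp add: tape_word_def)

abbreviation "One \<equiv> Sym 1"
abbreviation "Inc e \<equiv> App e One"
definition "Neg e = Ite e Emp One"
text \<open>The result is the word of \<open>b\<close>, not a mere truth value, so a conjunction
  also serves as a guard.\<close>

definition "And a b = Ite a b Emp"
definition "Equal a b = And (Neg (Less a b)) (Neg (Less b a))"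
text \<open>A \<open>For\<close> is nonempty iff one of its rounds is, so it is a bounded
  existential quantifier; this is its dual.\<close>

definition "Forall x a b = Neg (For x a (Neg b))"
abbreviation "Times a b \<equiv> For 20 a b"
text \<open>Counts the rounds with a nonzero counter, that is, all but the first.\<close>

definition "Pred a = For 21 a (And (Var 21) One)"

lemma nv_simps [simp]:
  "nv Emp \<sigma> = 0"
  "nv (Sym c) \<sigma> = 1"
  "nv (Var x) \<sigma> = length (\<sigma> x)"
  "nv (App a b) \<sigma> = nv a \<sigma> + nv b \<sigma>"
  "nv (For x a b) \<sigma> = (\<Sum>i<nv a \<sigma>. nv b (\<sigma>(x := replicate i 1)))"
  "nv (Bind x a b) \<sigma> = nv b (\<sigma>(x := ev a \<sigma>))"
  "nv (Ite d a b) \<sigma> = (if holds d \<sigma> then nv a \<sigma> else nv b \<sigma>)"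
  by (simp_all add: nv_def holds_def length_concat comp_def interv_sum_list_conv_sum_set_nat
      atLeast0LessThan)

lemma holds_simps [simp]:
  "\<not> holds Emp \<sigma>"
  "holds (Sym c) \<sigma>"
  "holds (Var x) \<sigma> \<longleftrightarrow> \<sigma> x \<noteq> []"
  "holds (App a b) \<sigma> \<longleftrightarrow> holds a \<sigma> \<or> holds b \<sigma>"
  "holds (For x a b) \<sigma> \<longleftrightarrow> (\<exists>i<nv a \<sigma>. holds b (\<sigma>(x := replicate i 1)))"
  "holds (Bind x a b) \<sigma> \<longleftrightarrow> holds b (\<sigma>(x := ev a \<sigma>))"
  "holds (Ite d a b) \<sigma> \<longleftrightarrow> (if holds d \<sigma> then holds a \<sigma> else holds b \<sigma>)"
  "holds (Less a b) \<sigma> \<longleftrightarrow> nv a \<sigma> < nv b \<sigma>"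
  "holds (At a i c) \<sigma> \<longleftrightarrow> nv i \<sigma> < nv a \<sigma> \<and> ev a \<sigma> ! nv i \<sigma> = c"
  by (auto simp: nv_def holds_def)

lemma holds_connectives [simp]:
  "holds (Neg e) \<sigma> \<longleftrightarrow> \<not> holds e \<sigma>"
  "holds (And a b) \<sigma> \<longleftrightarrow> holds a \<sigma> \<and> holds b \<sigma>"
  "holds (Equal a b) \<sigma> \<longleftrightarrow> nv a \<sigma> = nv b \<sigma>"
  "holds (Forall x a b) \<sigma> \<longleftrightarrow> (\<forall>i<nv a \<sigma>. holds b (\<sigma>(x := replicate i 1)))"
  by (auto simp: Neg_def And_def Equal_def Forall_def)

lemma nv_connectives [simp]:
  "nv (Neg e) \<sigma> = (if holds e \<sigma> then 0 else 1)"
  "nv (And a b) \<sigma> = (if holds a \<sigma> then nv b \<sigma> else 0)"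
  "nv (Equal a b) \<sigma> = (if nv a \<sigma> = nv b \<sigma> then 1 else 0)"
  by (auto simp: Neg_def And_def Equal_def)

lemma syms_connectives [simp]:
  "syms (Neg e) = insert 1 (syms e)"
  "syms (And a b) = syms a \<union> syms b"
  "syms (Equal a b) = insert 1 (syms a \<union> syms b)"
  "syms (Forall x a b) = insert 1 (syms a \<union> syms b)"
  by (auto simp: Neg_def And_def Equal_def Forall_def)

lemma ev_For_nv: "ev (For x a b) \<sigma> = concat (map (\<lambda>i. ev b (\<sigma>(x := replicate i 1))) [0..<nv a \<sigma>])"
  by (simp add: nv_def)

lemma ev_Ite_holds: "ev (Ite c a b) \<sigma> = (if holds c \<sigma> then ev a \<sigma> else ev b \<sigma>)"
  by (simp add: holds_def)

lemma nv_Pred [simp]: "nv (Pred a) \<sigma> = nv a \<sigma> - 1"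
proof -
  have "(\<Sum>i<l. if replicate i (1::nat) \<noteq> [] then 1 else 0) = l - (1::nat)" for l
    by (induction l) auto
  then show ?thesis by (simp add: Pred_def cong: if_cong)
qed

lemma syms_Pred [simp]: "syms (Pred a) = insert 1 (syms a)"
  by (auto simp: Pred_def)

lemma count_positions_sum:
  "count_positions Q u = (\<Sum>p<length u. if Q (take p u) (u ! p) then 1 else 0)"
proof -
  have "length (filter P [0..<n]) = (\<Sum>p<n. if P p then 1 else 0)" for P :: "nat \<Rightarrow> bool" and n
    by (induction n) auto
  then show ?thesis by (simp add: count_positions_def)
qed

lemma count_list_take:
  "p \<le> length u \<Longrightarrow> count_list (take p u) x = (\<Sum>q<p. if u ! q = x then 1 else 0)"
  by (induction p) (auto simp: take_Suc_conv_app_nth)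

lemma in_set_take: "p \<le> length u \<Longrightarrow> x \<in> set (take p u) \<longleftrightarrow> (\<exists>q<p. u ! q = x)"
  by (auto simp: in_set_conv_nth)

text \<open>
  Variable 0 is the word, 1 the parameter, 2 the size, 3 the number of blocks, 4 the number of
  generators. Variables from 20 on are bound.
\<close>

abbreviation "is_letter e i x \<equiv> At e i (letter_sym x)"

text \<open>Here \<open>p\<close> is the index of a variable that holds a position in unary. One
  letter is emitted per earlier hash; only nonemptiness matters.\<close>

definition hash_before :: "nat \<Rightarrow> exp" where
  "hash_before p = For 30 (Var p) (is_letter (Var 0) (Var 30) Hash)"

definition commas_before :: "nat \<Rightarrow> exp" where
  "commas_before p = For 30 (Var p) (is_letter (Var 0) (Var 30) Comma)"

definition degree_exp :: exp where
  "degree_exp = For 31 (Var 0) (And (is_letter (Var 0) (Var 31) Stroke) (Neg (hash_before 31)))"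

text \<open>\<open>hash_before\<close> may emit several letters; the guard \<open>One\<close> makes
  each counted position contribute exactly one.\<close>

definition blocks_exp :: exp where
  "blocks_exp = For 31 (Var 0) (And (is_letter (Var 0) (Var 31) Hash) (And (hash_before 31) One))"

definition value_exp :: "exp \<Rightarrow> exp" where
  "value_exp e = Bind 32 e (For 31 (Var 0) (And (is_letter (Var 0) (Var 31) Stroke)
     (And (hash_before 31) (Equal (commas_before 31) (Var 32)))))"

lemma nv_At: "nv (At a i c) \<sigma> = (if nv i \<sigma> < nv a \<sigma> \<and> ev a \<sigma> ! nv i \<sigma> = c then 1 else 0)"
  by (simp add: nv_def)

lemma holds_hash_before:
  assumes "\<sigma> 0 = tape_word u" "length (\<sigma> p) \<le> length u" "p \<noteq> 30"
  shows "holds (hash_before p) \<sigma> \<longleftrightarrow> Hash \<in> set (take (length (\<sigma> p)) u)"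
  using assms by (auto simp: hash_before_def in_set_take nth_tape_word)

lemma nv_commas_before:
  assumes "\<sigma> 0 = tape_word u" "length (\<sigma> p) \<le> length u" "p \<noteq> 30"
  shows "nv (commas_before p) \<sigma> = count_list (take (length (\<sigma> p)) u) Comma"
  using assms by (auto simp: commas_before_def count_list_take nth_tape_word nv_At intro!: sum.cong)

lemma nv_degree_exp: "\<sigma> 0 = tape_word u \<Longrightarrow> nv degree_exp \<sigma> = size_of u"
  by (auto simp: degree_exp_def size_of_def count_positions_sum holds_hash_before[of _ u]
      nth_tape_word intro!: sum.cong)

lemma nv_blocks_exp: "\<sigma> 0 = tape_word u \<Longrightarrow> nv blocks_exp \<sigma> = blocks_of u"
  by (auto simp: blocks_exp_def blocks_of_def count_positions_sum holds_hash_before[of _ u]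
      nth_tape_word intro!: sum.cong)

lemma nv_value_exp: "\<sigma> 0 = tape_word u \<Longrightarrow> nv (value_exp e) \<sigma> = value_of u (nv e \<sigma>)"
  by (auto simp: value_exp_def value_of_def count_positions_sum holds_hash_before[of _ u]
      nv_commas_before[of _ u] nth_tape_word nv_def[symmetric] intro!: sum.cong)

definition unary_exp :: "exp \<Rightarrow> exp" where
  "unary_exp e = App (For 33 e (Sym (letter_sym Stroke))) (Sym (letter_sym Comma))"

lemma ev_unary_exp: "ev (unary_exp e) \<sigma> = tape_word (unary (nv e \<sigma>))"
  by (simp add: unary_exp_def unary_def nv_def map_replicate_const)

definition block_exp :: "exp \<Rightarrow> exp" where
  "block_exp e = App (For 34 (Var 2) (unary_exp e)) (Sym (letter_sym Hash))"

lemma ev_block_exp: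
  "length (\<sigma> 2) = n \<Longrightarrow>
    ev (block_exp e) \<sigma> = tape_word (block n (\<lambda>j. nv e (\<sigma>(34 := replicate j 1))))"
  by (simp add: block_exp_def block_def ev_unary_exp comp_def del: tape_word_simps(4))

definition header_exp :: "exp \<Rightarrow> exp" where
  "header_exp e = App (For 35 e (Sym (letter_sym Stroke))) (Sym (letter_sym Hash))"

lemma ev_header_exp: "ev (header_exp e) \<sigma> = tape_word (replicate (nv e \<sigma>) Stroke @ [Hash])"
  by (simp add: header_exp_def nv_def map_replicate_const)

definition entry_exp :: "exp \<Rightarrow> exp \<Rightarrow> exp" where
  "entry_exp b j = value_exp (App (Times b (Var 2)) j)"

lemma nv_entry_exp:
  "\<sigma> 0 = tape_word u \<Longrightarrow> length (\<sigma> 2) = n \<Longrightarrow>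
    nv (entry_exp b j) \<sigma> = value_of u (nv b \<sigma> * n + nv j \<sigma>)"
  by (simp add: entry_exp_def nv_value_exp)

definition code_exp :: exp where
  "code_exp = App (header_exp (Var 2)) (For 36 (Var 3) (block_exp (entry_exp (Var 36) (Var 34))))"

definition decoded :: "letter list \<Rightarrow> (nat \<Rightarrow> nat list) \<Rightarrow> bool" where
  "decoded u \<sigma> \<longleftrightarrow> \<sigma> 0 = tape_word u \<and> length (\<sigma> 2) = size_of u \<and> length (\<sigma> 3) = blocks_of u"

lemma ev_code_exp:
  assumes "decoded u \<sigma>"
  shows "ev code_exp \<sigma> = tape_word (code (size_of u) (blocks_of u) (value_of u))"
  using assms
  by (simp add: decoded_def code_exp_def code_def ev_header_exp ev_block_exp nv_entry_exp[of _ u]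
      ev_For_nv comp_def del: ev.simps(5))

text \<open>\<open>Equal\<close> compares lengths only, so words are compared position by position.
  \<open>App\<close> acts as the disjunction over the three letters.\<close>

definition same_exp :: "exp \<Rightarrow> exp" where
  "same_exp e = Bind 37 e (And (Equal (Var 0) (Var 37)) (Forall 38 (Var 0)
     (App (And (is_letter (Var 0) (Var 38) Stroke) (is_letter (Var 37) (Var 38) Stroke))
     (App (And (is_letter (Var 0) (Var 38) Comma) (is_letter (Var 37) (Var 38) Comma))
       (And (is_letter (Var 0) (Var 38) Hash) (is_letter (Var 37) (Var 38) Hash))))))"

lemma holds_same_exp:
  fixes u w :: "letter list"
  assumes "\<sigma> 0 = tape_word u" "ev e \<sigma> = tape_word w"
  shows "holds (same_exp e) \<sigma> \<longleftrightarrow> u = w"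
proof (cases "length u = length w")
  case True
  have "x = Stroke \<and> y = Stroke \<or> x = Comma \<and> y = Comma \<or> x = Hash \<and> y = Hash \<longleftrightarrow> x = y" for x y
    by (cases x; cases y) simp_all
  then show ?thesis
    using assms True by (simp add: same_exp_def nth_tape_word list_eq_iff_nth_eq)
next
  case False
  then show ?thesis using assms by (auto simp: same_exp_def)
qed

definition valid_exp :: exp where
  "valid_exp = And (Var 2) (And (Var 3) (And (same_exp code_exp)
     (Forall 36 (Var 3) (Forall 34 (Var 2)
       (And (entry_exp (Var 36) (Var 34)) (And (Neg (Less (Var 2) (entry_exp (Var 36) (Var 34))))
         (Forall 39 (Var 34) (Neg (Equal (entry_exp (Var 36) (Var 39)) (entry_exp (Var 36) (Var 34)))))))))))"

lemma holds_nv: "holds e \<sigma> \<longleftrightarrow> 0 < nv e \<sigma>"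
  by (simp add: holds_def nv_def)

lemma holds_valid_exp:
  assumes "decoded u \<sigma>"
  shows "holds valid_exp \<sigma> \<longleftrightarrow> valid u"
proof -
  have \<sigma>: "\<sigma> 0 = tape_word u" "length (\<sigma> 2) = size_of u" "length (\<sigma> 3) = blocks_of u"
    using assms by (simp_all add: decoded_def)
  note entry = nv_entry_exp[where u = u and n = "size_of u"]
  have "holds valid_exp \<sigma> \<longleftrightarrow> \<sigma> 2 \<noteq> [] \<and> \<sigma> 3 \<noteq> [] \<and> u = code (size_of u) (blocks_of u) (value_of u) \<and>
    (\<forall>b<blocks_of u. \<forall>j<size_of u. 0 < value_of u (b * size_of u + j) \<and>
      value_of u (b * size_of u + j) \<le> size_of u \<and>
      (\<forall>i<j. value_of u (b * size_of u + i) \<noteq> value_of u (b * size_of u + j)))"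
    using \<sigma> by (simp add: valid_exp_def holds_same_exp[OF \<sigma>(1) ev_code_exp[OF assms]] entry
        holds_nv[of "entry_exp _ _"] not_less nat_neq_iff cong: if_cong)
  moreover have "\<sigma> 2 \<noteq> [] \<longleftrightarrow> 0 < size_of u" "\<sigma> 3 \<noteq> [] \<longleftrightarrow> 0 < blocks_of u"
    using \<sigma> by (simp_all flip: \<sigma>)
  ultimately show ?thesis
    unfolding valid_def Let_def by simp
qed

lemma syms_value_exp [simp]: "0 \<notin> syms (value_exp e) \<longleftrightarrow> 0 \<notin> syms e"
  by (simp add: value_exp_def hash_before_def commas_before_def)

lemma syms_constructs [simp]:
  "0 \<notin> syms (unary_exp e) \<longleftrightarrow> 0 \<notin> syms e"
  "0 \<notin> syms (block_exp e) \<longleftrightarrow> 0 \<notin> syms e"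
  "0 \<notin> syms (header_exp e) \<longleftrightarrow> 0 \<notin> syms e"
  "0 \<notin> syms (entry_exp a b) \<longleftrightarrow> 0 \<notin> syms a \<and> 0 \<notin> syms b"
  by (auto simp: unary_exp_def block_exp_def header_exp_def entry_exp_def)

lemma syms_valid_exp: "0 \<notin> syms valid_exp"
  by (simp add: valid_exp_def same_exp_def code_exp_def)

text \<open>The sizes are computed once and kept in variables while \<open>e\<close> runs; the guard
  in front of \<open>e\<close> yields the empty word on malformed input.\<close>

lemma definable_on_valid:
  assumes "0 \<notin> syms e"
    and "\<And>\<sigma> u k. decoded u \<sigma> \<Longrightarrow> length (\<sigma> 1) = k \<Longrightarrow> length (\<sigma> 4) = blocks_of u - 1 \<Longrightarrow>
      ev e \<sigma> = tape_word (F u k)"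
  shows "definable (\<lambda>u k. if valid u then F u k else [])"
proof -
  let ?e = "Bind 2 degree_exp (Bind 3 blocks_exp (Bind 4 (Pred (Var 3)) (And valid_exp e)))"
  have "0 \<notin> syms ?e"
    using assms(1) syms_valid_exp by (simp add: degree_exp_def blocks_exp_def hash_before_def)
  moreover have "ev ?e (input_env u k) = tape_word (if valid u then F u k else [])" for u k
  proof -
    define s2 where "s2 = (input_env u k)(2 := ev degree_exp (input_env u k))"
    define s3 where "s3 = s2(3 := ev blocks_exp s2)"
    define s4 where "s4 = s3(4 := ev (Pred (Var 3)) s3)"
    have 0: "input_env u k 0 = tape_word u" "input_env u k 1 = tape_num k"
      by (simp_all add: input_env_def)
    have 2: "s2 0 = tape_word u" "s2 1 = tape_num k" "length (s2 2) = size_of u"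
      using 0 nv_degree_exp[of "input_env u k" u] by (simp_all add: s2_def nv_def)
    have 3: "s3 0 = tape_word u" "s3 1 = tape_num k" "length (s3 2) = size_of u"
        "length (s3 3) = blocks_of u"
      using 2 nv_blocks_exp[of s2 u] by (simp_all add: s3_def nv_def)
    have "length (ev (Pred (Var 3)) s3) = blocks_of u - 1"
      using nv_Pred[of "Var 3" s3] 3(4) by (simp only: nv_def ev.simps)
    then have 4: "decoded u s4" "length (s4 1) = k" "length (s4 4) = blocks_of u - 1"
      using 3 by (simp_all add: s4_def decoded_def tape_num_def)
    have "ev ?e (input_env u k) = ev (And valid_exp e) s4"
      by (simp only: ev.simps s4_def s3_def s2_def)
    also have "\<dots> = (if valid u then ev e s4 else [])"
      using holds_valid_exp[OF 4(1)] by (simp add: And_def holds_def)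
    finally show ?thesis using assms(2)[OF 4] by simp
  qed
  ultimately show ?thesis unfolding definable_def by blast
qed

section \<open>The two reductions as expressions\<close>

lemma definable_copies: "definable copies"
proof -
  let ?e = "App (header_exp (Var 2)) (App (block_exp (value_exp (Var 34)))
    (For 40 (Var 1) (For 36 (Var 4) (block_exp (entry_exp (Inc (Var 36)) (Var 34))))))"
  have "definable (\<lambda>u k. if valid u then
      replicate (size_of u) Stroke @ [Hash] @ block (size_of u) (value_of u) @
      concat (map (\<lambda>_. concat (map (\<lambda>b. block (size_of u) (\<lambda>j. value_of u (Suc b * size_of u + j)))
        [0..<blocks_of u - 1])) [0..<k])
    else [])"
  proof (rule definable_on_valid[of ?e])
    fix \<sigma> u k
    assume "decoded u \<sigma>" and k: "length (\<sigma> 1) = k" and m: "length (\<sigma> 4) = blocks_of u - 1"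
    then have \<sigma>: "\<sigma> 0 = tape_word u" "length (\<sigma> 2) = size_of u"
      by (simp_all add: decoded_def)
    have "ev (block_exp (value_exp (Var 34))) \<sigma> = tape_word (block (size_of u) (value_of u))"
      using \<sigma> by (simp add: ev_block_exp nv_value_exp[of _ u])
    moreover have "ev (block_exp (entry_exp (Inc (Var 36)) (Var 34))) (\<sigma>(40 := v, 36 := replicate b 1)) =
        tape_word (block (size_of u) (\<lambda>j. value_of u (Suc b * size_of u + j)))" for v b
      using \<sigma> by (simp add: ev_block_exp nv_entry_exp[of _ u])
    ultimately show "ev ?e \<sigma> = tape_word (replicate (size_of u) Stroke @ [Hash] @ block (size_of u) (value_of u) @
      concat (map (\<lambda>_. concat (map (\<lambda>b. block (size_of u) (\<lambda>j. value_of u (Suc b * size_of u + j)))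
        [0..<blocks_of u - 1])) [0..<k]))"
      using \<sigma>(2) k m by (simp add: ev_header_exp comp_def del: mult_Suc)
  qed simp
  then show ?thesis unfolding copies_def .
qed

text \<open>\<open>f\<close>, \<open>g\<close> and \<open>h\<close> describe the action on a single
  point, whose coordinates the loops supply: variable 34 for an original point, 43 for a cell of the
  track, 44 and 45 for a register and its cell.\<close>

definition gadget_exp :: "exp \<Rightarrow> exp \<Rightarrow> exp \<Rightarrow> exp" where
  "gadget_exp f g h = App (For 34 (Var 2) (unary_exp f)) (App
     (For 43 (Inc (Var 1)) (unary_exp (App (Var 2) (App One g)))) (App
     (For 44 (Var 1) (For 45 (Inc (Var 4))
       (unary_exp (App (Inc (Inc (App (Var 2) (Var 1)))) (App (Times (Var 44) (Inc (Var 4))) h)))))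
     (Sym (letter_sym Hash))))"

lemma ev_gadget_exp:
  assumes "length (\<sigma> 2) = n" "length (\<sigma> 1) = k" "length (\<sigma> 4) = m"
    and "\<And>t. nv f (\<sigma>(34 := replicate t 1)) = f' t" "\<And>c. nv g (\<sigma>(43 := replicate c 1)) = g' c"
    and "\<And>r x. nv h (\<sigma>(44 := replicate r 1, 45 := replicate x 1)) = h' r x"
  shows "ev (gadget_exp f g h) \<sigma> = tape_word (gadget_word n k m f' g' h')"
proof -
  have 1: "ev (For 34 (Var 2) (unary_exp f)) \<sigma> = tape_word (concat (map (\<lambda>t. unary (f' t)) [0..<n]))"
    using assms by (simp add: ev_unary_exp comp_def)
  have 2: "ev (For 43 (Inc (Var 1)) (unary_exp (App (Var 2) (App One g)))) \<sigma> =
      tape_word (concat (map (\<lambda>c. unary (n + 1 + g' c)) [0..<Suc k]))"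
    using assms by (simp add: ev_unary_exp comp_def del: upt_Suc)
  have "nv (App (Inc (Inc (App (Var 2) (Var 1)))) (App (Times (Var 44) (Inc (Var 4))) h))
      (\<sigma>(44 := replicate r 1, 45 := replicate x 1)) = n + k + 2 + r * Suc m + h' r x" for r x
    using assms by simp
  then have 3: "ev (For 44 (Var 1) (For 45 (Inc (Var 4))
       (unary_exp (App (Inc (Inc (App (Var 2) (Var 1)))) (App (Times (Var 44) (Inc (Var 4))) h))))) \<sigma> =
    tape_word (concat (map (\<lambda>r. concat (map (\<lambda>x. unary (n + k + 2 + r * Suc m + h' r x)) [0..<Suc m])) [0..<k]))"
    using assms(1-3) by (simp add: ev_unary_exp comp_def del: upt_Suc nv_simps mult_Suc_right)
  show ?thesis
    unfolding gadget_exp_def gadget_word_def ev.simps(4) 1 2 3 by simp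
qed

definition transpose_exp :: "exp \<Rightarrow> exp \<Rightarrow> exp \<Rightarrow> exp" where
  "transpose_exp a b c = Ite (Equal c a) b (Ite (Equal c b) a c)"

lemma nv_transpose_exp [simp]:
  "nv (transpose_exp a b c) \<sigma> = transpose (nv a \<sigma>) (nv b \<sigma>) (nv c \<sigma>)"
  by (simp add: transpose_exp_def transpose_def)

text \<open>Variables 46, 47 and 48 hold the label \<open>(j, i, i')\<close>, and variable 4 the
  sentinel \<open>m\<close>.\<close>

definition reg_exp :: exp where
  "reg_exp = Ite (Equal (Var 44) (Var 46)) (transpose_exp (Var 4) (Var 48) (Var 45))
    (Ite (Equal (Inc (Var 44)) (Var 46)) (transpose_exp (Var 4) (Var 47) (Var 45)) (Var 45))"

definition token_exp :: exp where
  "token_exp = Ite (Var 43) (Ite (Less (Var 1) (Var 43)) (Var 43) (Pred (Var 43))) (Var 1)"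

definition num_points_exp :: exp where
  "num_points_exp = App (Var 2) (App (Inc (Var 1)) (Times (Var 1) (Inc (Var 4))))"

fun const_exp :: "nat \<Rightarrow> exp" where
  "const_exp 0 = Emp"
| "const_exp (Suc n) = Inc (const_exp n)"

lemma nv_const_exp [simp]: "nv (const_exp n) \<sigma> = n"
  by (induction n) auto

lemma syms_const_exp [simp]: "0 \<notin> syms (const_exp n)"
  by (induction n) auto

lemma definable_ordered: "definable (ordered s)"
proof -
  let ?t = "gadget_exp (value_exp (Var 34)) token_exp (Var 45)"
  let ?g = "gadget_exp (entry_exp (Inc (Var 47)) (Var 34)) (transpose_exp (Var 46) (Inc (Var 46)) (Var 43)) reg_exp"
  let ?e = "App (header_exp num_points_exp) (App ?t
    (For 46 (Var 1) (For 47 (Var 4) (For 48 (Inc (Var 4))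
      (Ite (Less (Var 48) (App (Var 47) (const_exp s))) Emp ?g)))))"
  have "definable (\<lambda>u k. if valid u then let n = size_of u; m = blocks_of u - 1 in
      replicate (num_points n k m) Stroke @ [Hash] @
      gadget_word n k m (value_of u) (\<lambda>c. if c = 0 then k else if c \<le> k then c - 1 else c) (\<lambda>r x. x) @
      concat (map (\<lambda>j. concat (map (\<lambda>i. concat (map (\<lambda>i'.
        if i + s \<le> i' then
          gadget_word n k m (\<lambda>t. value_of u (Suc i * n + t)) (transpose j (Suc j))
            (\<lambda>r. reg_action m r (j, i, i'))
        else []) [0..<Suc m])) [0..<m])) [0..<k])
    else [])"
  proof (rule definable_on_valid[of ?e])
    show "0 \<notin> syms ?e"
      by (simp add: num_points_exp_def gadget_exp_def token_exp_def reg_exp_def transpose_exp_def)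
    fix \<sigma> u k
    assume dec: "decoded u \<sigma>" and k: "length (\<sigma> 1) = k" and m: "length (\<sigma> 4) = blocks_of u - 1"
    let ?n = "size_of u" and ?m = "blocks_of u - 1"
    have u: "\<sigma> 0 = tape_word u" and n: "length (\<sigma> 2) = ?n"
      using dec by (simp_all add: decoded_def)
    have h: "nv num_points_exp \<sigma> = num_points ?n k ?m"
      using n k m by (simp add: num_points_exp_def num_points_def)
    have t: "ev ?t \<sigma> = tape_word (gadget_word ?n k ?m (value_of u)
        (\<lambda>c. if c = 0 then k else if c \<le> k then c - 1 else c) (\<lambda>r x. x))"
    proof (rule ev_gadget_exp[OF n k m])
      show "nv token_exp (\<sigma>(43 := replicate c 1)) =
          (if c = 0 then k else if c \<le> k then c - 1 else c)" for c
        using k by (simp add: token_exp_def not_less[symmetric] cong: if_cong)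
    qed (use u in \<open>simp_all add: nv_value_exp[of _ u]\<close>)
    have g: "ev ?g (\<sigma>(46 := replicate j 1, 47 := replicate i 1, 48 := replicate i' 1)) =
        tape_word (gadget_word ?n k ?m (\<lambda>t. value_of u (Suc i * ?n + t)) (transpose j (Suc j))
            (\<lambda>r. reg_action ?m r (j, i, i')))" for j i i'
    proof (rule ev_gadget_exp)
      show "nv reg_exp (\<sigma>(46 := replicate j 1, 47 := replicate i 1, 48 := replicate i' 1,
          44 := replicate r 1, 45 := replicate x 1)) = reg_action ?m r (j, i, i') x" for r x
        using m by (simp add: reg_exp_def reg_action_def cong: if_cong)
    qed (use u n k m in \<open>simp_all add: nv_entry_exp[of _ u]\<close>)
    have "ev (For 46 (Var 1) (For 47 (Var 4) (For 48 (Inc (Var 4))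
        (Ite (Less (Var 48) (App (Var 47) (const_exp s))) Emp ?g)))) \<sigma> =
      tape_word (concat (map (\<lambda>j. concat (map (\<lambda>i. concat (map (\<lambda>i'.
        if i + s \<le> i' then
          gadget_word ?n k ?m (\<lambda>t. value_of u (Suc i * ?n + t)) (transpose j (Suc j))
            (\<lambda>r. reg_action ?m r (j, i, i'))
        else []) [0..<Suc ?m])) [0..<?m])) [0..<k]))"
    proof -
      have "ev (Ite (Less (Var 48) (App (Var 47) (const_exp s))) Emp ?g)
          (\<sigma>(46 := replicate j 1, 47 := replicate i 1, 48 := replicate i' 1)) =
        tape_word (if i + s \<le> i' then
          gadget_word ?n k ?m (\<lambda>t. value_of u (Suc i * ?n + t)) (transpose j (Suc j))
            (\<lambda>r. reg_action ?m r (j, i, i'))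
        else [])" for j i i'
        unfolding ev_Ite_holds by (simp add: g[unfolded One_nat_def] not_less del: mult_Suc cong: if_cong)
      then show ?thesis
        using k m by (simp add: ev_For_nv comp_def del: ev.simps(5,7) upt_Suc mult_Suc)
    qed
    then show "ev ?e \<sigma> = tape_word (let n = ?n; m = ?m in
      replicate (num_points n k m) Stroke @ [Hash] @
      gadget_word n k m (value_of u) (\<lambda>c. if c = 0 then k else if c \<le> k then c - 1 else c) (\<lambda>r x. x) @
      concat (map (\<lambda>j. concat (map (\<lambda>i. concat (map (\<lambda>i'.
        if i + s \<le> i' then
          gadget_word n k m (\<lambda>t. value_of u (Suc i * n + t)) (transpose j (Suc j))
            (\<lambda>r. reg_action m r (j, i, i'))
        else []) [0..<Suc m])) [0..<m])) [0..<k]))"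
      unfolding Let_def ev.simps(4) ev_header_exp h t by (simp only: tape_word_simps(3) append_assoc)
  qed
  then show ?thesis unfolding ordered_def[abs_def] .
qed

theorem theorem4p11:
  shows "pF_sym \<equiv>fpt pKS_sym \<and> pKS_sym \<equiv>fpt pSSS_sym"
proof -
  note KS = pKS_sym_iff problems_valid(2) and SSS = pSSS_sym_iff problems_valid(3)
  have F_KS: "pF_sym \<le>fpt pKS_sym"
    by (rule definable_fpt_le[OF definable_copies], rule copies_correct[of 0]) (use KS in auto)
  have KS_F: "pKS_sym \<le>fpt pF_sym"
    by (rule definable_fpt_le[OF definable_ordered[of 0]], rule ordered_correct) (use KS in auto)
  \<comment> \<open>The two problems are linked through factorization; both halves keep the
    parameter, so they compose as word functions with the same \<open>k\<close>.\<close>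
  have KS_SSS: "pKS_sym \<le>fpt pSSS_sym"
  proof (rule definable_fpt_le[OF definable_comp[OF definable_ordered[of 0] definable_copies]])
    fix u k
    have "(u, k) \<in> pKS_sym \<longleftrightarrow> (ordered 0 u k, k) \<in> pF_sym"
      by (rule ordered_correct) (use KS in auto)
    also have "\<dots> \<longleftrightarrow> (copies (ordered 0 u k) k, k) \<in> pSSS_sym"
      by (rule copies_correct[of 1]) (use SSS in auto)
    finally show "(u, k) \<in> pKS_sym \<longleftrightarrow> (copies (ordered 0 u k) k, k) \<in> pSSS_sym" .
  qed
  have SSS_KS: "pSSS_sym \<le>fpt pKS_sym"
  proof (rule definable_fpt_le[OF definable_comp[OF definable_ordered[of 1] definable_copies]])
    fix u k
    have "(u, k) \<in> pSSS_sym \<longleftrightarrow> (ordered 1 u k, k) \<in> pF_sym"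
      by (rule ordered_correct) (use SSS in auto)
    also have "\<dots> \<longleftrightarrow> (copies (ordered 1 u k) k, k) \<in> pKS_sym"
      by (rule copies_correct[of 0]) (use KS in auto)
    finally show "(u, k) \<in> pSSS_sym \<longleftrightarrow> (copies (ordered 1 u k) k, k) \<in> pKS_sym" .
  qed
  show ?thesis
    unfolding fpt_equiv_def using F_KS KS_F KS_SSS SSS_KS by blast
qed

end
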